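(* Suppose $A\,|\,B$ is an irreducible extension of $K$-algebras and ${}_AP_A$ is a bimodule. Let $R=A^B$ and $T=(A\otimes_BA)^B$. Then the cochain mapping $\Phi_n:C^n(A,B;P)\to C^{n-1}(T,R;P^B)$ ($n\ge1$), from the relative Hochschild complex to the Hochschild coring complex, is nullhomotopic.
   Context: $K$ is a commutative ring, $A$ an associative unital $K$-algebra, $B\subseteq A$ a unital subalgebra. For an $A$-$A$-bimodule $M$ (over $K$), $M^B=\{m\in M: bm=mb\ \forall b\in B\}$. $R=A^B$ is the centralizer, $T=(A\otimes_BA)^B$, with elements written $t=t^1\otimes_Bt^2$ (summation suppressed) and $R$-bimodule structure $r\cdot t\cdot s=rt^1\otimes t^2s$. $P^B$ is an $R$-$R$-bimodule. $A\,|\,B$ is \emph{depth two} if for some positive integer $N$, $A\otimes_BA$ is isomorphic to a direct summand of $A^N$, both as natural $B$-$A$-bimodules and as natural $A$-$B$-bimodules. $A\,|\,B$ is \emph{irreducible} if it is depth two and $R\subseteq B$ (so $R$ is commutative). \emph{Relative Hochschild complex.} $C^0(A,B;P)=P^B$ and, for $n\ge1$, $C^n(A,B;P)=\mathrm{Hom}({}_BA\otimes_B\cdots\otimes_BA_B,{}_BP_B)$ ($n$ factors $A$). Differentials: $d^0(p)(a)=ap-pa$, and for $n\ge1$ $$(d^nf)(x_1\otimes\cdots\otimes x_{n+1})=x_1f(x_2\otimes\cdots\otimes x_{n+1})+\sum_{i=1}^n(-1)^if(x_1\otimes\cdots\otimes x_ix_{i+1}\otimes\cdots\otimes x_{n+1})+(-1)^{n+1}f(x_1\otimes\cdots\otimes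 x_n)x_{n+1}.$$ \emph{Hochschild coring complex.} For $n\ge0$, $C^n(T,R;P^B)=\mathrm{Hom}({}_RT\otimes_R\cdots\otimes_RT_R,{}_RP^B_R)$ ($n+1$ factors $T$). With $\varepsilon:T\to R$, $\varepsilon(t)=t^1t^2$, the differential is $$(\delta^ng)(t_1\otimes\cdots\otimes t_{n+2})=\varepsilon(t_1)g(t_2\otimes\cdots\otimes t_{n+2})+\sum_{i=2}^{n+1}(-1)^{i+1}g(t_1\otimes\cdots\otimes t_{i-1}\varepsilon(t_i)\otimes t_{i+1}\otimes\cdots\otimes t_{n+2})+(-1)^{n+3}g(t_1\otimes\cdots\otimes t_{n+1})\varepsilon(t_{n+2}).$$ \emph{The map $\Phi$.} For $n\ge1$ and $h\in C^n(A,B;P)$ put $$\pi^n_L(h)(u_1\otimes_R\cdots\otimes_Ru_n)=u_1^1\,h(u_1^2u_2^1\otimes_B\cdots\otimes_Bu_{n-1}^2u_n^1\otimes_Bu_n^2),$$ $$\pi^n_{\mathcal R}(h)(u_1\otimes_R\cdots\otimes_Ru_n)=h(u_1^1\otimes_Bu_1^2u_2^1\otimes_B\cdots\otimes_Bu_{n-1}^2u_n^1)\,u_n^2,$$ and $\Phi_n=\pi^n_L+(-1)^{n+1}\pi^n_{\mathcal R}$. For example $\Phi_1(h)(u)=u^1h(u^2)+h(u^1)u^2$ and $\Phi_2(g)(u\otimes t)=u^1g(u^2t^1\otimes t^2)-g(u^1\otimes u^2t^1)t^2$. These maps form a cochain map of degree $-1$: $\delta^{n-1}\Phi_n=\Phi_{n+1}d^n$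 for $n\ge1$. \emph{Nullhomotopic} means that there are $K$-linear maps $s_n:C^{n+2}(A,B;P)\to C^n(T,R;P^B)$, $n\ge0$, with $\Phi_{n+2}=\delta^ns_n+s_{n+1}d^{n+2}$ for all $n\ge0$ and $\Phi_1=s_0d^1$ (the coring complex being zero in negative degrees). *)

theory Defs
  imports "HOL-Algebra.Subrings" "HOL-Algebra.Free_Abelian_Groups"
begin

section \<open>Algebras and bimodules\<close>

text \<open>The library's \<^locale>\<open>algebra\<close> is commutative.\<close>

locale assoc_algebra = module K A + ring A
    for K :: "('k, 'c) ring_scheme" (structure) and A :: "('k, 'a, 'd) module_scheme" (structure) +
  assumes smult_mult_left:
      "\<lbrakk>k \<in> carrier K; x \<in> carrier A; y \<in> carrier A\<rbrakk>
        \<Longrightarrow> (k \<odot>\<^bsub>A\<^esub> x) \<otimes>\<^bsub>A\<^esub> y = k \<odot>\<^bsub>A\<^esub> (x \<otimes>\<^bsub>A\<^esub> y)"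
    and smult_mult_right:
      "\<lbrakk>k \<in> carrier K; x \<in> carrier A; y \<in> carrier A\<rbrakk>
        \<Longrightarrow> x \<otimes>\<^bsub>A\<^esub> (k \<odot>\<^bsub>A\<^esub> y) = k \<odot>\<^bsub>A\<^esub> (x \<otimes>\<^bsub>A\<^esub> y)"

definition unital_subalgebra ::
    "'k ring \<Rightarrow> ('k, 'a) module \<Rightarrow> 'a set \<Rightarrow> bool" where
  "unital_subalgebra K A B \<longleftrightarrow>
     subring B A \<and> (\<forall>k\<in>carrier K. \<forall>b\<in>B. k \<odot>\<^bsub>A\<^esub> b \<in> B)"

text \<open>As in \<^typ>\<open>('a, 'm) module\<close>, only the additive part of the \<^typ>\<open>'m ring\<close> fields is
  meaningful. Both actions are by elements of one type \<^typ>\<open>'a\<close>; which subsets of it act is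
  always said explicitly.\<close>

record ('a, 'm) bimodule = "'m ring" +
  lact :: "'a \<Rightarrow> 'm \<Rightarrow> 'm" (infixr "\<triangleright>\<index>" 70)
  ract :: "'m \<Rightarrow> 'a \<Rightarrow> 'm" (infixl "\<triangleleft>\<index>" 70)

locale bimodule = A?: ring A + P?: abelian_group P
    for A :: "('a, 'c) ring_scheme" (structure) and P :: "('a, 'm, 'd) bimodule_scheme" (structure) +
  assumes lact_closed: "\<lbrakk>a \<in> carrier A; x \<in> carrier P\<rbrakk> \<Longrightarrow> a \<triangleright>\<^bsub>P\<^esub> x \<in> carrier P"
    and ract_closed: "\<lbrakk>a \<in> carrier A; x \<in> carrier P\<rbrakk> \<Longrightarrow> x \<triangleleft>\<^bsub>P\<^esub> a \<in> carrier P"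
    and lact_add_left: "\<lbrakk>a \<in> carrier A; b \<in> carrier A; x \<in> carrier P\<rbrakk>
        \<Longrightarrow> (a \<oplus>\<^bsub>A\<^esub> b) \<triangleright>\<^bsub>P\<^esub> x = (a \<triangleright>\<^bsub>P\<^esub> x) \<oplus>\<^bsub>P\<^esub> (b \<triangleright>\<^bsub>P\<^esub> x)"
    and lact_add_right: "\<lbrakk>a \<in> carrier A; x \<in> carrier P; y \<in> carrier P\<rbrakk>
        \<Longrightarrow> a \<triangleright>\<^bsub>P\<^esub> (x \<oplus>\<^bsub>P\<^esub> y) = (a \<triangleright>\<^bsub>P\<^esub> x) \<oplus>\<^bsub>P\<^esub> (a \<triangleright>\<^bsub>P\<^esub> y)"
    and ract_add_right: "\<lbrakk>a \<in> carrier A; b \<in> carrier A; x \<in> carrier P\<rbrakk>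
        \<Longrightarrow> x \<triangleleft>\<^bsub>P\<^esub> (a \<oplus>\<^bsub>A\<^esub> b) = (x \<triangleleft>\<^bsub>P\<^esub> a) \<oplus>\<^bsub>P\<^esub> (x \<triangleleft>\<^bsub>P\<^esub> b)"
    and ract_add_left: "\<lbrakk>a \<in> carrier A; x \<in> carrier P; y \<in> carrier P\<rbrakk>
        \<Longrightarrow> (x \<oplus>\<^bsub>P\<^esub> y) \<triangleleft>\<^bsub>P\<^esub> a = (x \<triangleleft>\<^bsub>P\<^esub> a) \<oplus>\<^bsub>P\<^esub> (y \<triangleleft>\<^bsub>P\<^esub> a)"
    and lact_assoc: "\<lbrakk>a \<in> carrier A; b \<in> carrier A; x \<in> carrier P\<rbrakk>
        \<Longrightarrow> (a \<otimes>\<^bsub>A\<^esub> b) \<triangleright>\<^bsub>P\<^esub> x = a \<triangleright>\<^bsub>P\<^esub> (b \<triangleright>\<^bsub>P\<^esub> x)"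
    and ract_assoc: "\<lbrakk>a \<in> carrier A; b \<in> carrier A; x \<in> carrier P\<rbrakk>
        \<Longrightarrow> x \<triangleleft>\<^bsub>P\<^esub> (a \<otimes>\<^bsub>A\<^esub> b) = (x \<triangleleft>\<^bsub>P\<^esub> a) \<triangleleft>\<^bsub>P\<^esub> b"
    and lact_ract: "\<lbrakk>a \<in> carrier A; b \<in> carrier A; x \<in> carrier P\<rbrakk>
        \<Longrightarrow> (a \<triangleright>\<^bsub>P\<^esub> x) \<triangleleft>\<^bsub>P\<^esub> b = a \<triangleright>\<^bsub>P\<^esub> (x \<triangleleft>\<^bsub>P\<^esub> b)"
    and lact_one: "x \<in> carrier P \<Longrightarrow> \<one>\<^bsub>A\<^esub> \<triangleright>\<^bsub>P\<^esub> x = x"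
    and ract_one: "x \<in> carrier P \<Longrightarrow> x \<triangleleft>\<^bsub>P\<^esub> \<one>\<^bsub>A\<^esub> = x"

text \<open>For a bimodule over \<open>K\<close> the two \<open>K\<close>-actions \<open>(k1)x\<close> and \<open>x(k1)\<close> agree; this common action
  is its \<open>K\<close>-module structure.\<close>

locale bimodule_over = assoc_algebra K A + bimodule A P
    for K :: "('k, 'c) ring_scheme" (structure) and A :: "('k, 'a, 'd) module_scheme" (structure)
      and P :: "('a, 'm, 'e) bimodule_scheme" (structure) +
  assumes central: "\<lbrakk>k \<in> carrier K; x \<in> carrier P\<rbrakk>
      \<Longrightarrow> (k \<odot>\<^bsub>A\<^esub> \<one>\<^bsub>A\<^esub>) \<triangleright>\<^bsub>P\<^esub> x = x \<triangleleft>\<^bsub>P\<^esub> (k \<odot>\<^bsub>A\<^esub> \<one>\<^bsub>A\<^esub>)"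

definition regular :: "('k, 'a) module \<Rightarrow> ('a, 'a) bimodule" where
  "regular A = \<lparr>carrier = carrier A, monoid.mult = monoid.mult A, one = \<one>\<^bsub>A\<^esub>,
     ring.zero = \<zero>\<^bsub>A\<^esub>, add = add A,
     lact = monoid.mult A, ract = monoid.mult A\<rparr>"

text \<open>\<open>M\<^sup>B\<close>, keeping the operations of \<open>M\<close>.\<close>

definition invariants :: "'a set \<Rightarrow> ('a, 'm) bimodule \<Rightarrow> ('a, 'm) bimodule" where
  "invariants B M = M\<lparr>carrier := {x \<in> carrier M. \<forall>b\<in>B. b \<triangleright>\<^bsub>M\<^esub> x = x \<triangleleft>\<^bsub>M\<^esub> b}\<rparr>"

definition centralizer :: "('k, 'a) module \<Rightarrow> 'a set \<Rightarrow> 'a set" where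
  "centralizer A B = carrier (invariants B (regular A))"

definition bimodule_hom ::
    "'a set \<Rightarrow> 'a set \<Rightarrow> ('a, 'm) bimodule \<Rightarrow> ('a, 'n) bimodule \<Rightarrow> ('m \<Rightarrow> 'n) set" where
  "bimodule_hom S T M N = {f \<in> hom (add_monoid M) (add_monoid N).
     \<forall>x\<in>carrier M. (\<forall>s\<in>S. f (s \<triangleright>\<^bsub>M\<^esub> x) = s \<triangleright>\<^bsub>N\<^esub> f x) \<and> (\<forall>t\<in>T. f (x \<triangleleft>\<^bsub>M\<^esub> t) = f x \<triangleleft>\<^bsub>N\<^esub> t)}"


section \<open>Tensor powers\<close>

text \<open>\<open>M \<otimes>\<^sub>S \<cdots> \<otimes>\<^sub>S M\<close> with \<open>n \<ge> 1\<close> factors is the free abelian group on the words of length \<open>n\<close> over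
  \<open>M\<close> modulo multi-additivity and \<open>S\<close>-balancedness. Its elements are cosets of formal sums.
  For \<open>n = 1\<close> this is a canonically isomorphic copy of \<open>M\<close>.\<close>

type_synonym 'm tensors = "('m list \<Rightarrow>\<^sub>0 int) set"

definition words :: "('a, 'm) bimodule \<Rightarrow> nat \<Rightarrow> 'm list set" where
  "words M n = {ws. length ws = n \<and> set ws \<subseteq> carrier M}"

definition tensor_relators :: "'a set \<Rightarrow> ('a, 'm) bimodule \<Rightarrow> nat \<Rightarrow> ('m list \<Rightarrow>\<^sub>0 int) set" where
  "tensor_relators S M n =
     {frag_of (us @ (x \<oplus>\<^bsub>M\<^esub> y) # vs) - frag_of (us @ x # vs) - frag_of (us @ y # vs) | us x y vs.
        us @ x # vs \<in> words M n \<and> y \<in> carrier M} \<union>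
     {frag_of (us @ (x \<triangleleft>\<^bsub>M\<^esub> s) # y # vs) - frag_of (us @ x # (s \<triangleright>\<^bsub>M\<^esub> y) # vs) | us x s y vs.
        us @ x # y # vs \<in> words M n \<and> s \<in> S}"

definition tensor_subgroup :: "'a set \<Rightarrow> ('a, 'm) bimodule \<Rightarrow> nat \<Rightarrow> ('m list \<Rightarrow>\<^sub>0 int) set" where
  "tensor_subgroup S M n = generate (free_Abelian_group (words M n)) (tensor_relators S M n)"

definition pure_tensor :: "'a set \<Rightarrow> ('a, 'm) bimodule \<Rightarrow> 'm list \<Rightarrow> 'm tensors" where
  "pure_tensor S M ws =
     tensor_subgroup S M (length ws) #>\<^bsub>free_Abelian_group (words M (length ws))\<^esub> frag_of ws"

definition tensor_group :: "'a set \<Rightarrow> ('a, 'm) bimodule \<Rightarrow> nat \<Rightarrow> 'm tensors ring" where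
  "tensor_group S M n =
     (let Q = free_Abelian_group (words M n) Mod tensor_subgroup S M n
      in \<lparr>carrier = carrier Q, monoid.mult = undefined, one = undefined,
          ring.zero = \<one>\<^bsub>Q\<^esub>, add = monoid.mult Q\<rparr>)"

text \<open>The value at the tensor \<open>X\<close> of the additive map into \<open>N\<close> that sends \<open>w\<^sub>1 \<otimes> \<cdots> \<otimes> w\<^sub>n\<close> to
  \<open>\<phi> [w\<^sub>1, \<dots>, w\<^sub>n]\<close>. When \<open>\<phi>\<close> is multi-additive and balanced, the chosen representative of
  \<open>X\<close> does not matter. All maps on tensor powers below are given in this way by their
  formula on pure tensors.\<close>

definition tensor_lift :: "('n, 'z) ring_scheme \<Rightarrow> ('m list \<Rightarrow> 'n) \<Rightarrow> 'm tensors \<Rightarrow> 'n" where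
  "tensor_lift N \<phi> X =
     (let F = (SOME F. F \<in> X)
      in \<Oplus>\<^bsub>N\<^esub>ws\<in>Poly_Mapping.keys F. [Poly_Mapping.lookup F ws] \<cdot>\<^bsub>N\<^esub> \<phi> ws)"

text \<open>The actions are those on the two outermost factors, by the ring acting on \<open>M\<close>
  (not only by \<open>S\<close>).\<close>

definition tensor_power ::
    "'a set \<Rightarrow> ('a, 'm) bimodule \<Rightarrow> nat \<Rightarrow> ('a, 'm tensors) bimodule" where
  "tensor_power S M n =
     (let G = tensor_group S M n
      in \<lparr>carrier = carrier G, monoid.mult = monoid.mult G, one = one G, ring.zero = ring.zero G, add = add G,
          lact = \<lambda>a. tensor_lift G (\<lambda>ws. pure_tensor S M ((a \<triangleright>\<^bsub>M\<^esub> hd ws) # tl ws)),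
          ract = \<lambda>X a. tensor_lift G (\<lambda>ws. pure_tensor S M (butlast ws @ [last ws \<triangleleft>\<^bsub>M\<^esub> a])) X\<rparr>)"


section \<open>Irreducible depth two extensions\<close>

definition sub_bimodule :: "'a set \<Rightarrow> 'a set \<Rightarrow> 'm set \<Rightarrow> ('a, 'm) bimodule \<Rightarrow> bool" where
  "sub_bimodule S T U M \<longleftrightarrow> additive_subgroup U M \<and>
     (\<forall>x\<in>U. (\<forall>s\<in>S. s \<triangleright>\<^bsub>M\<^esub> x \<in> U) \<and> (\<forall>t\<in>T. x \<triangleleft>\<^bsub>M\<^esub> t \<in> U))"

definition direct_summand :: "'a set \<Rightarrow> 'a set \<Rightarrow> 'm set \<Rightarrow> ('a, 'm) bimodule \<Rightarrow> bool" where
  "direct_summand S T U M \<longleftrightarrow> sub_bimodule S T U M \<and>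
     (\<exists>V. sub_bimodule S T V M \<and> U \<inter> V = {\<zero>\<^bsub>M\<^esub>} \<and> U <+>\<^bsub>M\<^esub> V = carrier M)"

definition iso_to_direct_summand ::
    "'a set \<Rightarrow> 'a set \<Rightarrow> ('a, 'm) bimodule \<Rightarrow> ('a, 'n) bimodule \<Rightarrow> bool" where
  "iso_to_direct_summand S T M N \<longleftrightarrow>
     (\<exists>U. direct_summand S T U N \<and>
        (\<exists>f\<in>bimodule_hom S T M (N\<lparr>carrier := U\<rparr>). bij_betw f (carrier M) U))"

definition direct_power :: "('a, 'm) bimodule \<Rightarrow> nat \<Rightarrow> ('a, nat \<Rightarrow> 'm) bimodule" where
  "direct_power M N =
     \<lparr>carrier = {..<N} \<rightarrow>\<^sub>E carrier M, monoid.mult = undefined, one = undefined,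
      ring.zero = \<lambda>i\<in>{..<N}. \<zero>\<^bsub>M\<^esub>, add = \<lambda>f g. \<lambda>i\<in>{..<N}. f i \<oplus>\<^bsub>M\<^esub> g i,
      lact = \<lambda>a f. \<lambda>i\<in>{..<N}. a \<triangleright>\<^bsub>M\<^esub> f i, ract = \<lambda>f a. \<lambda>i\<in>{..<N}. f i \<triangleleft>\<^bsub>M\<^esub> a\<rparr>"

definition depth_two :: "('k, 'a) module \<Rightarrow> 'a set \<Rightarrow> bool" where
  "depth_two A B \<longleftrightarrow>
     (\<exists>N>0. iso_to_direct_summand B (carrier A)
               (tensor_power B (regular A) 2) (direct_power (regular A) N) \<and>
            iso_to_direct_summand (carrier A) B
               (tensor_power B (regular A) 2) (direct_power (regular A) N))"

definition irreducible_extension :: "('k, 'a) module \<Rightarrow> 'a set \<Rightarrow> bool" where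
  "irreducible_extension A B \<longleftrightarrow> depth_two A B \<and> centralizer A B \<subseteq> B"


section \<open>The two complexes\<close>

text \<open>\<open>Hom({}\<^sub>SM\<^sub>S, {}\<^sub>SN\<^sub>S)\<close> as a \<open>K\<close>-module; homomorphisms are made extensional so that
  equality of cochains is equality of maps on \<open>M\<close>.\<close>

definition hom_module ::
    "('k, 'a) module \<Rightarrow> 'a set \<Rightarrow> ('a, 'm) bimodule \<Rightarrow> ('a, 'n) bimodule
      \<Rightarrow> ('k, 'm \<Rightarrow> 'n) module" where
  "hom_module A S M N =
     \<lparr>carrier = bimodule_hom S S M N \<inter> extensional (carrier M),
      monoid.mult = undefined, one = undefined,
      ring.zero = \<lambda>X\<in>carrier M. \<zero>\<^bsub>N\<^esub>, add = \<lambda>f g. \<lambda>X\<in>carrier M. f X \<oplus>\<^bsub>N\<^esub> g X,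
      smult = \<lambda>k f. \<lambda>X\<in>carrier M. (k \<odot>\<^bsub>A\<^esub> \<one>\<^bsub>A\<^esub>) \<triangleright>\<^bsub>N\<^esub> f X\<rparr>"

text \<open>Degrees \<open>n \<ge> 1\<close> only: \<open>\<Phi>\<close> starts in degree \<open>1\<close>, so \<open>C\<^sup>0(A,B;P) = P\<^sup>B\<close> plays no role.\<close>

definition hochschild_cochains ::
    "('k, 'a) module \<Rightarrow> 'a set \<Rightarrow> ('a, 'p) bimodule \<Rightarrow> nat \<Rightarrow> ('k, 'a tensors \<Rightarrow> 'p) module" where
  "hochschild_cochains A B P n = hom_module A B (tensor_power B (regular A) n) P"

text \<open>Lists are indexed from \<open>0\<close>: the \<open>i\<close>-th summand multiplies \<open>x\<^sub>i = xs ! (i - 1)\<close> and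
  \<open>x\<^bsub>i+1\<^esub> = xs ! i\<close>.\<close>

definition hochschild_d ::
    "('k, 'a) module \<Rightarrow> 'a set \<Rightarrow> ('a, 'p) bimodule \<Rightarrow> nat
      \<Rightarrow> ('a tensors \<Rightarrow> 'p) \<Rightarrow> 'a tensors \<Rightarrow> 'p" where
  "hochschild_d A B P n f =
     (\<lambda>X\<in>carrier (tensor_power B (regular A) (n + 1)).
        tensor_lift P (\<lambda>xs.
          hd xs \<triangleright>\<^bsub>P\<^esub> f (pure_tensor B (regular A) (tl xs))
          \<oplus>\<^bsub>P\<^esub> (\<Oplus>\<^bsub>P\<^esub>i\<in>{1..n}. [((-1) ^ i :: int)] \<cdot>\<^bsub>P\<^esub>
                 f (pure_tensor B (regular A)
                     (take (i - 1) xs @ [xs ! (i - 1) \<otimes>\<^bsub>A\<^esub> xs ! i] @ drop (i + 1) xs)))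
          \<oplus>\<^bsub>P\<^esub> [((-1) ^ (n + 1) :: int)] \<cdot>\<^bsub>P\<^esub>
                 (f (pure_tensor B (regular A) (butlast xs)) \<triangleleft>\<^bsub>P\<^esub> last xs)) X)"

text \<open>\<open>T = (A \<otimes>\<^sub>B A)\<^sup>B\<close>. The inherited outer actions, restricted to \<open>R = A\<^sup>B\<close>, are
  \<open>r \<cdot> t \<cdot> s = r t\<^sup>1 \<otimes> t\<^sup>2 s\<close>.\<close>

definition dt_bimodule :: "('k, 'a) module \<Rightarrow> 'a set \<Rightarrow> ('a, 'a tensors) bimodule" where
  "dt_bimodule A B = invariants B (tensor_power B (regular A) 2)"

definition counit :: "('k, 'a) module \<Rightarrow> 'a tensors \<Rightarrow> 'a" where
  "counit A = tensor_lift A (\<lambda>xs. xs ! 0 \<otimes>\<^bsub>A\<^esub> xs ! 1)"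

text \<open>\<open>T \<otimes>\<^sub>R \<cdots> \<otimes>\<^sub>R T\<close> with \<open>n\<close> factors, where \<open>R = A\<^sup>B\<close>.\<close>

abbreviation dt_power ::
    "('k, 'a) module \<Rightarrow> 'a set \<Rightarrow> nat \<Rightarrow> ('a, 'a tensors tensors) bimodule" where
  "dt_power A B n \<equiv> tensor_power (centralizer A B) (dt_bimodule A B) n"

abbreviation dt_pure :: "('k, 'a) module \<Rightarrow> 'a set \<Rightarrow> 'a tensors list \<Rightarrow> 'a tensors tensors" where
  "dt_pure A B ts \<equiv> pure_tensor (centralizer A B) (dt_bimodule A B) ts"

definition coring_cochains ::
    "('k, 'a) module \<Rightarrow> 'a set \<Rightarrow> ('a, 'p) bimodule \<Rightarrow> nat
      \<Rightarrow> ('k, 'a tensors tensors \<Rightarrow> 'p) module" where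
  "coring_cochains A B P n =
     hom_module A (centralizer A B) (dt_power A B (n + 1)) (invariants B P)"

text \<open>Here \<open>t\<^sub>i = ts ! (i - 1)\<close>.\<close>

definition coring_d ::
    "('k, 'a) module \<Rightarrow> 'a set \<Rightarrow> ('a, 'p) bimodule \<Rightarrow> nat
      \<Rightarrow> ('a tensors tensors \<Rightarrow> 'p) \<Rightarrow> 'a tensors tensors \<Rightarrow> 'p" where
  "coring_d A B P n g =
     (\<lambda>X\<in>carrier (dt_power A B (n + 2)).
        tensor_lift P (\<lambda>ts.
          counit A (hd ts) \<triangleright>\<^bsub>P\<^esub> g (dt_pure A B (tl ts))
          \<oplus>\<^bsub>P\<^esub> (\<Oplus>\<^bsub>P\<^esub>i\<in>{2..n + 1}. [((-1) ^ (i + 1) :: int)] \<cdot>\<^bsub>P\<^esub>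
                 g (dt_pure A B
                     (take (i - 2) ts
                       @ [ts ! (i - 2) \<triangleleft>\<^bsub>dt_bimodule A B\<^esub> counit A (ts ! (i - 1))]
                       @ drop i ts)))
          \<oplus>\<^bsub>P\<^esub> [((-1) ^ (n + 3) :: int)] \<cdot>\<^bsub>P\<^esub>
                 (g (dt_pure A B (butlast ts)) \<triangleleft>\<^bsub>P\<^esub> counit A (last ts))) X)"


section \<open>The cochain map\<close>

text \<open>\<open>sweedler N \<psi> [u\<^sub>1, \<dots>, u\<^sub>n]\<close> is the (iterated) sum, over representations
  \<open>u\<^sub>i = u\<^sub>i\<^sup>1 \<otimes> u\<^sub>i\<^sup>2\<close>, of \<open>\<psi> [(u\<^sub>1\<^sup>1, u\<^sub>1\<^sup>2), \<dots>, (u\<^sub>n\<^sup>1, u\<^sub>n\<^sup>2)]\<close>.\<close>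

primrec sweedler ::
    "('n, 'z) ring_scheme \<Rightarrow> (('a \<times> 'a) list \<Rightarrow> 'n) \<Rightarrow> 'a tensors list \<Rightarrow> 'n" where
  "sweedler N \<psi> [] = \<psi> []"
| "sweedler N \<psi> (u # us) =
     tensor_lift N (\<lambda>xs. sweedler N (\<lambda>ps. \<psi> ((xs ! 0, xs ! 1) # ps)) us) u"

text \<open>\<open>[u\<^sub>1\<^sup>2 u\<^sub>2\<^sup>1, u\<^sub>2\<^sup>2 u\<^sub>3\<^sup>1, \<dots>, u\<^bsub>n-1\<^esub>\<^sup>2 u\<^sub>n\<^sup>1]\<close>\<close>

definition inner_products :: "('k, 'a) module \<Rightarrow> ('a \<times> 'a) list \<Rightarrow> 'a list" where
  "inner_products A ps = map2 (\<lambda>p q. snd p \<otimes>\<^bsub>A\<^esub> fst q) ps (tl ps)"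

definition pi_left ::
    "('k, 'a) module \<Rightarrow> 'a set \<Rightarrow> ('a, 'p) bimodule
      \<Rightarrow> ('a tensors \<Rightarrow> 'p) \<Rightarrow> 'a tensors tensors \<Rightarrow> 'p" where
  "pi_left A B P h =
     tensor_lift P (sweedler P (\<lambda>ps.
       fst (hd ps) \<triangleright>\<^bsub>P\<^esub> h (pure_tensor B (regular A) (inner_products A ps @ [snd (last ps)]))))"

definition pi_right ::
    "('k, 'a) module \<Rightarrow> 'a set \<Rightarrow> ('a, 'p) bimodule
      \<Rightarrow> ('a tensors \<Rightarrow> 'p) \<Rightarrow> 'a tensors tensors \<Rightarrow> 'p" where
  "pi_right A B P h =
     tensor_lift P (sweedler P (\<lambda>ps.
       h (pure_tensor B (regular A) (fst (hd ps) # inner_products A ps)) \<triangleleft>\<^bsub>P\<^esub> snd (last ps)))"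

definition Phi ::
    "('k, 'a) module \<Rightarrow> 'a set \<Rightarrow> ('a, 'p) bimodule \<Rightarrow> nat
      \<Rightarrow> ('a tensors \<Rightarrow> 'p) \<Rightarrow> 'a tensors tensors \<Rightarrow> 'p" where
  "Phi A B P n h =
     (\<lambda>X\<in>carrier (dt_power A B n).
        pi_left A B P h X \<oplus>\<^bsub>P\<^esub> [((-1) ^ (n + 1) :: int)] \<cdot>\<^bsub>P\<^esub> pi_right A B P h X)"


section \<open>Homotopy\<close>

definition linear_maps ::
    "'k ring \<Rightarrow> ('k, 'c) module \<Rightarrow> ('k, 'd) module \<Rightarrow> ('c \<Rightarrow> 'd) set" where
  "linear_maps K C D = {s \<in> hom (add_monoid C) (add_monoid D).
     \<forall>k\<in>carrier K. \<forall>f\<in>carrier C. s (k \<odot>\<^bsub>C\<^esub> f) = k \<odot>\<^bsub>D\<^esub> s f}"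

text \<open>For degree \<open>-1\<close> maps \<open>\<phi> n : C n \<rightarrow> D (n - 1)\<close>, \<open>n \<ge> 1\<close>, where \<open>D\<close> is zero in negative
  degrees; hence the separate equation for \<open>\<phi> 1\<close>.\<close>

definition nullhomotopic ::
    "'k ring \<Rightarrow> (nat \<Rightarrow> ('k, 'c) module) \<Rightarrow> (nat \<Rightarrow> 'c \<Rightarrow> 'c)
      \<Rightarrow> (nat \<Rightarrow> ('k, 'd) module) \<Rightarrow> (nat \<Rightarrow> 'd \<Rightarrow> 'd) \<Rightarrow> (nat \<Rightarrow> 'c \<Rightarrow> 'd) \<Rightarrow> bool" where
  "nullhomotopic K C d D \<delta> \<phi> \<longleftrightarrow>
     (\<exists>s. (\<forall>n. s n \<in> linear_maps K (C (n + 2)) (D n)) \<and>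
          (\<forall>n. \<forall>h\<in>carrier (C (n + 2)).
             \<phi> (n + 2) h = \<delta> n (s n h) \<oplus>\<^bsub>D (n + 1)\<^esub> s (n + 1) (d (n + 2) h)) \<and>
          (\<forall>h\<in>carrier (C 1). \<phi> 1 h = s 0 (d 1 h)))"

end

theory Submission
  imports Defs
begin

text \<open>The homotopy is
  \<open>(s\<^sub>n h)(u\<^sub>1 \<otimes> \<cdots> \<otimes> u\<^bsub>n+1\<^esub>) = h(u\<^sub>1\<^sup>1 \<otimes> u\<^sub>1\<^sup>2u\<^sub>2\<^sup>1 \<otimes> \<cdots> \<otimes> u\<^bsub>n+1\<^esub>\<^sup>2)\<close>,
  with the extra term \<open>\<epsilon>(u\<^sub>1) h(1 \<otimes> 1)\<close> for \<open>n = 0\<close>. In \<open>s\<^bsub>n+1\<^esub>(d h)\<close> the two outermost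
  summands of the Hochschild differential give \<open>\<Phi> h\<close>, and each inner summand contracts some \<open>u\<^sub>i\<close> to
  \<open>\<epsilon>(u\<^sub>i) \<in> R \<subseteq> B\<close>, so that the inner summands add up to \<open>- \<delta>(s\<^sub>n h)\<close>. For \<open>\<Phi>\<^sub>1\<close> one is left with
  \<open>- h(\<epsilon>(u)) = - \<epsilon>(u) h(1)\<close>, which the extra term cancels because \<open>(d h)(1 \<otimes> 1) = h(1)\<close>; the extra
  term is itself a cocycle, since \<open>h(1 \<otimes> 1)\<close> commutes with \<open>B\<close>.

  An additive map commutes with the evaluation of formal sums, and \<open>tensor_lift\<close> is additive in its
  formula. The equation for \<open>\<Phi>\<close> is therefore checked on words over \<open>A\<close>, without showing that the
  formulas of \<open>\<Phi>\<close> and of \<open>\<delta>\<close> are balanced.\<close>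

text \<open>Irreducibility is felt at the outer positions. A Hochschild cochain is linear only over
  \<open>B\<close>, whereas the first and last summands of \<open>\<delta>\<close> multiply by
  counits, which lie in \<open>R\<close>; as \<open>R \<subseteq> B\<close>, these can be moved into
  and out of the argument of \<open>h\<close>. At the inner positions associativity of
  \<open>A\<close> suffices. Linearity over \<open>B\<close> also gives values in
  \<open>P\<^sup>B\<close>: an element of \<open>B\<close> enters \<open>h\<close> on the left,
  crosses every \<open>u\<^sub>i\<close> and leaves on the right. Degree 1 is exceptional because no
  lower coring cochain has a coboundary that could account for the inner summand of
  \<open>d h\<close>. The obstacle is that \<open>tensor_lift\<close> evaluates at an arbitrarily
  chosen representative. Identities between formulas survive this, as both sides use the same
  representative. Actions on tensors do not: to move \<open>r u\<close> or \<open>u r\<close> onto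
  the entries of a pair, the formula must be balanced. The formulas of the homotopy are therefore
  functions on lists of pairs, and their balancedness is proved by recursion on the list.\<close>

lemma add_hom_add:
  "f \<in> hom (add_monoid M) (add_monoid N) \<Longrightarrow> x \<in> carrier M \<Longrightarrow> y \<in> carrier M
    \<Longrightarrow> f (x \<oplus>\<^bsub>M\<^esub> y) = f x \<oplus>\<^bsub>N\<^esub> f y"
  by (simp add: hom_def)

lemma add_hom_closed:
  "f \<in> hom (add_monoid M) (add_monoid N) \<Longrightarrow> x \<in> carrier M \<Longrightarrow> f x \<in> carrier N"
  by (auto simp: hom_def)

lemma add_homI:
  assumes "\<And>x. x \<in> carrier M \<Longrightarrow> f x \<in> carrier N"
    and "\<And>x y. x \<in> carrier M \<Longrightarrow> y \<in> carrier M \<Longrightarrow> f (x \<oplus>\<^bsub>M\<^esub> y) = f x \<oplus>\<^bsub>N\<^esub> f y"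
  shows "f \<in> hom (add_monoid M) (add_monoid N)"
  using assms by (auto simp: hom_def)

lemma add_hom_group_hom:
  assumes "abelian_group M" "abelian_group N" "f \<in> hom (add_monoid M) (add_monoid N)"
  shows "group_hom (add_monoid M) (add_monoid N) f"
  using assms by (simp add: group_hom_def group_hom_axioms_def abelian_group.a_group)

lemma add_hom_zero:
  assumes "abelian_group M" "abelian_group N" "f \<in> hom (add_monoid M) (add_monoid N)"
  shows "f \<zero>\<^bsub>M\<^esub> = \<zero>\<^bsub>N\<^esub>"
  using group_hom.hom_one[OF add_hom_group_hom[OF assms]] by simp

lemma add_hom_int_pow:
  fixes k :: int
  assumes "abelian_group M" "abelian_group N" "f \<in> hom (add_monoid M) (add_monoid N)"
    "x \<in> carrier M"
  shows "f ([k] \<cdot>\<^bsub>M\<^esub> x) = [k] \<cdot>\<^bsub>N\<^esub> f x"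
  using group_hom.hom_int_pow[OF add_hom_group_hom[OF assms(1-3)], of x k] assms(4)
  by (simp add: add_pow_def)

lemma add_hom_a_inv:
  assumes "abelian_group M" "abelian_group N" "f \<in> hom (add_monoid M) (add_monoid N)"
    "x \<in> carrier M"
  shows "f (\<ominus>\<^bsub>M\<^esub> x) = \<ominus>\<^bsub>N\<^esub> f x"
  using group_hom.hom_inv[OF add_hom_group_hom[OF assms(1-3)], of x] assms(4)
  by (simp add: a_inv_def)

lemma add_hom_finsum:
  assumes M: "abelian_group M" and N: "abelian_group N"
    and f: "f \<in> hom (add_monoid M) (add_monoid N)"
    and "g \<in> I \<rightarrow> carrier M"
  shows "f (\<Oplus>\<^bsub>M\<^esub>i\<in>I. g i) = (\<Oplus>\<^bsub>N\<^esub>i\<in>I. f (g i))"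
proof -
  interpret M: abelian_group M by fact
  interpret N: abelian_group N by fact
  note cl = add_hom_closed[OF f]
  show ?thesis
    using assms(4)
  proof (induction I rule: infinite_finite_induct)
    case (insert i I)
    then have "(\<Oplus>\<^bsub>M\<^esub>i\<in>I. g i) \<in> carrier M" "g i \<in> carrier M"
      by (auto intro!: M.finsum_closed)
    moreover have "(\<lambda>i. f (g i)) \<in> I \<rightarrow> carrier N" "f (g i) \<in> carrier N"
      using insert cl by auto
    ultimately show ?case
      using insert by (simp add: add_hom_add[OF f] Pi_def)
  qed (simp_all add: add_hom_zero[OF M N f])
qed

lemma add_hom_compose:
  assumes "f \<in> hom (add_monoid L) (add_monoid M)" "g \<in> hom (add_monoid M) (add_monoid N)"
  shows "(\<lambda>x. g (f x)) \<in> hom (add_monoid L) (add_monoid N)"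
  using assms by (auto simp: hom_def Pi_iff)

section \<open>Universal property of tensor powers\<close>

lemma words_Nil [simp]: "[] \<in> words M n \<longleftrightarrow> n = 0"
  by (auto simp: words_def)

lemma words_Cons: "x # ws \<in> words M n \<longleftrightarrow> x \<in> carrier M \<and> 0 < n \<and> ws \<in> words M (n - 1)"
  by (auto simp: words_def)

lemma words_Cons_Suc [simp]: "x # ws \<in> words M (Suc n) \<longleftrightarrow> x \<in> carrier M \<and> ws \<in> words M n"
  by (simp add: words_Cons)

lemma words_0 [simp]: "ws \<in> words M 0 \<longleftrightarrow> ws = []"
  by (auto simp: words_def)

lemma words_length: "ws \<in> words M n \<Longrightarrow> length ws = n"
  by (simp add: words_def)

lemma words_SucE:
  assumes "ws \<in> words M (Suc n)"
  obtains x ws' where "ws = x # ws'" "x \<in> carrier M" "ws' \<in> words M n"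
  using assms by (cases ws) auto

section \<open>Multi-additive balanced formulas on words\<close>

definition multiadditive ::
    "'a set \<Rightarrow> ('a, 'm) bimodule \<Rightarrow> ('n, 'z) ring_scheme \<Rightarrow> nat \<Rightarrow> ('m list \<Rightarrow> 'n) \<Rightarrow> bool" where
  "multiadditive S M N n \<phi> \<longleftrightarrow>
     \<phi> \<in> words M n \<rightarrow> carrier N \<and>
     (\<forall>us x y vs. us @ x # vs \<in> words M n \<longrightarrow> y \<in> carrier M \<longrightarrow>
        \<phi> (us @ (x \<oplus>\<^bsub>M\<^esub> y) # vs) = \<phi> (us @ x # vs) \<oplus>\<^bsub>N\<^esub> \<phi> (us @ y # vs)) \<and>
     (\<forall>us x s y vs. us @ x # y # vs \<in> words M n \<longrightarrow> s \<in> S \<longrightarrow>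
        \<phi> (us @ (x \<triangleleft>\<^bsub>M\<^esub> s) # y # vs) = \<phi> (us @ x # (s \<triangleright>\<^bsub>M\<^esub> y) # vs))"

lemma multiadditive_closed:
  "multiadditive S M N n \<phi> \<Longrightarrow> ws \<in> words M n \<Longrightarrow> \<phi> ws \<in> carrier N"
  by (auto simp: multiadditive_def)

lemma multiadditive_0 [simp]: "multiadditive S M N 0 \<phi> \<longleftrightarrow> \<phi> [] \<in> carrier N"
  by (auto simp: multiadditive_def)

text \<open>A relation either involves the first letter or lives entirely in the tail. In this form
  closure properties follow by induction on the number of factors, without splitting words as
  \<open>us @ x # vs\<close>.\<close>

lemma multiadditive_Suc:
  "multiadditive S M N (Suc n) \<phi> \<longleftrightarrow>
     (\<forall>x\<in>carrier M. multiadditive S M N n (\<lambda>ws. \<phi> (x # ws))) \<and>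
     (\<forall>x\<in>carrier M. \<forall>y\<in>carrier M. \<forall>ws\<in>words M n.
        \<phi> ((x \<oplus>\<^bsub>M\<^esub> y) # ws) = \<phi> (x # ws) \<oplus>\<^bsub>N\<^esub> \<phi> (y # ws)) \<and>
     (\<forall>x\<in>carrier M. \<forall>s\<in>S. \<forall>y ws. y # ws \<in> words M n \<longrightarrow>
        \<phi> ((x \<triangleleft>\<^bsub>M\<^esub> s) # y # ws) = \<phi> (x # (s \<triangleright>\<^bsub>M\<^esub> y) # ws))"
  (is "?l \<longleftrightarrow> ?a \<and> ?b \<and> ?c")
proof
  assume L: ?l
  have ?a
  proof
    fix x assume x: "x \<in> carrier M"
    show "multiadditive S M N n (\<lambda>ws. \<phi> (x # ws))"
      unfolding multiadditive_def
    proof (intro conjI allI impI)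
      show "(\<lambda>ws. \<phi> (x # ws)) \<in> words M n \<rightarrow> carrier N"
        using L x by (auto simp: multiadditive_def)
    next
      fix us y z vs assume "us @ y # vs \<in> words M n" "z \<in> carrier M"
      with L x show "\<phi> (x # us @ (y \<oplus>\<^bsub>M\<^esub> z) # vs)
          = \<phi> (x # us @ y # vs) \<oplus>\<^bsub>N\<^esub> \<phi> (x # us @ z # vs)"
        unfolding multiadditive_def
        by (metis append_Cons words_Cons_Suc)
    next
      fix us y s z vs assume "us @ y # z # vs \<in> words M n" "s \<in> S"
      with L x show "\<phi> (x # us @ (y \<triangleleft>\<^bsub>M\<^esub> s) # z # vs) = \<phi> (x # us @ y # (s \<triangleright>\<^bsub>M\<^esub> z) # vs)"
        unfolding multiadditive_def
        by (metis append_Cons words_Cons_Suc)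
    qed
  qed
  moreover have ?b
    using L unfolding multiadditive_def
    by (metis append_Nil words_Cons_Suc)
  moreover have ?c
    using L unfolding multiadditive_def
    by (metis append_Nil words_Cons_Suc)
  ultimately show "?a \<and> ?b \<and> ?c"
    by blast
next
  assume R: "?a \<and> ?b \<and> ?c"
  show ?l
    unfolding multiadditive_def
  proof (intro conjI allI impI)
    show "\<phi> \<in> words M (Suc n) \<rightarrow> carrier N"
    proof
      fix ws assume "ws \<in> words M (Suc n)"
      then show "\<phi> ws \<in> carrier N"
        using R by (auto elim!: words_SucE simp: multiadditive_def)
    qed
  next
    fix us y z vs assume "us @ y # vs \<in> words M (Suc n)" "z \<in> carrier M"
    then show "\<phi> (us @ (y \<oplus>\<^bsub>M\<^esub> z) # vs) = \<phi> (us @ y # vs) \<oplus>\<^bsub>N\<^esub> \<phi> (us @ z # vs)"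
      using R by (cases us) (auto simp: multiadditive_def)
  next
    fix us y s z vs assume "us @ y # z # vs \<in> words M (Suc n)" "s \<in> S"
    then show "\<phi> (us @ (y \<triangleleft>\<^bsub>M\<^esub> s) # z # vs) = \<phi> (us @ y # (s \<triangleright>\<^bsub>M\<^esub> z) # vs)"
      using R by (cases us) (auto simp: multiadditive_def)
  qed
qed

lemma multiadditive_add:
  assumes "abelian_group N" "multiadditive S M N n \<phi>" "multiadditive S M N n \<psi>"
  shows "multiadditive S M N n (\<lambda>ws. \<phi> ws \<oplus>\<^bsub>N\<^esub> \<psi> ws)"
proof -
  interpret N: abelian_group N by fact
  show ?thesis
    using assms(2,3)
  proof (induction n arbitrary: \<phi> \<psi>)
    case (Suc n)
    have cl: "\<phi> (x # ws) \<in> carrier N" "\<psi> (x # ws) \<in> carrier N"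
      if "x \<in> carrier M" "ws \<in> words M n" for x ws
      using that Suc.prems by (auto intro!: multiadditive_closed)
    show ?case
      using Suc unfolding multiadditive_Suc by (simp add: cl N.a_ac)
  qed simp
qed

lemma multiadditive_hom:
  assumes "multiadditive S M N n \<phi>" "f \<in> hom (add_monoid N) (add_monoid N')"
  shows "multiadditive S M N' n (\<lambda>ws. f (\<phi> ws))"
  using assms(1)
proof (induction n arbitrary: \<phi>)
  case (Suc n)
  have cl: "\<phi> (x # ws) \<in> carrier N" if "x \<in> carrier M" "ws \<in> words M n" for x ws
    using that Suc.prems by (auto intro!: multiadditive_closed)
  show ?case
    using Suc unfolding multiadditive_Suc by (simp add: cl add_hom_add[OF assms(2)])
qed (simp add: add_hom_closed[OF assms(2)])

text \<open>Closure under the two actions keeps the relators inside the free group on words. One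
  locale thus serves both \<open>A\<close> over \<open>B\<close> and \<open>T\<close> over
  \<open>R\<close>.\<close>

locale balanced_module = M?: abelian_group M
    for S :: "'a set" and M :: "('a, 'm) bimodule" (structure) +
  assumes lact_closed [simp]: "\<lbrakk>s \<in> S; x \<in> carrier M\<rbrakk> \<Longrightarrow> s \<triangleright>\<^bsub>M\<^esub> x \<in> carrier M"
    and ract_closed [simp]: "\<lbrakk>s \<in> S; x \<in> carrier M\<rbrakk> \<Longrightarrow> x \<triangleleft>\<^bsub>M\<^esub> s \<in> carrier M"
begin

lemma multiadditive_cong:
  assumes \<phi>: "multiadditive S M N n \<phi>" and eq: "\<And>ws. ws \<in> words M n \<Longrightarrow> \<phi> ws = \<psi> ws"
  shows "multiadditive S M N n \<psi>"
  unfolding multiadditive_def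
proof (intro conjI allI impI)
  show "\<psi> \<in> words M n \<rightarrow> carrier N"
    using \<phi> by (auto simp: multiadditive_def simp flip: eq)
next
  fix us x y vs assume w: "us @ x # vs \<in> words M n" "y \<in> carrier M"
  then have "us @ (x \<oplus> y) # vs \<in> words M n" "us @ y # vs \<in> words M n"
    by (auto simp: words_def)
  with w \<phi> show "\<psi> (us @ (x \<oplus> y) # vs) = \<psi> (us @ x # vs) \<oplus>\<^bsub>N\<^esub> \<psi> (us @ y # vs)"
    by (simp add: multiadditive_def flip: eq)
next
  fix us x s y vs assume w: "us @ x # y # vs \<in> words M n" "s \<in> S"
  then have "us @ (x \<triangleleft> s) # y # vs \<in> words M n" "us @ x # (s \<triangleright> y) # vs \<in> words M n"
    by (auto simp: words_def)
  with w \<phi> show "\<psi> (us @ (x \<triangleleft> s) # y # vs) = \<psi> (us @ x # (s \<triangleright> y) # vs)"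
    by (simp add: multiadditive_def flip: eq)
qed

lemma multiadditive_finsum:
  assumes "abelian_group N" "finite I" "\<And>i. i \<in> I \<Longrightarrow> multiadditive S M N n (\<phi> i)"
  shows "multiadditive S M N n (\<lambda>ws. \<Oplus>\<^bsub>N\<^esub>i\<in>I. \<phi> i ws)"
proof -
  interpret N: abelian_group N by fact
  have "(\<lambda>i. \<phi> i ws) \<in> I \<rightarrow> carrier N" if "ws \<in> words M n" for ws
    using assms(3) that by (auto intro: multiadditive_closed)
  note cl = this
  show ?thesis
    using assms(3) cl
  proof (induction n arbitrary: \<phi>)
    case 0
    then show ?case by (auto intro!: N.finsum_closed)
  next
    case (Suc n)
    have m: "multiadditive S M N n (\<lambda>ws. \<phi> i (x # ws))" if "x \<in> carrier M" "i \<in> I" for x i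
      using Suc.prems(1) that unfolding multiadditive_Suc by blast
    have c: "(\<lambda>i. \<phi> i (x # ws)) \<in> I \<rightarrow> carrier N" if "x \<in> carrier M" "ws \<in> words M n" for x ws
      using Suc.prems(2) that by simp
    show ?case
      unfolding multiadditive_Suc
    proof (intro conjI ballI allI impI)
      fix x assume "x \<in> carrier M"
      then show "multiadditive S M N n (\<lambda>ws. \<Oplus>\<^bsub>N\<^esub>i\<in>I. \<phi> i (x # ws))"
        using Suc.IH[of "\<lambda>i ws. \<phi> i (x # ws)"] m c by blast
    next
      fix x y ws assume w: "x \<in> carrier M" "y \<in> carrier M" "ws \<in> words M n"
      then have "(\<Oplus>\<^bsub>N\<^esub>i\<in>I. \<phi> i ((x \<oplus>\<^bsub>M\<^esub> y) # ws))
          = (\<Oplus>\<^bsub>N\<^esub>i\<in>I. \<phi> i (x # ws) \<oplus>\<^bsub>N\<^esub> \<phi> i (y # ws))"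
        using Suc.prems(1) c[OF w(1,3)] c[OF w(2,3)]
        by (intro N.finsum_cong') (auto simp: multiadditive_Suc)
      then show "(\<Oplus>\<^bsub>N\<^esub>i\<in>I. \<phi> i ((x \<oplus>\<^bsub>M\<^esub> y) # ws))
          = (\<Oplus>\<^bsub>N\<^esub>i\<in>I. \<phi> i (x # ws)) \<oplus>\<^bsub>N\<^esub> (\<Oplus>\<^bsub>N\<^esub>i\<in>I. \<phi> i (y # ws))"
        using c[OF w(1,3)] c[OF w(2,3)] by (simp add: N.finsum_addf)
    next
      fix x s y ws assume w: "x \<in> carrier M" "s \<in> S" "y # ws \<in> words M n"
      have "\<phi> i ((x \<triangleleft>\<^bsub>M\<^esub> s) # y # ws) = \<phi> i (x # (s \<triangleright>\<^bsub>M\<^esub> y) # ws)" if "i \<in> I" for i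
        using Suc.prems(1)[OF that] w unfolding multiadditive_Suc by blast
      then show "(\<Oplus>\<^bsub>N\<^esub>i\<in>I. \<phi> i ((x \<triangleleft>\<^bsub>M\<^esub> s) # y # ws))
          = (\<Oplus>\<^bsub>N\<^esub>i\<in>I. \<phi> i (x # (s \<triangleright>\<^bsub>M\<^esub> y) # ws))"
        using c[OF w(1), of "(s \<triangleright> y) # ws"] w by (intro N.finsum_cong') (auto simp: words_Cons)
    qed
  qed
qed

section \<open>The tensor group as a quotient of the free abelian group\<close>

abbreviation "Fr n \<equiv> free_Abelian_group (words M n)"
abbreviation "Rel n \<equiv> tensor_subgroup S M n"

lemma tensor_relators_closed: "tensor_relators S M n \<subseteq> carrier (Fr n)"
proof -
  have f: "Poly_Mapping.keys (frag_of a - frag_of b) \<subseteq> words M n"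
    if "a \<in> words M n" "b \<in> words M n" for a b
    using keys_diff[of "frag_of a" "frag_of b"] that by auto
  have g: "Poly_Mapping.keys (frag_of a - frag_of b - frag_of c) \<subseteq> words M n"
    if "a \<in> words M n" "b \<in> words M n" "c \<in> words M n" for a b c
    using keys_diff[of "frag_of a - frag_of b" "frag_of c"] f[OF that(1,2)] that(3) by auto
  show ?thesis
    unfolding tensor_relators_def
  proof (intro subsetI, elim UnE CollectE exE conjE)
    fix r us x y vs
    assume r: "r = frag_of (us @ (x \<oplus> y) # vs) - frag_of (us @ x # vs) - frag_of (us @ y # vs)"
      and w: "us @ x # vs \<in> words M n" "y \<in> carrier M"
    have "us @ y # vs \<in> words M n" "us @ (x \<oplus> y) # vs \<in> words M n"
      using w by (auto simp: words_def)
    with r w(1) show "r \<in> carrier (Fr n)"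
      by (simp add: g)
  next
    fix r us x s y vs
    assume r: "r = frag_of (us @ (x \<triangleleft> s) # y # vs) - frag_of (us @ x # (s \<triangleright> y) # vs)"
      and w: "us @ x # y # vs \<in> words M n" "s \<in> S"
    have "us @ (x \<triangleleft> s) # y # vs \<in> words M n" "us @ x # (s \<triangleright> y) # vs \<in> words M n"
      using w by (auto simp: words_def)
    with r show "r \<in> carrier (Fr n)"
      by (simp add: f)
  qed
qed

lemma tensor_subgroup_normal: "Rel n \<lhd> Fr n"
  unfolding tensor_subgroup_def
  by (intro comm_group.normal_iff_subgroup[THEN iffD2] abelian_free_Abelian_group
      group.generate_is_subgroup group_free_Abelian_group tensor_relators_closed)

lemma carrier_tensor_group:
  "carrier (tensor_group S M n) = (\<lambda>F. Rel n #>\<^bsub>Fr n\<^esub> F) ` carrier (Fr n)"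
  by (auto simp: tensor_group_def Let_def FactGroup_def RCOSETS_def)

lemma add_tensor_group:
  assumes "F \<in> carrier (Fr n)" "G \<in> carrier (Fr n)"
  shows "(Rel n #>\<^bsub>Fr n\<^esub> F) \<oplus>\<^bsub>tensor_group S M n\<^esub> (Rel n #>\<^bsub>Fr n\<^esub> G) = Rel n #>\<^bsub>Fr n\<^esub> (F + G)"
  using normal.rcos_sum[OF tensor_subgroup_normal assms]
  by (simp add: tensor_group_def Let_def FactGroup_def)

lemma zero_tensor_group: "\<zero>\<^bsub>tensor_group S M n\<^esub> = Rel n #>\<^bsub>Fr n\<^esub> 0"
  using group.coset_join2[OF group_free_Abelian_group, of 0 "words M n" "Rel n"]
    normal_imp_subgroup[OF tensor_subgroup_normal, of n]
    subgroup.one_closed[OF normal_imp_subgroup[OF tensor_subgroup_normal], of n]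
  by (simp add: tensor_group_def Let_def FactGroup_def)

lemma abelian_group_tensor_group: "abelian_group (tensor_group S M n)"
proof (rule abelian_groupI)
  have add: "Poly_Mapping.keys (a + b) \<subseteq> words M n"
    if "Poly_Mapping.keys a \<subseteq> words M n" "Poly_Mapping.keys b \<subseteq> words M n" for a b :: "'m list \<Rightarrow>\<^sub>0 int"
    using that keys_add[of a b] by blast
  note s = carrier_tensor_group add_tensor_group zero_tensor_group add
  show "\<And>x y. x \<in> carrier (tensor_group S M n) \<Longrightarrow> y \<in> carrier (tensor_group S M n) \<Longrightarrow>
      x \<oplus>\<^bsub>tensor_group S M n\<^esub> y \<in> carrier (tensor_group S M n)"
    by (auto simp: s)
  show "\<zero>\<^bsub>tensor_group S M n\<^esub> \<in> carrier (tensor_group S M n)"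
    by (auto simp: s)
  show "\<And>x y z. \<lbrakk>x \<in> carrier (tensor_group S M n); y \<in> carrier (tensor_group S M n);
      z \<in> carrier (tensor_group S M n)\<rbrakk>
     \<Longrightarrow> x \<oplus>\<^bsub>tensor_group S M n\<^esub> y \<oplus>\<^bsub>tensor_group S M n\<^esub> z
       = x \<oplus>\<^bsub>tensor_group S M n\<^esub> (y \<oplus>\<^bsub>tensor_group S M n\<^esub> z)"
    by (auto simp: s add.assoc)
  show "\<And>x y. \<lbrakk>x \<in> carrier (tensor_group S M n); y \<in> carrier (tensor_group S M n)\<rbrakk>
     \<Longrightarrow> x \<oplus>\<^bsub>tensor_group S M n\<^esub> y = y \<oplus>\<^bsub>tensor_group S M n\<^esub> x"
    by (auto simp: s add.commute)
  show "\<And>x. x \<in> carrier (tensor_group S M n) \<Longrightarrow> \<zero>\<^bsub>tensor_group S M n\<^esub> \<oplus>\<^bsub>tensor_group S M n\<^esub> x = x"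
    by (auto simp: s)
  show "\<exists>y\<in>carrier (tensor_group S M n). y \<oplus>\<^bsub>tensor_group S M n\<^esub> x = \<zero>\<^bsub>tensor_group S M n\<^esub>"
    if "x \<in> carrier (tensor_group S M n)" for x
  proof -
    obtain F where F: "Poly_Mapping.keys F \<subseteq> words M n" "x = Rel n #>\<^bsub>Fr n\<^esub> F"
      using \<open>x \<in> _\<close> by (auto simp: s)
    then show ?thesis
      by (intro bexI[of _ "Rel n #>\<^bsub>Fr n\<^esub> (- F)"]) (auto simp: s)
  qed
qed

lemma pure_tensor_eq: "ws \<in> words M n \<Longrightarrow> pure_tensor S M ws = Rel n #>\<^bsub>Fr n\<^esub> frag_of ws"
  by (simp add: pure_tensor_def words_length)

lemma pure_tensor_closed:
  "ws \<in> words M n \<Longrightarrow> pure_tensor S M ws \<in> carrier (tensor_group S M n)"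
  by (auto simp: pure_tensor_eq carrier_tensor_group)

lemma coset_eqI:
  assumes "F \<in> carrier (Fr n)" "G \<in> carrier (Fr n)" "F - G \<in> Rel n"
  shows "Rel n #>\<^bsub>Fr n\<^esub> F = Rel n #>\<^bsub>Fr n\<^esub> G"
proof -
  interpret G: group "Fr n" by simp
  have "F \<in> Rel n #>\<^bsub>Fr n\<^esub> G"
    unfolding r_coset_def using assms(3) by (auto intro: bexI[of _ "F - G"])
  then show ?thesis
    using G.repr_independence[of F "Rel n" G] assms normal_imp_subgroup[OF tensor_subgroup_normal]
    by auto
qed

lemma relator_closed: "r \<in> tensor_relators S M n \<Longrightarrow> r \<in> Rel n"
  unfolding tensor_subgroup_def by (rule generate.incl)

lemma multiadditive_pure_tensor:
  "multiadditive S M (tensor_group S M n) n (pure_tensor S M)"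
  unfolding multiadditive_def
proof (intro conjI allI impI)
  show "pure_tensor S M \<in> words M n \<rightarrow> carrier (tensor_group S M n)"
    using pure_tensor_closed by auto
next
  fix us x y vs
  assume w: "us @ x # vs \<in> words M n" and y: "y \<in> carrier M"
  have w': "us @ y # vs \<in> words M n" "us @ (x \<oplus>\<^bsub>M\<^esub> y) # vs \<in> words M n"
    using w y by (auto simp: words_def)
  have a: "frag_of (us @ x # vs) + frag_of (us @ y # vs) \<in> carrier (Fr n)"
    using w w' keys_add[of "frag_of (us @ x # vs)" "frag_of (us @ y # vs)"] by auto
  have "frag_of (us @ (x \<oplus>\<^bsub>M\<^esub> y) # vs) - frag_of (us @ x # vs) - frag_of (us @ y # vs) \<in> Rel n"
    by (rule relator_closed) (use w y in \<open>auto simp: tensor_relators_def\<close>)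
  then have "Rel n #>\<^bsub>Fr n\<^esub> frag_of (us @ (x \<oplus>\<^bsub>M\<^esub> y) # vs)
      = Rel n #>\<^bsub>Fr n\<^esub> (frag_of (us @ x # vs) + frag_of (us @ y # vs))"
    by (intro coset_eqI a) (use w' in \<open>simp_all add: diff_diff_eq\<close>)
  then show "pure_tensor S M (us @ (x \<oplus>\<^bsub>M\<^esub> y) # vs)
      = pure_tensor S M (us @ x # vs) \<oplus>\<^bsub>tensor_group S M n\<^esub> pure_tensor S M (us @ y # vs)"
    using w w' by (simp add: pure_tensor_eq add_tensor_group)
next
  fix us x s y vs
  assume w: "us @ x # y # vs \<in> words M n" and s: "s \<in> S"
  have w': "us @ (x \<triangleleft>\<^bsub>M\<^esub> s) # y # vs \<in> words M n" "us @ x # (s \<triangleright>\<^bsub>M\<^esub> y) # vs \<in> words M n"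
    using w s by (auto simp: words_def)
  have "frag_of (us @ (x \<triangleleft>\<^bsub>M\<^esub> s) # y # vs) - frag_of (us @ x # (s \<triangleright>\<^bsub>M\<^esub> y) # vs) \<in> Rel n"
    by (rule relator_closed) (use w s in \<open>unfold tensor_relators_def, blast\<close>)
  then show "pure_tensor S M (us @ (x \<triangleleft>\<^bsub>M\<^esub> s) # y # vs) = pure_tensor S M (us @ x # (s \<triangleright>\<^bsub>M\<^esub> y) # vs)"
    using w' by (simp add: pure_tensor_eq coset_eqI)
qed

section \<open>Evaluation of formulas at tensors\<close>

lemma tensor_rep:
  assumes "X \<in> carrier (tensor_group S M n)"
  shows "(SOME F. F \<in> X) \<in> X" "Poly_Mapping.keys (SOME F. F \<in> X) \<subseteq> words M n"
proof -
  obtain F where F: "F \<in> carrier (Fr n)" "X = Rel n #>\<^bsub>Fr n\<^esub> F"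
    using assms by (auto simp: carrier_tensor_group)
  have sub: "subgroup (Rel n) (Fr n)"
    by (rule normal_imp_subgroup[OF tensor_subgroup_normal])
  show *: "(SOME F. F \<in> X) \<in> X"
    by (rule someI[of _ F])
      (use F sub group.rcos_self[OF group_free_Abelian_group] in blast)
  show "Poly_Mapping.keys (SOME F. F \<in> X) \<subseteq> words M n"
    using * monoid.r_coset_subset_G[OF group.is_monoid[OF group_free_Abelian_group] subgroup.subset[OF sub] F(1)]
    by (auto simp: F(2) subset_iff)
qed

text \<open>Both sides use the same chosen representative of \<open>X\<close>, and its support
  consists of words; agreement on words is therefore enough even for formulas that are not
  balanced.\<close>

lemma tensor_lift_cong:
  assumes "abelian_group N" "X \<in> carrier (tensor_group S M n)"
    and "\<And>ws. ws \<in> words M n \<Longrightarrow> \<phi> ws \<in> carrier N" "\<And>ws. ws \<in> words M n \<Longrightarrow> \<phi> ws = \<psi> ws"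
  shows "tensor_lift N \<phi> X = tensor_lift N \<psi> X"
proof -
  interpret N: abelian_group N by fact
  show ?thesis
    unfolding tensor_lift_def Let_def
    by (rule N.finsum_cong') (use assms tensor_rep[OF assms(2)] in auto)
qed

lemma tensor_lift_closed:
  assumes "abelian_group N" "X \<in> carrier (tensor_group S M n)"
    and "\<And>ws. ws \<in> words M n \<Longrightarrow> \<phi> ws \<in> carrier N"
  shows "tensor_lift N \<phi> X \<in> carrier N"
proof -
  interpret N: abelian_group N by fact
  show ?thesis
    unfolding tensor_lift_def Let_def
    by (rule N.finsum_closed) (use assms tensor_rep[OF assms(2)] in auto)
qed

lemma tensor_lift_add:
  assumes "abelian_group N" "X \<in> carrier (tensor_group S M n)"
    and "\<And>ws. ws \<in> words M n \<Longrightarrow> \<phi> ws \<in> carrier N" "\<And>ws. ws \<in> words M n \<Longrightarrow> \<psi> ws \<in> carrier N"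
  shows "tensor_lift N (\<lambda>ws. \<phi> ws \<oplus>\<^bsub>N\<^esub> \<psi> ws) X = tensor_lift N \<phi> X \<oplus>\<^bsub>N\<^esub> tensor_lift N \<psi> X"
proof -
  interpret N: abelian_group N by fact
  let ?F = "SOME F. F \<in> X"
  have cl: "\<phi> ws \<in> carrier N" "\<psi> ws \<in> carrier N" if "ws \<in> Poly_Mapping.keys ?F" for ws
    using that assms tensor_rep[OF assms(2)] by auto
  have "tensor_lift N (\<lambda>ws. \<phi> ws \<oplus>\<^bsub>N\<^esub> \<psi> ws) X
      = (\<Oplus>\<^bsub>N\<^esub>ws\<in>Poly_Mapping.keys ?F. [Poly_Mapping.lookup ?F ws] \<cdot>\<^bsub>N\<^esub> \<phi> ws
           \<oplus>\<^bsub>N\<^esub> [Poly_Mapping.lookup ?F ws] \<cdot>\<^bsub>N\<^esub> \<psi> ws)"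
    unfolding tensor_lift_def Let_def
    by (rule N.finsum_cong') (auto simp: cl N.add.int_pow_distrib)
  then show ?thesis
    unfolding tensor_lift_def Let_def
    by (simp add: N.finsum_addf cl Pi_def)
qed

lemma tensor_lift_hom:
  assumes N: "abelian_group N" and N': "abelian_group N'" and "X \<in> carrier (tensor_group S M n)"
    and "\<And>ws. ws \<in> words M n \<Longrightarrow> \<phi> ws \<in> carrier N" and f: "f \<in> hom (add_monoid N) (add_monoid N')"
  shows "f (tensor_lift N \<phi> X) = tensor_lift N' (\<lambda>ws. f (\<phi> ws)) X"
proof -
  interpret N: abelian_group N by fact
  interpret N': abelian_group N' by fact
  let ?F = "SOME F. F \<in> X"
  have cl: "\<phi> ws \<in> carrier N" if "ws \<in> Poly_Mapping.keys ?F" for ws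
    using that assms tensor_rep[OF assms(3)] by auto
  show ?thesis
    unfolding tensor_lift_def Let_def
    by (subst add_hom_finsum[OF N N' f])
      (auto simp: cl add_hom_int_pow[OF N N' f] add_hom_closed[OF f] intro!: N'.finsum_cong')
qed

text \<open>The free group extends \<open>\<phi>\<close> to a homomorphism \<open>h\<close>.
  Multi-additivity and balancedness say that \<open>h\<close> kills the relators, hence the subgroup
  they generate, so any representative gives the same value. The map \<open>h\<close> is handed on
  because it also yields additivity in the tensor.\<close>

lemma tensor_lift_coset:
  assumes N: "abelian_group N" and \<phi>: "multiadditive S M N n \<phi>"
  obtains h where "h \<in> hom (Fr n) (add_monoid N)"
    "\<And>ws. ws \<in> words M n \<Longrightarrow> h (frag_of ws) = \<phi> ws"
    "\<And>F. F \<in> carrier (Fr n) \<Longrightarrow> tensor_lift N \<phi> (Rel n #>\<^bsub>Fr n\<^esub> F) = h F"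
proof -
  interpret N: abelian_group N by fact
  have sub: "subgroup (Rel n) (Fr n)"
    by (rule normal_imp_subgroup[OF tensor_subgroup_normal])
  obtain h where h: "h \<in> hom (Fr n) (add_monoid N)"
    and hf: "\<And>ws. ws \<in> words M n \<Longrightarrow> h (frag_of ws) = \<phi> ws"
    using comm_group.free_Abelian_group_universal[OF N.a_comm_group, of \<phi> "words M n"]
      multiadditive_closed[OF \<phi>] by auto
  interpret h: group_hom "Fr n" "add_monoid N" h
    using h by (simp add: group_hom_def group_hom_axioms_def N.a_group)
  have hadd: "h (F + G) = h F \<oplus>\<^bsub>N\<^esub> h G" if "F \<in> carrier (Fr n)" "G \<in> carrier (Fr n)" for F G
    using h.hom_mult[OF that] by simp
  have hcl: "h F \<in> carrier N" if "F \<in> carrier (Fr n)" for F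
    using h.hom_closed[OF that] by simp
  have hdiff: "h (F - G) = h F \<ominus>\<^bsub>N\<^esub> h G" if "F \<in> carrier (Fr n)" "G \<in> carrier (Fr n)" for F G
  proof -
    have "h (- G) = \<ominus>\<^bsub>N\<^esub> h G"
      using h.hom_inv[of G] that by (simp add: a_inv_def)
    then show ?thesis
      using hadd[of F "- G"] that by (simp add: a_minus_def)
  qed
  have of: "frag_of ws \<in> carrier (Fr n)" if "ws \<in> words M n" for ws
    using that by simp
  have diff: "F - G \<in> carrier (Fr n)" if "F \<in> carrier (Fr n)" "G \<in> carrier (Fr n)" for F G
    using that keys_diff[of F G] by auto
  have rel: "h r = \<zero>\<^bsub>N\<^esub>" if "r \<in> tensor_relators S M n" for r
    using that unfolding tensor_relators_def
  proof (elim UnE CollectE exE conjE)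
    fix us x y vs
    assume r: "r = frag_of (us @ (x \<oplus>\<^bsub>M\<^esub> y) # vs) - frag_of (us @ x # vs) - frag_of (us @ y # vs)"
      and w: "us @ x # vs \<in> words M n" "y \<in> carrier M"
    have w': "us @ y # vs \<in> words M n" "us @ (x \<oplus>\<^bsub>M\<^esub> y) # vs \<in> words M n"
      using w by (auto simp: words_def)
    have "\<phi> (us @ (x \<oplus>\<^bsub>M\<^esub> y) # vs) = \<phi> (us @ x # vs) \<oplus>\<^bsub>N\<^esub> \<phi> (us @ y # vs)"
      using \<phi> w by (auto simp: multiadditive_def)
    moreover have "\<phi> (us @ x # vs) \<in> carrier N" "\<phi> (us @ y # vs) \<in> carrier N"
      using \<phi> w w' by (auto intro: multiadditive_closed)
    ultimately show ?thesis
      unfolding r using w w'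
      by (simp add: hdiff of diff hf del: carrier_free_Abelian_group_iff)
        (metis N.add.inv_closed N.add.inv_solve_right' N.a_comm N.r_neg N.zero_closed a_minus_def
          N.minus_closed N.add.m_closed N.minus_add N.add.m_assoc)
  next
    fix us x s y vs
    assume r: "r = frag_of (us @ (x \<triangleleft>\<^bsub>M\<^esub> s) # y # vs) - frag_of (us @ x # (s \<triangleright>\<^bsub>M\<^esub> y) # vs)"
      and w: "us @ x # y # vs \<in> words M n" "s \<in> S"
    have w': "us @ (x \<triangleleft>\<^bsub>M\<^esub> s) # y # vs \<in> words M n" "us @ x # (s \<triangleright>\<^bsub>M\<^esub> y) # vs \<in> words M n"
      using w by (auto simp: words_def)
    have "\<phi> (us @ (x \<triangleleft>\<^bsub>M\<^esub> s) # y # vs) = \<phi> (us @ x # (s \<triangleright>\<^bsub>M\<^esub> y) # vs)"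
      using \<phi> w by (auto simp: multiadditive_def)
    then show ?thesis
      unfolding r using w' multiadditive_closed[OF \<phi>]
      by (simp add: hdiff of hf N.minus_eq N.r_neg del: carrier_free_Abelian_group_iff)
  qed
  have ker: "h r = \<zero>\<^bsub>N\<^esub>" if "r \<in> Rel n" for r
  proof -
    have "subgroup (kernel (Fr n) (add_monoid N) h) (Fr n)"
      by (rule h.subgroup_kernel)
    moreover have "tensor_relators S M n \<subseteq> kernel (Fr n) (add_monoid N) h"
      using rel tensor_relators_closed[of n]
      by (auto simp: kernel_def simp del: carrier_free_Abelian_group_iff)
    ultimately have "Rel n \<subseteq> kernel (Fr n) (add_monoid N) h"
      unfolding tensor_subgroup_def by (intro group.generate_subgroup_incl) auto
    then show ?thesis
      using that by (auto simp: kernel_def)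
  qed
  have lin: "h (\<Sum>i\<in>I. frag_cmul (c i) (frag_of i)) = (\<Oplus>\<^bsub>N\<^esub>i\<in>I. [c i] \<cdot>\<^bsub>N\<^esub> \<phi> i)"
    if "finite I" "I \<subseteq> words M n" for I and c :: "'m list \<Rightarrow> int"
    using that
  proof (induction I)
    case empty
    then show ?case using h.hom_one by simp
  next
    case (insert i I)
    have c: "frag_cmul (c i) (frag_of i) \<in> carrier (Fr n)" if "i \<in> words M n" for i
      using that by auto
    have s: "(\<Sum>i\<in>I. frag_cmul (c i) (frag_of i)) \<in> carrier (Fr n)"
      by (rule sum_closed_free_Abelian_group) (use c insert in blast)
    have "h (frag_cmul (c i) (frag_of i)) = [c i] \<cdot>\<^bsub>N\<^esub> \<phi> i"
      using h.hom_int_pow[OF of, of i "c i"] insert.prems hf[of i]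
      by (simp add: add_pow_def)
    moreover have "\<phi> i \<in> carrier N" if "i \<in> words M n" for i
      using that multiadditive_closed[OF \<phi>] by blast
    ultimately show ?case
      using insert hadd[OF c s] by (simp add: subset_iff Pi_def)
  qed
  \<comment> \<open>Expanding \<open>F\<close> in the basis of words turns \<open>h F\<close> into
    the very sum by which \<open>tensor_lift\<close> is defined.\<close>
  have ext: "h F = (\<Oplus>\<^bsub>N\<^esub>ws\<in>Poly_Mapping.keys F. [Poly_Mapping.lookup F ws] \<cdot>\<^bsub>N\<^esub> \<phi> ws)"
    if "F \<in> carrier (Fr n)" for F
    using lin[OF finite_keys, of F "Poly_Mapping.lookup F"] that frag_expansion[of F]
    by (simp add: frag_extend_def)
  have "tensor_lift N \<phi> (Rel n #>\<^bsub>Fr n\<^esub> F) = h F" if F: "F \<in> carrier (Fr n)" for F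
  proof -
    define X where "X = Rel n #>\<^bsub>Fr n\<^esub> F"
    define G where "G = (SOME F. F \<in> X)"
    have X: "X \<in> carrier (tensor_group S M n)"
      using F by (auto simp: X_def carrier_tensor_group)
    have G: "G \<in> X" "G \<in> carrier (Fr n)"
      using tensor_rep[OF X] by (auto simp: G_def)
    then obtain r where r: "r \<in> Rel n" "G = r + F"
      by (auto simp: X_def r_coset_def)
    then have "h G = h F"
      using hadd[of r F] ker F hcl subgroup.mem_carrier[OF sub r(1)] by simp
    then show ?thesis
      using ext[OF G(2)] by (simp add: tensor_lift_def Let_def G_def X_def)
  qed
  then show thesis
    using that h hf by blast
qed

lemma tensor_lift_pure:
  assumes "abelian_group N" "multiadditive S M N n \<phi>" "ws \<in> words M n"
  shows "tensor_lift N \<phi> (pure_tensor S M ws) = \<phi> ws"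
  using tensor_lift_coset[OF assms(1,2)] assms(3)
  by (metis pure_tensor_eq frag_of_in_free_Abelian_group)

lemma tensor_lift_additive:
  assumes N: "abelian_group N" and \<phi>: "multiadditive S M N n \<phi>"
  shows "tensor_lift N \<phi> \<in> hom (add_monoid (tensor_group S M n)) (add_monoid N)"
proof (rule add_homI)
  obtain h where h: "h \<in> hom (Fr n) (add_monoid N)"
    "\<And>F. F \<in> carrier (Fr n) \<Longrightarrow> tensor_lift N \<phi> (Rel n #>\<^bsub>Fr n\<^esub> F) = h F"
    using tensor_lift_coset[OF N \<phi>] by metis
  show "tensor_lift N \<phi> X \<in> carrier N" if "X \<in> carrier (tensor_group S M n)" for X
    using N that multiadditive_closed[OF \<phi>] by (rule tensor_lift_closed)
  fix X Y
  assume "X \<in> carrier (tensor_group S M n)" "Y \<in> carrier (tensor_group S M n)"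
  then obtain F G where FG: "F \<in> carrier (Fr n)" "X = Rel n #>\<^bsub>Fr n\<^esub> F"
    "G \<in> carrier (Fr n)" "Y = Rel n #>\<^bsub>Fr n\<^esub> G"
    unfolding carrier_tensor_group by blast
  have "F + G \<in> carrier (Fr n)"
    using FG keys_add[of F G] by auto
  moreover have "h (F + G) = h F \<oplus>\<^bsub>N\<^esub> h G"
    using h(1) FG by (auto simp: hom_def)
  ultimately show "tensor_lift N \<phi> (X \<oplus>\<^bsub>tensor_group S M n\<^esub> Y)
      = tensor_lift N \<phi> X \<oplus>\<^bsub>N\<^esub> tensor_lift N \<phi> Y"
    using FG(1,3) by (simp add: FG(2,4) add_tensor_group h(2) del: carrier_free_Abelian_group_iff)
qed

text \<open>Pure tensors generate the tensor group; the induction runs over a formal sum that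
  represents \<open>X\<close>.\<close>

lemma tensor_hom_eqI:
  assumes N: "abelian_group N"
    and f: "f \<in> hom (add_monoid (tensor_group S M n)) (add_monoid N)"
    and g: "g \<in> hom (add_monoid (tensor_group S M n)) (add_monoid N)"
    and eq: "\<And>ws. ws \<in> words M n \<Longrightarrow> f (pure_tensor S M ws) = g (pure_tensor S M ws)"
    and X: "X \<in> carrier (tensor_group S M n)"
  shows "f X = g X"
proof -
  let ?c = "\<lambda>F. Rel n #>\<^bsub>Fr n\<^esub> F"
  note tg = abelian_group_tensor_group[of n]
  interpret tg: abelian_group "tensor_group S M n" by (rule tg)
  obtain F where F: "F \<in> carrier (Fr n)" "X = ?c F"
    using X by (auto simp: carrier_tensor_group)
  have "Poly_Mapping.keys F \<subseteq> words M n"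
    using F by simp
  then have "f (?c F) = g (?c F)"
  proof (induction F rule: free_Abelian_group_induct[consumes 1, case_names zero diff frag])
    case zero
    then show ?case
      using add_hom_zero[OF tg N f] add_hom_zero[OF tg N g] by (simp add: zero_tensor_group)
  next
    case (diff F G)
    have c: "?c F \<in> carrier (tensor_group S M n)" if "Poly_Mapping.keys F \<subseteq> words M n" for F
      using that by (auto simp: carrier_tensor_group)
    have m: "\<ominus>\<^bsub>tensor_group S M n\<^esub> ?c G = ?c (- G)"
      by (rule tg.minus_equality)
        (use diff in \<open>simp_all add: c add_tensor_group zero_tensor_group\<close>)
    have "?c (F - G) = ?c F \<oplus>\<^bsub>tensor_group S M n\<^esub> (\<ominus>\<^bsub>tensor_group S M n\<^esub> ?c G)"
      using diff by (simp add: m add_tensor_group)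
    then show ?case
      using diff by (simp add: c add_hom_add[OF f] add_hom_add[OF g]
          add_hom_a_inv[OF tg N f] add_hom_a_inv[OF tg N g])
  next
    case (frag ws)
    then show ?case
      using eq[of ws] by (simp add: pure_tensor_eq)
  qed
  then show ?thesis
    using F by simp
qed

end

section \<open>Actions on the outer factors\<close>

lemma carrier_tensor_power [simp]: "carrier (tensor_power S M n) = carrier (tensor_group S M n)"
  and add_tensor_power [simp]: "add (tensor_power S M n) = add (tensor_group S M n)"
  and zero_tensor_power [simp]: "\<zero>\<^bsub>tensor_power S M n\<^esub> = \<zero>\<^bsub>tensor_group S M n\<^esub>"
  by (simp_all add: tensor_power_def Let_def)

lemma lact_tensor_power: "a \<triangleright>\<^bsub>tensor_power S M n\<^esub> X =
    tensor_lift (tensor_group S M n) (\<lambda>ws. pure_tensor S M ((a \<triangleright>\<^bsub>M\<^esub> hd ws) # tl ws)) X"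
  and ract_tensor_power: "X \<triangleleft>\<^bsub>tensor_power S M n\<^esub> a =
    tensor_lift (tensor_group S M n) (\<lambda>ws. pure_tensor S M (butlast ws @ [last ws \<triangleleft>\<^bsub>M\<^esub> a])) X"
  by (simp_all add: tensor_power_def Let_def)

text \<open>\<open>L\<close> acts on the outer factors of a tensor power over \<open>S\<close>: on \<open>A \<otimes>\<^sub>B \<cdots> \<otimes>\<^sub>B A\<close> all of \<open>A\<close> acts, on
  \<open>T \<otimes>\<^sub>R \<cdots> \<otimes>\<^sub>R T\<close> only \<open>R\<close> does.\<close>

locale balanced_bimodule = balanced_module S M
    for S :: "'a set" and M :: "('a, 'm) bimodule" (structure) +
  fixes L :: "'a set"
  assumes S_subset: "S \<subseteq> L"
    and outer_lact_closed [simp]: "\<lbrakk>a \<in> L; x \<in> carrier M\<rbrakk> \<Longrightarrow> a \<triangleright> x \<in> carrier M"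
    and outer_ract_closed [simp]: "\<lbrakk>a \<in> L; x \<in> carrier M\<rbrakk> \<Longrightarrow> x \<triangleleft> a \<in> carrier M"
    and outer_lact_add: "\<lbrakk>a \<in> L; x \<in> carrier M; y \<in> carrier M\<rbrakk> \<Longrightarrow> a \<triangleright> (x \<oplus> y) = (a \<triangleright> x) \<oplus> (a \<triangleright> y)"
    and outer_ract_add: "\<lbrakk>a \<in> L; x \<in> carrier M; y \<in> carrier M\<rbrakk> \<Longrightarrow> (x \<oplus> y) \<triangleleft> a = (x \<triangleleft> a) \<oplus> (y \<triangleleft> a)"
    and outer_lact_ract: "\<lbrakk>a \<in> L; b \<in> L; x \<in> carrier M\<rbrakk> \<Longrightarrow> (a \<triangleright> x) \<triangleleft> b = a \<triangleright> (x \<triangleleft> b)"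
begin

lemma multiadditive_lact:
  assumes "multiadditive S M N (Suc n) \<phi>" "a \<in> L"
  shows "multiadditive S M N (Suc n) (\<lambda>ws. \<phi> ((a \<triangleright> hd ws) # tl ws))"
  using assms S_subset unfolding multiadditive_Suc[of _ _ _ n]
  by (auto simp: outer_lact_add outer_lact_ract[symmetric])

lemma multiadditive_ract:
  assumes "multiadditive S M N (Suc n) \<phi>" "a \<in> L"
  shows "multiadditive S M N (Suc n) (\<lambda>ws. \<phi> (butlast ws @ [last ws \<triangleleft> a]))"
  using assms(1)
proof (induction n arbitrary: \<phi>)
  case 0
  then show ?case
    using assms(2) by (auto simp: multiadditive_Suc words_Cons outer_ract_add)
next
  case (Suc n)
  have ne: "ws \<noteq> []" if "ws \<in> words M (Suc n)" for ws
    using that by auto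
  have w: "butlast ws @ [last ws \<triangleleft> a] \<in> words M (Suc n)" if "ws \<in> words M (Suc n)" for ws
    using that assms(2) ne[OF that]
    by (cases ws rule: rev_cases) (auto simp: words_def)
  show ?case
    unfolding multiadditive_Suc[of _ _ _ "Suc n"]
  proof (intro conjI ballI allI impI)
    fix x assume "x \<in> carrier M"
    then have "multiadditive S M N (Suc n) (\<lambda>ws. \<phi> (x # ws))"
      using Suc.prems by (simp add: multiadditive_Suc[of _ _ _ "Suc n"])
    from Suc.IH[OF this] show
      "multiadditive S M N (Suc n) (\<lambda>ws. \<phi> (butlast (x # ws) @ [last (x # ws) \<triangleleft> a]))"
      by (rule multiadditive_cong) (simp add: ne)
  next
    fix x y ws assume "x \<in> carrier M" "y \<in> carrier M" "ws \<in> words M (Suc n)"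
    with w[of ws] Suc.prems ne[of ws] show "\<phi> (butlast ((x \<oplus> y) # ws) @ [last ((x \<oplus> y) # ws) \<triangleleft> a]) =
        \<phi> (butlast (x # ws) @ [last (x # ws) \<triangleleft> a]) \<oplus>\<^bsub>N\<^esub> \<phi> (butlast (y # ws) @ [last (y # ws) \<triangleleft> a])"
      unfolding multiadditive_Suc[of _ _ _ "Suc n"] by simp
  next
    fix x s y ws assume h: "x \<in> carrier M" "s \<in> S" "y # ws \<in> words M (Suc n)"
    \<comment> \<open>When \<open>y\<close> is the last letter, the inner action of \<open>s\<close>
      and the outer action of \<open>a\<close> fall on the same letter and have to be
      interchanged.\<close>
    then have "(s \<triangleright> y) \<triangleleft> a = s \<triangleright> (y \<triangleleft> a)"
      using S_subset assms(2) by (auto intro: outer_lact_ract)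
    then show "\<phi> (butlast ((x \<triangleleft> s) # y # ws) @ [last ((x \<triangleleft> s) # y # ws) \<triangleleft> a]) =
        \<phi> (butlast (x # (s \<triangleright> y) # ws) @ [last (x # (s \<triangleright> y) # ws) \<triangleleft> a])"
      using w[OF h(3)] Suc.prems h unfolding multiadditive_Suc[of _ _ _ "Suc n"] by auto
  qed
qed

text \<open>A positive number of factors ensures that there is an outer letter for \<open>a\<close>
  to act on.\<close>

context
  fixes a and n :: nat
  assumes a: "a \<in> L" and n: "0 < n"
begin

lemma lact_word: "ws \<in> words M n \<Longrightarrow> (a \<triangleright> hd ws) # tl ws \<in> words M n"
  using a n by (cases ws) (auto simp: words_def)

lemma ract_word: "ws \<in> words M n \<Longrightarrow> butlast ws @ [last ws \<triangleleft> a] \<in> words M n"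
  using a n by (cases ws rule: rev_cases) (auto simp: words_def)

lemma multiadditive_lact_pure:
  "multiadditive S M (tensor_group S M n) n (\<lambda>ws. pure_tensor S M ((a \<triangleright> hd ws) # tl ws))"
  using multiadditive_lact[OF _ a, of _ "n - 1"] multiadditive_pure_tensor[of n] n by simp

lemma multiadditive_ract_pure:
  "multiadditive S M (tensor_group S M n) n (\<lambda>ws. pure_tensor S M (butlast ws @ [last ws \<triangleleft> a]))"
  using multiadditive_ract[OF _ a, of _ "n - 1"] multiadditive_pure_tensor[of n] n by simp

lemma lact_tensor_hom:
  "(\<lambda>X. a \<triangleright>\<^bsub>tensor_power S M n\<^esub> X) \<in> hom (add_monoid (tensor_group S M n)) (add_monoid (tensor_group S M n))"
  unfolding lact_tensor_power
  by (rule tensor_lift_additive[OF abelian_group_tensor_group multiadditive_lact_pure])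

lemma ract_tensor_hom:
  "(\<lambda>X. X \<triangleleft>\<^bsub>tensor_power S M n\<^esub> a) \<in> hom (add_monoid (tensor_group S M n)) (add_monoid (tensor_group S M n))"
  unfolding ract_tensor_power
  by (rule tensor_lift_additive[OF abelian_group_tensor_group multiadditive_ract_pure])

lemmas lact_tensor_closed = add_hom_closed[OF lact_tensor_hom]
lemmas ract_tensor_closed = add_hom_closed[OF ract_tensor_hom]

lemma lact_pure_tensor:
  "ws \<in> words M n \<Longrightarrow> a \<triangleright>\<^bsub>tensor_power S M n\<^esub> pure_tensor S M ws = pure_tensor S M ((a \<triangleright> hd ws) # tl ws)"
  unfolding lact_tensor_power
  by (rule tensor_lift_pure[OF abelian_group_tensor_group multiadditive_lact_pure])

lemma ract_pure_tensor:
  "ws \<in> words M n \<Longrightarrow> pure_tensor S M ws \<triangleleft>\<^bsub>tensor_power S M n\<^esub> a = pure_tensor S M (butlast ws @ [last ws \<triangleleft> a])"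
  unfolding ract_tensor_power
  by (rule tensor_lift_pure[OF abelian_group_tensor_group multiadditive_ract_pure])

text \<open>The action on \<open>X\<close> is itself a \<open>tensor_lift\<close> with values in the
  tensor group. The additive map \<open>tensor_lift N \<phi>\<close> passes through it and is then
  evaluated on pure tensors.\<close>

lemma tensor_lift_lact:
  assumes "abelian_group N" "multiadditive S M N n \<phi>" "X \<in> carrier (tensor_group S M n)"
  shows "tensor_lift N \<phi> (a \<triangleright>\<^bsub>tensor_power S M n\<^esub> X) = tensor_lift N (\<lambda>ws. \<phi> ((a \<triangleright> hd ws) # tl ws)) X"
proof -
  have "tensor_lift N \<phi> (a \<triangleright>\<^bsub>tensor_power S M n\<^esub> X)
      = tensor_lift N (\<lambda>ws. tensor_lift N \<phi> (pure_tensor S M ((a \<triangleright> hd ws) # tl ws))) X"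
    unfolding lact_tensor_power
    by (rule tensor_lift_hom[OF abelian_group_tensor_group assms(1,3) _ tensor_lift_additive[OF assms(1,2)]])
      (simp add: pure_tensor_closed lact_word)
  also have "\<dots> = tensor_lift N (\<lambda>ws. \<phi> ((a \<triangleright> hd ws) # tl ws)) X"
    by (rule tensor_lift_cong[OF assms(1,3)])
      (auto simp: tensor_lift_pure[OF assms(1,2)] lact_word intro: multiadditive_closed[OF assms(2)])
  finally show ?thesis .
qed

lemma tensor_lift_ract:
  assumes "abelian_group N" "multiadditive S M N n \<phi>" "X \<in> carrier (tensor_group S M n)"
  shows "tensor_lift N \<phi> (X \<triangleleft>\<^bsub>tensor_power S M n\<^esub> a) = tensor_lift N (\<lambda>ws. \<phi> (butlast ws @ [last ws \<triangleleft> a])) X"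
proof -
  have "tensor_lift N \<phi> (X \<triangleleft>\<^bsub>tensor_power S M n\<^esub> a)
      = tensor_lift N (\<lambda>ws. tensor_lift N \<phi> (pure_tensor S M (butlast ws @ [last ws \<triangleleft> a]))) X"
    unfolding ract_tensor_power
    by (rule tensor_lift_hom[OF abelian_group_tensor_group assms(1,3) _ tensor_lift_additive[OF assms(1,2)]])
      (simp add: pure_tensor_closed ract_word)
  also have "\<dots> = tensor_lift N (\<lambda>ws. \<phi> (butlast ws @ [last ws \<triangleleft> a])) X"
    by (rule tensor_lift_cong[OF assms(1,3)])
      (auto simp: tensor_lift_pure[OF assms(1,2)] ract_word intro: multiadditive_closed[OF assms(2)])
  finally show ?thesis .
qed

end

lemma lact_ract_tensor:
  assumes "a \<in> L" "b \<in> L" "0 < n" "X \<in> carrier (tensor_group S M n)"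
  shows "(a \<triangleright>\<^bsub>tensor_power S M n\<^esub> X) \<triangleleft>\<^bsub>tensor_power S M n\<^esub> b = a \<triangleright>\<^bsub>tensor_power S M n\<^esub> (X \<triangleleft>\<^bsub>tensor_power S M n\<^esub> b)"
proof (rule tensor_hom_eqI[OF abelian_group_tensor_group _ _ _ assms(4)])
  show "(\<lambda>X. (a \<triangleright>\<^bsub>tensor_power S M n\<^esub> X) \<triangleleft>\<^bsub>tensor_power S M n\<^esub> b)
      \<in> hom (add_monoid (tensor_group S M n)) (add_monoid (tensor_group S M n))"
    using lact_tensor_hom[OF assms(1,3)] ract_tensor_hom[OF assms(2,3)] by (rule add_hom_compose)
  show "(\<lambda>X. a \<triangleright>\<^bsub>tensor_power S M n\<^esub> (X \<triangleleft>\<^bsub>tensor_power S M n\<^esub> b))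
      \<in> hom (add_monoid (tensor_group S M n)) (add_monoid (tensor_group S M n))"
    using ract_tensor_hom[OF assms(2,3)] lact_tensor_hom[OF assms(1,3)] by (rule add_hom_compose)
next
  fix ws assume w: "ws \<in> words M n"
  \<comment> \<open>In a one-letter word both actions hit the same letter, which is the case that
    needs \<open>outer_lact_ract\<close>; in longer words they hit different letters.\<close>
  have "butlast ((a \<triangleright> hd ws) # tl ws) @ [last ((a \<triangleright> hd ws) # tl ws) \<triangleleft> b]
      = (a \<triangleright> hd (butlast ws @ [last ws \<triangleleft> b])) # tl (butlast ws @ [last ws \<triangleleft> b])"
    using w assms(1-3) outer_lact_ract by (cases ws; cases "tl ws") (auto simp: words_def)
  then show "(a \<triangleright>\<^bsub>tensor_power S M n\<^esub> pure_tensor S M ws) \<triangleleft>\<^bsub>tensor_power S M n\<^esub> b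
      = a \<triangleright>\<^bsub>tensor_power S M n\<^esub> (pure_tensor S M ws \<triangleleft>\<^bsub>tensor_power S M n\<^esub> b)"
    using w assms(1-3)
    by (simp add: lact_pure_tensor ract_pure_tensor lact_word ract_word del: butlast.simps)
qed

end

section \<open>Extensions with centralizer inside the subring\<close>

lemma carrier_regular [simp]: "carrier (regular A) = carrier A"
  and add_regular [simp]: "add (regular A) = add A"
  and zero_regular [simp]: "\<zero>\<^bsub>regular A\<^esub> = \<zero>\<^bsub>A\<^esub>"
  and lact_regular [simp]: "a \<triangleright>\<^bsub>regular A\<^esub> x = a \<otimes>\<^bsub>A\<^esub> x"
  and ract_regular [simp]: "x \<triangleleft>\<^bsub>regular A\<^esub> a = x \<otimes>\<^bsub>A\<^esub> a"
  by (simp_all add: regular_def)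

lemma carrier_invariants: "carrier (invariants B M) = {x \<in> carrier M. \<forall>b\<in>B. b \<triangleright>\<^bsub>M\<^esub> x = x \<triangleleft>\<^bsub>M\<^esub> b}"
  and add_invariants [simp]: "add (invariants B M) = add M"
  and zero_invariants [simp]: "\<zero>\<^bsub>invariants B M\<^esub> = \<zero>\<^bsub>M\<^esub>"
  and lact_invariants [simp]: "lact (invariants B M) = lact M"
  and ract_invariants [simp]: "ract (invariants B M) = ract M"
  by (simp_all add: invariants_def)

locale irreducible_ring_extension = A?: ring A
    for A :: "('k, 'a) module" (structure) and B :: "'a set" +
  assumes subring: "subring B A"
    and centralizer_subset: "centralizer A B \<subseteq> B"
begin

abbreviation R where "R \<equiv> centralizer A B"
abbreviation T where "T \<equiv> dt_bimodule A B"
abbreviation tens where "tens \<equiv> pure_tensor B (regular A)"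
abbreviation AA where "AA \<equiv> tensor_power B (regular A) 2"

lemma B_closed [simp]: "b \<in> B \<Longrightarrow> b \<in> carrier A"
  using subringE(1)[OF subring] by blast

lemma R_B [simp]: "r \<in> R \<Longrightarrow> r \<in> B"
  using centralizer_subset by blast

lemma R_iff: "r \<in> R \<longleftrightarrow> r \<in> carrier A \<and> (\<forall>b\<in>B. b \<otimes> r = r \<otimes> b)"
  unfolding centralizer_def carrier_invariants by simp

lemma R_commutes: "r \<in> R \<Longrightarrow> b \<in> B \<Longrightarrow> b \<otimes> r = r \<otimes> b"
  using R_iff by blast

section \<open>The bimodules A and T\<close>

lemma regular_abelian_group: "abelian_group (regular A)"
proof (rule abelian_groupI)
  fix x assume "x \<in> carrier (regular A)"
  then show "\<exists>y\<in>carrier (regular A). y \<oplus>\<^bsub>regular A\<^esub> x = \<zero>\<^bsub>regular A\<^esub>"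
    by (intro bexI[of _ "\<ominus> x"]) (simp_all add: l_neg)
qed (simp_all add: a_ac)

text \<open>The rewrites replace the fields of the record \<open>regular A\<close> by those of
  \<open>A\<close>, so that the facts on tensor powers apply to ring elements directly.\<close>

sublocale reg: balanced_bimodule B "regular A" "carrier A"
  rewrites "carrier (regular A) = carrier A" and "add (regular A) = add A"
    and "ring.zero (regular A) = ring.zero A" and "lact (regular A) = monoid.mult A"
    and "ract (regular A) = monoid.mult A"
  by (auto simp: balanced_bimodule_def balanced_module_def balanced_module_axioms_def
      balanced_bimodule_axioms_def regular_abelian_group l_distr r_distr m_assoc) (simp_all add: regular_def)

lemma carrier_T: "u \<in> carrier T \<longleftrightarrow> u \<in> carrier (tensor_group B (regular A) 2) \<and>
    (\<forall>b\<in>B. b \<triangleright>\<^bsub>AA\<^esub> u = u \<triangleleft>\<^bsub>AA\<^esub> b)"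
  by (simp add: dt_bimodule_def carrier_invariants)

lemma T_simps [simp]: "add T = add (tensor_group B (regular A) 2)"
  "\<zero>\<^bsub>T\<^esub> = \<zero>\<^bsub>tensor_group B (regular A) 2\<^esub>" "lact T = lact AA" "ract T = ract AA"
  by (simp_all add: dt_bimodule_def)

lemma T_closed [simp]: "u \<in> carrier T \<Longrightarrow> u \<in> carrier (tensor_group B (regular A) 2)"
  by (simp add: carrier_T)

lemma lact_assoc_AA:
  assumes "a \<in> carrier A" "b \<in> carrier A" "X \<in> carrier (tensor_group B (regular A) 2)"
  shows "(a \<otimes> b) \<triangleright>\<^bsub>AA\<^esub> X = a \<triangleright>\<^bsub>AA\<^esub> (b \<triangleright>\<^bsub>AA\<^esub> X)"
proof (rule reg.tensor_hom_eqI[OF reg.abelian_group_tensor_group _ _ _ assms(3)])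
  show "(\<lambda>X. (a \<otimes> b) \<triangleright>\<^bsub>AA\<^esub> X)
      \<in> hom (add_monoid (tensor_group B (regular A) 2)) (add_monoid (tensor_group B (regular A) 2))"
    by (rule reg.lact_tensor_hom) (use assms in auto)
  show "(\<lambda>X. a \<triangleright>\<^bsub>AA\<^esub> (b \<triangleright>\<^bsub>AA\<^esub> X))
      \<in> hom (add_monoid (tensor_group B (regular A) 2)) (add_monoid (tensor_group B (regular A) 2))"
    by (rule add_hom_compose; rule reg.lact_tensor_hom) (use assms in auto)
next
  fix ws assume w: "ws \<in> words (regular A) 2"
  then have "hd ws \<in> carrier A"
    by (cases ws) (auto simp: words_Cons)
  then show "(a \<otimes> b) \<triangleright>\<^bsub>AA\<^esub> tens ws = a \<triangleright>\<^bsub>AA\<^esub> (b \<triangleright>\<^bsub>AA\<^esub> tens ws)"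
    using w assms reg.lact_word[of b 2 ws]
    by (simp add: reg.lact_pure_tensor m_assoc)
qed

lemma ract_assoc_AA:
  assumes "a \<in> carrier A" "b \<in> carrier A" "X \<in> carrier (tensor_group B (regular A) 2)"
  shows "X \<triangleleft>\<^bsub>AA\<^esub> (a \<otimes> b) = (X \<triangleleft>\<^bsub>AA\<^esub> a) \<triangleleft>\<^bsub>AA\<^esub> b"
proof (rule reg.tensor_hom_eqI[OF reg.abelian_group_tensor_group _ _ _ assms(3)])
  show "(\<lambda>X. X \<triangleleft>\<^bsub>AA\<^esub> (a \<otimes> b))
      \<in> hom (add_monoid (tensor_group B (regular A) 2)) (add_monoid (tensor_group B (regular A) 2))"
    by (rule reg.ract_tensor_hom) (use assms in auto)
  show "(\<lambda>X. (X \<triangleleft>\<^bsub>AA\<^esub> a) \<triangleleft>\<^bsub>AA\<^esub> b)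
      \<in> hom (add_monoid (tensor_group B (regular A) 2)) (add_monoid (tensor_group B (regular A) 2))"
    by (rule add_hom_compose; rule reg.ract_tensor_hom) (use assms in auto)
next
  fix ws assume w: "ws \<in> words (regular A) 2"
  then have "last ws \<in> carrier A"
    by (cases ws rule: rev_cases) (auto simp: words_def)
  then show "tens ws \<triangleleft>\<^bsub>AA\<^esub> (a \<otimes> b) = (tens ws \<triangleleft>\<^bsub>AA\<^esub> a) \<triangleleft>\<^bsub>AA\<^esub> b"
    using w assms reg.ract_word[of a 2 ws]
    by (simp add: reg.ract_pure_tensor m_assoc)
qed

text \<open>Elements of \<open>R\<close> commute with \<open>B\<close>, so
  \<open>b (r u) = r (b u) = r (u b)\<close>: the outer actions restrict to actions of
  \<open>R\<close> on \<open>T\<close>.\<close>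

lemma lact_T_closed:
  assumes "r \<in> R" "u \<in> carrier T"
  shows "r \<triangleright>\<^bsub>AA\<^esub> u \<in> carrier T"
  unfolding carrier_T
proof (intro conjI ballI)
  show "r \<triangleright>\<^bsub>AA\<^esub> u \<in> carrier (tensor_group B (regular A) 2)"
    using assms by (auto intro: reg.lact_tensor_closed)
  fix b assume b: "b \<in> B"
  have "b \<triangleright>\<^bsub>AA\<^esub> (r \<triangleright>\<^bsub>AA\<^esub> u) = (b \<otimes> r) \<triangleright>\<^bsub>AA\<^esub> u"
    using assms b by (simp add: lact_assoc_AA)
  also have "b \<otimes> r = r \<otimes> b"
    using R_commutes[OF assms(1) b] by simp
  also have "(r \<otimes> b) \<triangleright>\<^bsub>AA\<^esub> u = r \<triangleright>\<^bsub>AA\<^esub> (u \<triangleleft>\<^bsub>AA\<^esub> b)"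
    using assms b by (simp add: lact_assoc_AA carrier_T)
  finally show "b \<triangleright>\<^bsub>AA\<^esub> (r \<triangleright>\<^bsub>AA\<^esub> u) = (r \<triangleright>\<^bsub>AA\<^esub> u) \<triangleleft>\<^bsub>AA\<^esub> b"
    using assms b by (simp add: reg.lact_ract_tensor)
qed

lemma ract_T_closed:
  assumes "r \<in> R" "u \<in> carrier T"
  shows "u \<triangleleft>\<^bsub>AA\<^esub> r \<in> carrier T"
  unfolding carrier_T
proof (intro conjI ballI)
  show "u \<triangleleft>\<^bsub>AA\<^esub> r \<in> carrier (tensor_group B (regular A) 2)"
    using assms by (auto intro: reg.ract_tensor_closed)
  fix b assume b: "b \<in> B"
  have "(u \<triangleleft>\<^bsub>AA\<^esub> r) \<triangleleft>\<^bsub>AA\<^esub> b = u \<triangleleft>\<^bsub>AA\<^esub> (r \<otimes> b)"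
    using assms b by (simp add: ract_assoc_AA)
  also have "r \<otimes> b = b \<otimes> r"
    using R_commutes[OF assms(1) b] by (rule sym)
  also have "u \<triangleleft>\<^bsub>AA\<^esub> (b \<otimes> r) = (b \<triangleright>\<^bsub>AA\<^esub> u) \<triangleleft>\<^bsub>AA\<^esub> r"
    using assms b by (simp add: ract_assoc_AA carrier_T)
  finally show "b \<triangleright>\<^bsub>AA\<^esub> (u \<triangleleft>\<^bsub>AA\<^esub> r) = (u \<triangleleft>\<^bsub>AA\<^esub> r) \<triangleleft>\<^bsub>AA\<^esub> b"
    using assms b by (simp add: reg.lact_ract_tensor)
qed

lemma abelian_group_T: "abelian_group T"
proof -
  interpret tg: abelian_group "tensor_group B (regular A) 2"
    by (rule reg.abelian_group_tensor_group)
  note tg = reg.abelian_group_tensor_group[of 2]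
  have hom: "(\<lambda>X. b \<triangleright>\<^bsub>AA\<^esub> X) \<in> hom (add_monoid (tensor_group B (regular A) 2)) (add_monoid (tensor_group B (regular A) 2))"
    "(\<lambda>X. X \<triangleleft>\<^bsub>AA\<^esub> b) \<in> hom (add_monoid (tensor_group B (regular A) 2)) (add_monoid (tensor_group B (regular A) 2))"
    if "b \<in> B" for b
    using reg.lact_tensor_hom[of b 2] reg.ract_tensor_hom[of b 2] that by simp_all
  note s = add_hom_add[OF hom(1)] add_hom_add[OF hom(2)] add_hom_zero[OF tg tg hom(1)] add_hom_zero[OF tg tg hom(2)]
    add_hom_a_inv[OF tg tg hom(1)] add_hom_a_inv[OF tg tg hom(2)]
  show ?thesis
  proof (rule abelian_groupI)
    fix x assume x: "x \<in> carrier T"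
    then have "\<ominus>\<^bsub>tensor_group B (regular A) 2\<^esub> x \<in> carrier T"
      by (simp add: carrier_T s)
    then show "\<exists>y\<in>carrier T. y \<oplus>\<^bsub>T\<^esub> x = \<zero>\<^bsub>T\<^esub>"
      using x by (intro bexI) (auto simp: tg.l_neg)
  qed (auto simp: carrier_T tg.a_ac s)
qed

sublocale T: balanced_bimodule R T R
proof -
  have hom: "r \<triangleright>\<^bsub>AA\<^esub> (x \<oplus>\<^bsub>tensor_group B (regular A) 2\<^esub> y) = (r \<triangleright>\<^bsub>AA\<^esub> x) \<oplus>\<^bsub>tensor_group B (regular A) 2\<^esub> (r \<triangleright>\<^bsub>AA\<^esub> y)"
    "(x \<oplus>\<^bsub>tensor_group B (regular A) 2\<^esub> y) \<triangleleft>\<^bsub>AA\<^esub> r = (x \<triangleleft>\<^bsub>AA\<^esub> r) \<oplus>\<^bsub>tensor_group B (regular A) 2\<^esub> (y \<triangleleft>\<^bsub>AA\<^esub> r)"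
    if "r \<in> R" "x \<in> carrier T" "y \<in> carrier T" for r x y
    using add_hom_add[OF reg.lact_tensor_hom[of r 2], of x y] that
      add_hom_add[OF reg.ract_tensor_hom[of r 2], of x y] by simp_all
  show "balanced_bimodule R T R"
    by (auto simp: balanced_bimodule_def balanced_module_def balanced_module_axioms_def hom
        balanced_bimodule_axioms_def abelian_group_T lact_T_closed ract_T_closed reg.lact_ract_tensor)
qed

lemma words_2E:
  assumes "ws \<in> words M 2"
  obtains x y where "ws = [x, y]" "x \<in> carrier M" "y \<in> carrier M"
  using assms by (auto simp: numeral_2_eq_2 elim!: words_SucE)

section \<open>The counit of T\<close>

lemma multiadditive_counit: "multiadditive B (regular A) A 2 (\<lambda>xs. xs ! 0 \<otimes> xs ! 1)"
  by (auto simp: numeral_2_eq_2 multiadditive_Suc l_distr r_distr m_assoc elim!: words_SucE)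

lemma counit_hom: "counit A \<in> hom (add_monoid (tensor_group B (regular A) 2)) (add_monoid A)"
  unfolding counit_def by (rule reg.tensor_lift_additive[OF is_abelian_group multiadditive_counit])

text \<open>Multiplication is a bimodule map, so \<open>b u = u b\<close> is carried to
  \<open>b \<epsilon>(u) = \<epsilon>(u) b\<close>. Together with \<open>R \<subseteq> B\<close>
  this makes counits available as scalars for Hochschild cochains.\<close>

lemma counit_closed:
  assumes "u \<in> carrier T"
  shows "counit A u \<in> R"
proof -
  note lift = reg.tensor_lift_hom[OF is_abelian_group is_abelian_group T_closed[OF assms]]
  have cl: "xs ! 0 \<otimes> xs ! 1 \<in> carrier A" if "xs \<in> words (regular A) 2" for xs
    using that by (auto elim!: words_2E)
  have "b \<otimes> counit A u = counit A u \<otimes> b" if b: "b \<in> B" for b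
  proof -
    have "b \<otimes> counit A u = tensor_lift A (\<lambda>xs. b \<otimes> (xs ! 0 \<otimes> xs ! 1)) u"
      unfolding counit_def
      by (rule lift[OF cl]) (use b in \<open>auto intro!: add_homI simp: r_distr\<close>)
    also have "\<dots> = tensor_lift A (\<lambda>ws. ((b \<otimes> hd ws) # tl ws) ! 0 \<otimes> ((b \<otimes> hd ws) # tl ws) ! 1) u"
      by (rule reg.tensor_lift_cong[OF is_abelian_group T_closed[OF assms]])
        (use b in \<open>auto elim!: words_2E simp: m_assoc\<close>)
    also have "\<dots> = counit A (b \<triangleright>\<^bsub>AA\<^esub> u)"
      unfolding counit_def
      by (rule reg.tensor_lift_lact[OF _ _ is_abelian_group multiadditive_counit, symmetric])
        (use assms b in auto)
    also have "b \<triangleright>\<^bsub>AA\<^esub> u = u \<triangleleft>\<^bsub>AA\<^esub> b"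
      using assms b by (simp add: carrier_T)
    also have "counit A \<dots> = tensor_lift A (\<lambda>ws. (butlast ws @ [last ws \<otimes> b]) ! 0 \<otimes> (butlast ws @ [last ws \<otimes> b]) ! 1) u"
      unfolding counit_def
      by (rule reg.tensor_lift_ract[OF _ _ is_abelian_group multiadditive_counit])
        (use assms b in auto)
    also have "\<dots> = tensor_lift A (\<lambda>xs. (xs ! 0 \<otimes> xs ! 1) \<otimes> b) u"
      by (rule reg.tensor_lift_cong[OF is_abelian_group T_closed[OF assms]])
        (use b in \<open>auto elim!: words_2E simp: m_assoc\<close>)
    also have "\<dots> = counit A u \<otimes> b"
      unfolding counit_def
      by (rule lift[OF cl, symmetric]) (use b in \<open>auto intro!: add_homI simp: l_distr\<close>)
    finally show ?thesis .
  qed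
  then show ?thesis
    using add_hom_closed[OF counit_hom T_closed[OF assms]] R_iff by blast
qed

end

section \<open>Sums over Sweedler representatives\<close>

definition pair_words :: "('k, 'a) module \<Rightarrow> nat \<Rightarrow> ('a \<times> 'a) list set" where
  "pair_words A n = {ps. length ps = n \<and> set ps \<subseteq> carrier A \<times> carrier A}"

lemma pair_words_0 [simp]: "ps \<in> pair_words A 0 \<longleftrightarrow> ps = []"
  by (auto simp: pair_words_def)

lemma pair_words_Cons_Suc [simp]:
  "(x, y) # ps \<in> pair_words A (Suc n) \<longleftrightarrow> x \<in> carrier A \<and> y \<in> carrier A \<and> ps \<in> pair_words A n"
  by (auto simp: pair_words_def)

lemma pair_words_SucE:
  assumes "ps \<in> pair_words A (Suc n)"
  obtains x y qs where "ps = (x, y) # qs" "x \<in> carrier A" "y \<in> carrier A" "qs \<in> pair_words A n"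
  using assms by (cases ps) (auto simp: pair_words_def)

text \<open>A list of pairs stands for \<open>[(u\<^sub>1\<^sup>1, u\<^sub>1\<^sup>2), \<dots>, (u\<^sub>n\<^sup>1, u\<^sub>n\<^sup>2)]\<close>. Balancedness over \<open>B\<close> within a pair makes
  \<open>sweedler\<close> independent of representatives; between adjacent pairs it gives, as \<open>R \<subseteq> B\<close>, balancedness
  over \<open>R\<close> in \<open>T \<otimes>\<^sub>R \<cdots> \<otimes>\<^sub>R T\<close>.\<close>

primrec pair_balanced ::
    "('k, 'a) module \<Rightarrow> 'a set \<Rightarrow> ('n, 'z) ring_scheme \<Rightarrow> nat \<Rightarrow> (('a \<times> 'a) list \<Rightarrow> 'n) \<Rightarrow> bool" where
  "pair_balanced A B N 0 \<psi> \<longleftrightarrow> \<psi> [] \<in> carrier N"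
| "pair_balanced A B N (Suc n) \<psi> \<longleftrightarrow>
     (\<forall>x\<in>carrier A. \<forall>y\<in>carrier A. pair_balanced A B N n (\<lambda>ps. \<psi> ((x, y) # ps))) \<and>
     (\<forall>x\<in>carrier A. \<forall>x'\<in>carrier A. \<forall>y\<in>carrier A. \<forall>ps\<in>pair_words A n.
        \<psi> ((x \<oplus>\<^bsub>A\<^esub> x', y) # ps) = \<psi> ((x, y) # ps) \<oplus>\<^bsub>N\<^esub> \<psi> ((x', y) # ps) \<and>
        \<psi> ((y, x \<oplus>\<^bsub>A\<^esub> x') # ps) = \<psi> ((y, x) # ps) \<oplus>\<^bsub>N\<^esub> \<psi> ((y, x') # ps)) \<and>
     (\<forall>x\<in>carrier A. \<forall>b\<in>B. \<forall>y\<in>carrier A. \<forall>ps\<in>pair_words A n.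
        \<psi> ((x \<otimes>\<^bsub>A\<^esub> b, y) # ps) = \<psi> ((x, b \<otimes>\<^bsub>A\<^esub> y) # ps)) \<and>
     (\<forall>x\<in>carrier A. \<forall>y\<in>carrier A. \<forall>b\<in>B. \<forall>x' y' ps. (x', y') # ps \<in> pair_words A n \<longrightarrow>
        \<psi> ((x, y \<otimes>\<^bsub>A\<^esub> b) # (x', y') # ps) = \<psi> ((x, y) # (b \<otimes>\<^bsub>A\<^esub> x', y') # ps))"

lemma pair_balanced_closed:
  "pair_balanced A B N n \<psi> \<Longrightarrow> ps \<in> pair_words A n \<Longrightarrow> \<psi> ps \<in> carrier N"
proof (induction n arbitrary: \<psi> ps)
  case (Suc n)
  from Suc.prems(2) obtain x y qs where
    "ps = (x, y) # qs" "x \<in> carrier A" "y \<in> carrier A" "qs \<in> pair_words A n"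
    by (rule pair_words_SucE)
  then show ?case
    using Suc.IH[of "\<lambda>ps. \<psi> ((x, y) # ps)" qs] Suc.prems(1) by simp
qed simp

definition lact_pairs :: "('k, 'a) module \<Rightarrow> 'a \<Rightarrow> ('a \<times> 'a) list \<Rightarrow> ('a \<times> 'a) list" where
  "lact_pairs A a ps = (a \<otimes>\<^bsub>A\<^esub> fst (hd ps), snd (hd ps)) # tl ps"

definition ract_pairs :: "('k, 'a) module \<Rightarrow> ('a \<times> 'a) list \<Rightarrow> 'a \<Rightarrow> ('a \<times> 'a) list" where
  "ract_pairs A ps a = butlast ps @ [(fst (last ps), snd (last ps) \<otimes>\<^bsub>A\<^esub> a)]"

text \<open>Replaces \<open>u\<^bsub>j+1\<^esub>, u\<^bsub>j+2\<^esub>\<close> by \<open>u\<^bsub>j+1\<^esub> \<epsilon>(u\<^bsub>j+2\<^esub>)\<close>.\<close>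

primrec merge_pairs :: "('k, 'a) module \<Rightarrow> nat \<Rightarrow> ('a \<times> 'a) list \<Rightarrow> ('a \<times> 'a) list" where
  "merge_pairs A 0 ps =
     (fst (hd ps), snd (hd ps) \<otimes>\<^bsub>A\<^esub> (fst (hd (tl ps)) \<otimes>\<^bsub>A\<^esub> snd (hd (tl ps)))) # tl (tl ps)"
| "merge_pairs A (Suc j) ps = hd ps # merge_pairs A j (tl ps)"

lemma lact_pairs_Cons [simp]: "lact_pairs A a ((x, y) # ps) = (a \<otimes>\<^bsub>A\<^esub> x, y) # ps"
  by (simp add: lact_pairs_def)

context irreducible_ring_extension
begin

lemma lact_pairs_closed [simp]:
  "a \<in> carrier A \<Longrightarrow> ps \<in> pair_words A (Suc n) \<Longrightarrow> lact_pairs A a ps \<in> pair_words A (Suc n)"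
  by (auto elim!: pair_words_SucE)

lemma ract_pairs_closed [simp]:
  "a \<in> carrier A \<Longrightarrow> ps \<in> pair_words A (Suc n) \<Longrightarrow> ract_pairs A ps a \<in> pair_words A (Suc n)"
  by (cases ps rule: rev_cases) (auto simp: pair_words_def ract_pairs_def)

lemma merge_pairs_closed [simp]:
  "j \<le> n \<Longrightarrow> ps \<in> pair_words A (Suc (Suc n)) \<Longrightarrow> merge_pairs A j ps \<in> pair_words A (Suc n)"
proof (induction j arbitrary: n ps)
  case (Suc j)
  from Suc.prems obtain m where "n = Suc m" "j \<le> m"
    by (cases n) auto
  with Suc show ?case
    by (auto elim!: pair_words_SucE[of ps])
qed (auto elim!: pair_words_SucE)

context
  fixes N :: "('n, 'z) ring_scheme"
  assumes N: "abelian_group N"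
begin

interpretation N: abelian_group N
  by (rule N)

section \<open>Linearity of Sweedler sums in their formula\<close>

lemma sweedler_closed:
  assumes "ts \<in> words T n" "\<And>ps. ps \<in> pair_words A n \<Longrightarrow> \<psi> ps \<in> carrier N"
  shows "sweedler N \<psi> ts \<in> carrier N"
  using assms
proof (induction n arbitrary: ts \<psi>)
  case (Suc n)
  from Suc.prems(1) obtain u us where t: "ts = u # us" "u \<in> carrier T" "us \<in> words T n"
    by (rule words_SucE)
  show ?case
    unfolding t(1) sweedler.simps
    by (rule reg.tensor_lift_closed[OF N T_closed[OF t(2)]])
      (use Suc t in \<open>auto elim!: words_2E\<close>)
qed simp

lemma sweedler_cong:
  assumes "ts \<in> words T n" "\<And>ps. ps \<in> pair_words A n \<Longrightarrow> \<psi> ps \<in> carrier N"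
    and "\<And>ps. ps \<in> pair_words A n \<Longrightarrow> \<psi> ps = \<psi>' ps"
  shows "sweedler N \<psi> ts = sweedler N \<psi>' ts"
  using assms
proof (induction n arbitrary: ts \<psi> \<psi>')
  case (Suc n)
  from Suc.prems(1) obtain u us where t: "ts = u # us" "u \<in> carrier T" "us \<in> words T n"
    by (rule words_SucE)
  show ?case
    unfolding t(1) sweedler.simps
  proof (rule reg.tensor_lift_cong[OF N T_closed[OF t(2)]])
    fix ws assume ws: "ws \<in> words (regular A) 2"
    show "sweedler N (\<lambda>ps. \<psi> ((ws ! 0, ws ! 1) # ps)) us \<in> carrier N"
      using t(3) by (rule sweedler_closed) (use ws Suc.prems(2) in \<open>auto elim!: words_2E\<close>)
    show "sweedler N (\<lambda>ps. \<psi> ((ws ! 0, ws ! 1) # ps)) us = sweedler N (\<lambda>ps. \<psi>' ((ws ! 0, ws ! 1) # ps)) us"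
      by (rule Suc.IH) (use t ws Suc.prems(2,3) in \<open>auto elim!: words_2E\<close>)
  qed
qed simp

lemma sweedler_add:
  assumes "ts \<in> words T n" "\<And>ps. ps \<in> pair_words A n \<Longrightarrow> \<psi> ps \<in> carrier N"
    and "\<And>ps. ps \<in> pair_words A n \<Longrightarrow> \<psi>' ps \<in> carrier N"
  shows "sweedler N (\<lambda>ps. \<psi> ps \<oplus>\<^bsub>N\<^esub> \<psi>' ps) ts = sweedler N \<psi> ts \<oplus>\<^bsub>N\<^esub> sweedler N \<psi>' ts"
  using assms
proof (induction n arbitrary: ts \<psi> \<psi>')
  case (Suc n)
  from Suc.prems(1) obtain u us where t: "ts = u # us" "u \<in> carrier T" "us \<in> words T n"
    by (rule words_SucE)
  have cl: "sweedler N (\<lambda>ps. \<psi> ((ws ! 0, ws ! 1) # ps)) us \<in> carrier N"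
    "sweedler N (\<lambda>ps. \<psi>' ((ws ! 0, ws ! 1) # ps)) us \<in> carrier N"
    if "ws \<in> words (regular A) 2" for ws
    by (rule sweedler_closed[OF t(3)], use that Suc.prems(2,3) in \<open>auto elim!: words_2E\<close>)+
  have "sweedler N (\<lambda>ps. \<psi> ps \<oplus>\<^bsub>N\<^esub> \<psi>' ps) ts = tensor_lift N (\<lambda>ws.
      sweedler N (\<lambda>ps. \<psi> ((ws ! 0, ws ! 1) # ps)) us \<oplus>\<^bsub>N\<^esub> sweedler N (\<lambda>ps. \<psi>' ((ws ! 0, ws ! 1) # ps)) us) u"
    unfolding t(1) sweedler.simps
  proof (rule reg.tensor_lift_cong[OF N T_closed[OF t(2)], symmetric])
    fix ws assume ws: "ws \<in> words (regular A) 2"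
    then show "sweedler N (\<lambda>ps. \<psi> ((ws ! 0, ws ! 1) # ps)) us \<oplus>\<^bsub>N\<^esub> sweedler N (\<lambda>ps. \<psi>' ((ws ! 0, ws ! 1) # ps)) us \<in> carrier N"
      using cl by blast
    show "sweedler N (\<lambda>ps. \<psi> ((ws ! 0, ws ! 1) # ps)) us \<oplus>\<^bsub>N\<^esub> sweedler N (\<lambda>ps. \<psi>' ((ws ! 0, ws ! 1) # ps)) us
      = sweedler N (\<lambda>ps. \<psi> ((ws ! 0, ws ! 1) # ps) \<oplus>\<^bsub>N\<^esub> \<psi>' ((ws ! 0, ws ! 1) # ps)) us"
      by (rule Suc.IH[symmetric]) (use t ws Suc.prems(2,3) in \<open>auto elim!: words_2E\<close>)
  qed
  also have "\<dots> = sweedler N \<psi> ts \<oplus>\<^bsub>N\<^esub> sweedler N \<psi>' ts"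
    unfolding t(1) sweedler.simps by (rule reg.tensor_lift_add[OF N T_closed[OF t(2)] cl])
  finally show ?case .
qed simp

lemma sweedler_hom:
  assumes N': "abelian_group N'" and f: "f \<in> hom (add_monoid N) (add_monoid N')"
    and "ts \<in> words T n" "\<And>ps. ps \<in> pair_words A n \<Longrightarrow> \<psi> ps \<in> carrier N"
  shows "f (sweedler N \<psi> ts) = sweedler N' (\<lambda>ps. f (\<psi> ps)) ts"
  using assms(3,4)
proof (induction n arbitrary: ts \<psi>)
  case (Suc n)
  from Suc.prems(1) obtain u us where t: "ts = u # us" "u \<in> carrier T" "us \<in> words T n"
    by (rule words_SucE)
  have cl: "sweedler N (\<lambda>ps. \<psi> ((ws ! 0, ws ! 1) # ps)) us \<in> carrier N"
    if "ws \<in> words (regular A) 2" for ws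
    by (rule sweedler_closed[OF t(3)], use that Suc.prems(2) in \<open>auto elim!: words_2E\<close>)+
  have "f (sweedler N \<psi> ts) = tensor_lift N' (\<lambda>ws. f (sweedler N (\<lambda>ps. \<psi> ((ws ! 0, ws ! 1) # ps)) us)) u"
    unfolding t(1) sweedler.simps by (rule reg.tensor_lift_hom[OF N N' T_closed[OF t(2)] cl f])
  also have "\<dots> = sweedler N' (\<lambda>ps. f (\<psi> ps)) ts"
    unfolding t(1) sweedler.simps
  proof (rule reg.tensor_lift_cong[OF N' T_closed[OF t(2)]])
    fix ws assume ws: "ws \<in> words (regular A) 2"
    then show "f (sweedler N (\<lambda>ps. \<psi> ((ws ! 0, ws ! 1) # ps)) us) \<in> carrier N'"
      using cl add_hom_closed[OF f] by blast
    show "f (sweedler N (\<lambda>ps. \<psi> ((ws ! 0, ws ! 1) # ps)) us) = sweedler N' (\<lambda>ps. f (\<psi> ((ws ! 0, ws ! 1) # ps))) us"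
      by (rule Suc.IH) (use t ws Suc.prems(2) in \<open>auto elim!: words_2E\<close>)
  qed
  finally show ?case .
qed simp

lemma sweedler_zero: "ts \<in> words T n \<Longrightarrow> sweedler N (\<lambda>ps. \<zero>\<^bsub>N\<^esub>) ts = \<zero>\<^bsub>N\<^esub>"
  using sweedler_hom[OF N, of "\<lambda>_. \<zero>\<^bsub>N\<^esub>" ts n "\<lambda>_. \<zero>\<^bsub>N\<^esub>"] by (simp add: add_homI)

lemma sweedler_finsum:
  assumes ts: "ts \<in> words T n" and "finite I"
    and "\<And>i ps. i \<in> I \<Longrightarrow> ps \<in> pair_words A n \<Longrightarrow> \<psi> i ps \<in> carrier N"
  shows "sweedler N (\<lambda>ps. \<Oplus>\<^bsub>N\<^esub>i\<in>I. \<psi> i ps) ts = (\<Oplus>\<^bsub>N\<^esub>i\<in>I. sweedler N (\<psi> i) ts)"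
  using assms(2,3)
proof (induction I)
  case empty
  then show ?case
    using sweedler_zero[OF ts] by simp
next
  case (insert i I)
  have c: "\<psi> i ps \<in> carrier N" "(\<lambda>i. \<psi> i ps) \<in> I \<rightarrow> carrier N" "(\<Oplus>\<^bsub>N\<^esub>i\<in>I. \<psi> i ps) \<in> carrier N"
    if "ps \<in> pair_words A n" for ps
    using insert.prems that by (auto intro!: N.finsum_closed)
  have "(\<lambda>i. sweedler N (\<psi> i) ts) \<in> I \<rightarrow> carrier N" "sweedler N (\<psi> i) ts \<in> carrier N"
    using insert.prems sweedler_closed[OF ts] by auto
  moreover have "sweedler N (\<lambda>ps. \<Oplus>\<^bsub>N\<^esub>i\<in>insert i I. \<psi> i ps) ts
      = sweedler N (\<lambda>ps. \<psi> i ps \<oplus>\<^bsub>N\<^esub> (\<Oplus>\<^bsub>N\<^esub>i\<in>I. \<psi> i ps)) ts"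
    by (rule sweedler_cong[OF ts, symmetric]) (use c insert.hyps in auto)
  ultimately show ?case
    using insert by (simp add: sweedler_add[OF ts] c)
qed

section \<open>Dependence of Sweedler sums on the tensors\<close>

text \<open>With the remaining tensors fixed, the sum is a balanced formula in the first pair. Hence
  it may be computed from any representative of the first tensor, and an action on that tensor can
  be moved onto its pair.\<close>

lemma multiadditive_sweedler_head:
  assumes \<psi>: "pair_balanced A B N (Suc n) \<psi>" and ws: "ws \<in> words T n"
  shows "multiadditive B (regular A) N 2 (\<lambda>xs. sweedler N (\<lambda>ps. \<psi> ((xs ! 0, xs ! 1) # ps)) ws)"
proof -
  have cl: "\<psi> ((x, y) # ps) \<in> carrier N" if "x \<in> carrier A" "y \<in> carrier A" "ps \<in> pair_words A n" for x y ps
    using pair_balanced_closed[OF \<psi>] that by simp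
  have scl: "sweedler N (\<lambda>ps. \<psi> ((x, y) # ps)) ws \<in> carrier N" if "x \<in> carrier A" "y \<in> carrier A" for x y
    by (rule sweedler_closed[OF ws]) (use cl that in auto)
  have add1: "sweedler N (\<lambda>ps. \<psi> ((x \<oplus> x', y) # ps)) ws
      = sweedler N (\<lambda>ps. \<psi> ((x, y) # ps)) ws \<oplus>\<^bsub>N\<^esub> sweedler N (\<lambda>ps. \<psi> ((x', y) # ps)) ws"
    if "x \<in> carrier A" "x' \<in> carrier A" "y \<in> carrier A" for x x' y
    by (subst sweedler_add[OF ws, symmetric]; (rule sweedler_cong[OF ws])?) (use that \<psi> cl in auto)
  have add2: "sweedler N (\<lambda>ps. \<psi> ((y, x \<oplus> x') # ps)) ws
      = sweedler N (\<lambda>ps. \<psi> ((y, x) # ps)) ws \<oplus>\<^bsub>N\<^esub> sweedler N (\<lambda>ps. \<psi> ((y, x') # ps)) ws"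
    if "x \<in> carrier A" "x' \<in> carrier A" "y \<in> carrier A" for x x' y
    by (subst sweedler_add[OF ws, symmetric]; (rule sweedler_cong[OF ws])?) (use that \<psi> cl in auto)
  have bal: "sweedler N (\<lambda>ps. \<psi> ((x \<otimes> b, y) # ps)) ws = sweedler N (\<lambda>ps. \<psi> ((x, b \<otimes> y) # ps)) ws"
    if "x \<in> carrier A" "b \<in> B" "y \<in> carrier A" for x b y
    by (rule sweedler_cong[OF ws]) (use that \<psi> cl in auto)
  show ?thesis
    unfolding numeral_2_eq_2
    by (auto simp: multiadditive_Suc scl add1 add2 bal elim!: words_SucE)
qed

text \<open>The tensor \<open>u\<close> is fixed, so all terms are evaluated at one representative
  of it; a relation in \<open>ws\<close> that holds for every pair passes through the sum over
  \<open>u\<close>.\<close>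

lemma multiadditive_tensor_lift:
  assumes u: "u \<in> carrier T" and "\<And>x y. x \<in> carrier A \<Longrightarrow> y \<in> carrier A \<Longrightarrow> multiadditive R T N n (\<phi> x y)"
  shows "multiadditive R T N n (\<lambda>ws. tensor_lift N (\<lambda>xs. \<phi> (xs ! 0) (xs ! 1) ws) u)"
proof -
  have m: "multiadditive R T N n (\<phi> (xs ! 0) (xs ! 1))" if "xs \<in> words (regular A) 2" for xs
    using that assms(2) by (auto elim!: words_2E)
  note cl = multiadditive_closed[OF m]
  note lc = reg.tensor_lift_cong[OF N T_closed[OF u]]
  show ?thesis
    unfolding multiadditive_def
  proof (intro conjI allI impI)
    show "(\<lambda>ws. tensor_lift N (\<lambda>xs. \<phi> (xs ! 0) (xs ! 1) ws) u) \<in> words T n \<rightarrow> carrier N"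
      by (intro funcsetI reg.tensor_lift_closed[OF N T_closed[OF u]] cl)
  next
    fix us x y vs assume w: "us @ x # vs \<in> words T n" "y \<in> carrier T"
    then have w': "us @ y # vs \<in> words T n" "us @ (x \<oplus>\<^bsub>T\<^esub> y) # vs \<in> words T n"
      using T.a_closed by (auto simp: words_def simp del: T_simps)
    have "tensor_lift N (\<lambda>xs. \<phi> (xs ! 0) (xs ! 1) (us @ (x \<oplus>\<^bsub>T\<^esub> y) # vs)) u
        = tensor_lift N (\<lambda>xs. \<phi> (xs ! 0) (xs ! 1) (us @ x # vs) \<oplus>\<^bsub>N\<^esub> \<phi> (xs ! 0) (xs ! 1) (us @ y # vs)) u"
    proof (rule lc)
      fix xs assume xs: "xs \<in> words (regular A) 2"
      show "\<phi> (xs ! 0) (xs ! 1) (us @ (x \<oplus>\<^bsub>T\<^esub> y) # vs) \<in> carrier N"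
        by (rule cl[OF xs w'(2)])
      show "\<phi> (xs ! 0) (xs ! 1) (us @ (x \<oplus>\<^bsub>T\<^esub> y) # vs)
          = \<phi> (xs ! 0) (xs ! 1) (us @ x # vs) \<oplus>\<^bsub>N\<^esub> \<phi> (xs ! 0) (xs ! 1) (us @ y # vs)"
        using m[OF xs] w unfolding multiadditive_def by blast
    qed
    also have "\<dots> = tensor_lift N (\<lambda>xs. \<phi> (xs ! 0) (xs ! 1) (us @ x # vs)) u \<oplus>\<^bsub>N\<^esub>
        tensor_lift N (\<lambda>xs. \<phi> (xs ! 0) (xs ! 1) (us @ y # vs)) u"
      by (rule reg.tensor_lift_add[OF N T_closed[OF u]]) (use cl w w' in auto)
    finally show "tensor_lift N (\<lambda>xs. \<phi> (xs ! 0) (xs ! 1) (us @ (x \<oplus>\<^bsub>T\<^esub> y) # vs)) u = \<dots>" .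
  next
    fix us x s y vs assume w: "us @ x # y # vs \<in> words T n" "s \<in> R"
    then have w': "us @ (x \<triangleleft>\<^bsub>T\<^esub> s) # y # vs \<in> words T n"
      using T.ract_closed by (auto simp: words_def simp del: T_simps)
    show "tensor_lift N (\<lambda>xs. \<phi> (xs ! 0) (xs ! 1) (us @ (x \<triangleleft>\<^bsub>T\<^esub> s) # y # vs)) u
        = tensor_lift N (\<lambda>xs. \<phi> (xs ! 0) (xs ! 1) (us @ x # (s \<triangleright>\<^bsub>T\<^esub> y) # vs)) u"
    proof (rule lc)
      fix xs assume xs: "xs \<in> words (regular A) 2"
      show "\<phi> (xs ! 0) (xs ! 1) (us @ (x \<triangleleft>\<^bsub>T\<^esub> s) # y # vs) \<in> carrier N"
        by (rule cl[OF xs w'])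
      show "\<phi> (xs ! 0) (xs ! 1) (us @ (x \<triangleleft>\<^bsub>T\<^esub> s) # y # vs)
          = \<phi> (xs ! 0) (xs ! 1) (us @ x # (s \<triangleright>\<^bsub>T\<^esub> y) # vs)"
        using m[OF xs] w unfolding multiadditive_def by blast
    qed
  qed
qed

text \<open>For \<open>b\<close> outside \<open>R\<close> the tensor
  \<open>u \<triangleleft> b\<close> need not lie in \<open>T\<close>. This is harmless: as the
  first entry of the list it only has to be a tensor of \<open>A\<close> with \<open>A\<close> over
  \<open>B\<close>.\<close>

lemma sweedler_ract_head:
  assumes \<psi>: "pair_balanced A B N (Suc n) \<psi>" and u: "u \<in> carrier T" and ws: "ws \<in> words T n"
    and b: "b \<in> carrier A"
  shows "sweedler N \<psi> ((u \<triangleleft>\<^bsub>AA\<^esub> b) # ws)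
    = tensor_lift N (\<lambda>xs. sweedler N (\<lambda>ps. \<psi> ((xs ! 0, xs ! 1 \<otimes> b) # ps)) ws) u"
proof -
  have "sweedler N \<psi> ((u \<triangleleft>\<^bsub>AA\<^esub> b) # ws) = tensor_lift N (\<lambda>xs. sweedler N (\<lambda>ps. \<psi>
      (((butlast xs @ [last xs \<otimes> b]) ! 0, (butlast xs @ [last xs \<otimes> b]) ! 1) # ps)) ws) u"
    unfolding sweedler.simps
    by (rule reg.tensor_lift_ract[OF b _ N multiadditive_sweedler_head[OF \<psi> ws] T_closed[OF u]]) simp
  also have "\<dots> = tensor_lift N (\<lambda>xs. sweedler N (\<lambda>ps. \<psi> ((xs ! 0, xs ! 1 \<otimes> b) # ps)) ws) u"
    by (rule reg.tensor_lift_cong[OF N T_closed[OF u]])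
      (use b in \<open>auto elim!: words_2E intro!: sweedler_closed[OF ws] pair_balanced_closed[OF \<psi>]\<close>)
  finally show ?thesis .
qed

lemma sweedler_lact_head:
  assumes \<psi>: "pair_balanced A B N (Suc n) \<psi>" and u: "u \<in> carrier T" and ws: "ws \<in> words T n"
    and b: "b \<in> carrier A"
  shows "sweedler N \<psi> ((b \<triangleright>\<^bsub>AA\<^esub> u) # ws)
    = tensor_lift N (\<lambda>xs. sweedler N (\<lambda>ps. \<psi> ((b \<otimes> xs ! 0, xs ! 1) # ps)) ws) u"
proof -
  have "sweedler N \<psi> ((b \<triangleright>\<^bsub>AA\<^esub> u) # ws) = tensor_lift N (\<lambda>xs. sweedler N (\<lambda>ps. \<psi>
      ((((b \<otimes> hd xs) # tl xs) ! 0, ((b \<otimes> hd xs) # tl xs) ! 1) # ps)) ws) u"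
    unfolding sweedler.simps
    by (rule reg.tensor_lift_lact[OF b _ N multiadditive_sweedler_head[OF \<psi> ws] T_closed[OF u]]) simp
  also have "\<dots> = tensor_lift N (\<lambda>xs. sweedler N (\<lambda>ps. \<psi> ((b \<otimes> xs ! 0, xs ! 1) # ps)) ws) u"
    by (rule reg.tensor_lift_cong[OF N T_closed[OF u]])
      (use b in \<open>auto elim!: words_2E intro!: sweedler_closed[OF ws] pair_balanced_closed[OF \<psi>]\<close>)
  finally show ?thesis .
qed

lemma sweedler_lact:
  assumes \<psi>: "pair_balanced A B N (Suc n) \<psi>" and ts: "ts \<in> words T (Suc n)" and b: "b \<in> carrier A"
  shows "sweedler N \<psi> ((b \<triangleright>\<^bsub>AA\<^esub> hd ts) # tl ts) = sweedler N (\<lambda>ps. \<psi> (lact_pairs A b ps)) ts"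
proof -
  obtain u us where t: "ts = u # us" "u \<in> carrier T" "us \<in> words T n"
    using ts by (rule words_SucE)
  show ?thesis
    using sweedler_lact_head[OF \<psi> t(2,3) b] by (simp add: t(1))
qed

text \<open>Here \<open>b\<close> passes from the second entry of one pair to the first entry of the
  next and stays in the formula. All of \<open>B\<close> is thus allowed, where moving it between
  tensors of \<open>T\<close> would require an element of \<open>R\<close>.\<close>

lemma sweedler_balanced:
  assumes \<psi>: "pair_balanced A B N (Suc n) \<psi>" and u: "u \<in> carrier T" and vs: "vs \<in> words T n"
    and n: "n = Suc m" and b: "b \<in> B"
  shows "sweedler N \<psi> ((u \<triangleleft>\<^bsub>AA\<^esub> b) # vs) = tensor_lift N (\<lambda>xs.
     sweedler N (\<lambda>ps. \<psi> ((xs ! 0, xs ! 1) # lact_pairs A b ps)) vs) u"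
proof -
  have bA: "b \<in> carrier A"
    using b by simp
  have "sweedler N \<psi> ((u \<triangleleft>\<^bsub>AA\<^esub> b) # vs)
    = tensor_lift N (\<lambda>xs. sweedler N (\<lambda>ps. \<psi> ((xs ! 0, xs ! 1 \<otimes> b) # ps)) vs) u"
    by (rule sweedler_ract_head[OF \<psi> u vs bA])
  also have "\<dots> = tensor_lift N (\<lambda>xs. sweedler N (\<lambda>ps. \<psi> ((xs ! 0, xs ! 1) # lact_pairs A b ps)) vs) u"
  proof (rule reg.tensor_lift_cong[OF N T_closed[OF u]])
    fix xs assume xs: "xs \<in> words (regular A) 2"
    have cl: "\<psi> ((xs ! 0, xs ! 1 \<otimes> b) # ps) \<in> carrier N" if "ps \<in> pair_words A n" for ps
      using that xs bA by (auto elim!: words_2E intro!: pair_balanced_closed[OF \<psi>])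
    show "sweedler N (\<lambda>ps. \<psi> ((xs ! 0, xs ! 1 \<otimes> b) # ps)) vs \<in> carrier N"
      by (rule sweedler_closed[OF vs cl])
    show "sweedler N (\<lambda>ps. \<psi> ((xs ! 0, xs ! 1 \<otimes> b) # ps)) vs
        = sweedler N (\<lambda>ps. \<psi> ((xs ! 0, xs ! 1) # lact_pairs A b ps)) vs"
      by (rule sweedler_cong[OF vs cl])
        (use \<psi> xs b n in \<open>auto elim!: words_2E pair_words_SucE\<close>)
  qed
  finally show ?thesis .
qed

text \<open>For the relation \<open>u s \<otimes> v = u \<otimes> s v\<close> the scalar is moved to
  the pair of \<open>v\<close> by \<open>sweedler_balanced\<close>, which applies because
  \<open>R \<subseteq> B\<close>, and from that pair onto the tensor \<open>v\<close> by
  \<open>sweedler_lact\<close>.\<close>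

lemma multiadditive_sweedler:
  "pair_balanced A B N n \<psi> \<Longrightarrow> multiadditive R T N n (sweedler N \<psi>)"
proof (induction n arbitrary: \<psi>)
  case (Suc n)
  have \<psi>: "pair_balanced A B N n (\<lambda>ps. \<psi> ((x, y) # ps))" if "x \<in> carrier A" "y \<in> carrier A" for x y
    using Suc.prems that by simp
  show ?case
    unfolding multiadditive_Suc[of _ _ _ n]
  proof (intro conjI ballI allI impI)
    fix u assume "u \<in> carrier T"
    then show "multiadditive R T N n (\<lambda>ws. sweedler N \<psi> (u # ws))"
      unfolding sweedler.simps by (rule multiadditive_tensor_lift) (use \<psi> Suc.IH in blast)
  next
    fix u v ws assume "u \<in> carrier T" "v \<in> carrier T" "ws \<in> words T n"
    then show "sweedler N \<psi> ((u \<oplus>\<^bsub>T\<^esub> v) # ws) = sweedler N \<psi> (u # ws) \<oplus>\<^bsub>N\<^esub> sweedler N \<psi> (v # ws)"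
      using add_hom_add[OF reg.tensor_lift_additive[OF N multiadditive_sweedler_head[OF Suc.prems]]]
      by simp
  next
    fix u s v ws assume h: "u \<in> carrier T" "s \<in> R" "v # ws \<in> words T n"
    then obtain m where n: "n = Suc m"
      by (cases n) auto
    have "sweedler N \<psi> ((u \<triangleleft>\<^bsub>AA\<^esub> s) # v # ws) = tensor_lift N (\<lambda>xs.
       sweedler N (\<lambda>ps. \<psi> ((xs ! 0, xs ! 1) # lact_pairs A s ps)) (v # ws)) u"
      by (rule sweedler_balanced[OF Suc.prems _ _ n]) (use h in auto)
    also have "\<dots> = tensor_lift N (\<lambda>xs.
       sweedler N (\<lambda>ps. \<psi> ((xs ! 0, xs ! 1) # ps)) ((s \<triangleright>\<^bsub>AA\<^esub> v) # ws)) u"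
    proof (rule reg.tensor_lift_cong[OF N T_closed[OF h(1)]])
      fix xs assume xs: "xs \<in> words (regular A) 2"
      show "sweedler N (\<lambda>ps. \<psi> ((xs ! 0, xs ! 1) # lact_pairs A s ps)) (v # ws) \<in> carrier N"
        by (rule sweedler_closed[OF h(3)])
          (use xs h(2) n in \<open>auto elim!: words_2E intro!: pair_balanced_closed[OF Suc.prems]\<close>)
      have "pair_balanced A B N (Suc m) (\<lambda>ps. \<psi> ((xs ! 0, xs ! 1) # ps))"
        using xs \<psi> n by (auto elim!: words_2E)
      from sweedler_lact[OF this, of "v # ws" s] show
        "sweedler N (\<lambda>ps. \<psi> ((xs ! 0, xs ! 1) # lact_pairs A s ps)) (v # ws)
          = sweedler N (\<lambda>ps. \<psi> ((xs ! 0, xs ! 1) # ps)) ((s \<triangleright>\<^bsub>AA\<^esub> v) # ws)"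
        using h n by simp
    qed
    finally show "sweedler N \<psi> ((u \<triangleleft>\<^bsub>T\<^esub> s) # v # ws) = sweedler N \<psi> (u # (s \<triangleright>\<^bsub>T\<^esub> v) # ws)"
      by simp
  qed
qed simp

section \<open>Actions on the last tensor\<close>

text \<open>Unless the list has length one, the modified tensor is not the first entry, so it must
  remain in \<open>T\<close>; hence the scalar is taken from \<open>R\<close>.\<close>

lemma sweedler_ract:
  assumes "pair_balanced A B N (Suc n) \<psi>" "ts \<in> words T (Suc n)" "r \<in> R"
  shows "sweedler N \<psi> (butlast ts @ [last ts \<triangleleft>\<^bsub>AA\<^esub> r]) = sweedler N (\<lambda>ps. \<psi> (ract_pairs A ps r)) ts"
  using assms(1,2)
proof (induction n arbitrary: \<psi> ts)
  case 0
  then obtain u where "ts = [u]" "u \<in> carrier T"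
    by (auto elim!: words_SucE)
  then show ?case
    using sweedler_ract_head[OF 0(1), of u "[]" r] assms(3) by (simp add: ract_pairs_def)
next
  case (Suc n)
  from Suc.prems(2) obtain u us where t: "ts = u # us" "u \<in> carrier T" "us \<in> words T (Suc n)"
    by (rule words_SucE)
  have us: "us \<noteq> []"
    using t(3) by auto
  have us': "butlast us @ [last us \<triangleleft>\<^bsub>AA\<^esub> r] \<in> words T (Suc n)"
    using T.ract_word[OF assms(3) _ t(3)] by simp
  have "sweedler N \<psi> (butlast ts @ [last ts \<triangleleft>\<^bsub>AA\<^esub> r]) = tensor_lift N (\<lambda>xs.
     sweedler N (\<lambda>ps. \<psi> ((xs ! 0, xs ! 1) # ps)) (butlast us @ [last us \<triangleleft>\<^bsub>AA\<^esub> r])) u"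
    using us by (simp add: t(1))
  also have "\<dots> = sweedler N (\<lambda>ps. \<psi> (ract_pairs A ps r)) ts"
    unfolding t(1) sweedler.simps
  proof (rule reg.tensor_lift_cong[OF N T_closed[OF t(2)]])
    fix xs assume xs: "xs \<in> words (regular A) 2"
    have cl: "\<psi> ((xs ! 0, xs ! 1) # ps) \<in> carrier N" if "ps \<in> pair_words A (Suc n)" for ps
      using xs that assms(3) by (auto elim!: words_2E intro!: pair_balanced_closed[OF Suc.prems(1)])
    show "sweedler N (\<lambda>ps. \<psi> ((xs ! 0, xs ! 1) # ps)) (butlast us @ [last us \<triangleleft>\<^bsub>AA\<^esub> r]) \<in> carrier N"
      by (rule sweedler_closed[OF us' cl])
    have "sweedler N (\<lambda>ps. \<psi> ((xs ! 0, xs ! 1) # ps)) (butlast us @ [last us \<triangleleft>\<^bsub>AA\<^esub> r])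
        = sweedler N (\<lambda>ps. \<psi> ((xs ! 0, xs ! 1) # ract_pairs A ps r)) us"
      by (rule Suc.IH[OF _ t(3)]) (use Suc.prems(1) xs in \<open>auto elim!: words_2E\<close>)
    also have "\<dots> = sweedler N (\<lambda>ps. \<psi> (ract_pairs A ((xs ! 0, xs ! 1) # ps) r)) us"
    proof (rule sweedler_cong[OF t(3)])
      fix ps assume ps: "ps \<in> pair_words A (Suc n)"
      show "\<psi> ((xs ! 0, xs ! 1) # ract_pairs A ps r) \<in> carrier N"
        by (rule cl) (use ps assms(3) in simp)
      show "\<psi> ((xs ! 0, xs ! 1) # ract_pairs A ps r) = \<psi> (ract_pairs A ((xs ! 0, xs ! 1) # ps) r)"
        using ps by (auto simp: ract_pairs_def elim!: pair_words_SucE)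
    qed
    finally show "sweedler N (\<lambda>ps. \<psi> ((xs ! 0, xs ! 1) # ps)) (butlast us @ [last us \<triangleleft>\<^bsub>AA\<^esub> r])
        = sweedler N (\<lambda>ps. \<psi> (ract_pairs A ((xs ! 0, xs ! 1) # ps) r)) us" .
  qed
  finally show ?case .
qed

text \<open>An element of \<open>B\<close> moves through the \<open>u\<^sub>i\<close> one by one, as they commute with \<open>B\<close>; unlike
  \<open>sweedler_ract\<close> this cannot be read off from balancedness over \<open>R\<close>.\<close>

lemma sweedler_ract_last:
  assumes "pair_balanced A B N (Suc n) \<psi>" "ts \<in> words T (Suc n)" "b \<in> B"
  shows "sweedler N (\<lambda>ps. \<psi> (lact_pairs A b ps)) ts = sweedler N (\<lambda>ps. \<psi> (ract_pairs A ps b)) ts"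
  using assms(1,2)
proof (induction n arbitrary: \<psi> ts)
  case 0
  from 0(2) obtain u where t: "ts = [u]" "u \<in> carrier T"
    by (auto elim!: words_SucE)
  have "sweedler N (\<lambda>ps. \<psi> (lact_pairs A b ps)) ts = sweedler N \<psi> [b \<triangleright>\<^bsub>AA\<^esub> u]"
    using sweedler_lact[OF 0, of b] assms(3) t by simp
  also have "\<dots> = sweedler N \<psi> [u \<triangleleft>\<^bsub>AA\<^esub> b]"
    using t assms(3) by (simp add: carrier_T)
  also have "\<dots> = sweedler N (\<lambda>ps. \<psi> (ract_pairs A ps b)) ts"
    using sweedler_ract_head[OF 0(1) t(2), of "[]" b] assms(3) by (simp add: t(1) ract_pairs_def)
  finally show ?case .
next
  case (Suc n)
  from Suc.prems(2) obtain u us where t: "ts = u # us" "u \<in> carrier T" "us \<in> words T (Suc n)"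
    by (rule words_SucE)
  have "sweedler N (\<lambda>ps. \<psi> (lact_pairs A b ps)) ts = sweedler N \<psi> ((b \<triangleright>\<^bsub>AA\<^esub> u) # us)"
    using sweedler_lact[OF Suc.prems, of b] assms(3) t by simp
  also have "\<dots> = sweedler N \<psi> ((u \<triangleleft>\<^bsub>AA\<^esub> b) # us)"
    using t assms(3) by (simp add: carrier_T)
  also have "\<dots> = tensor_lift N (\<lambda>xs.
     sweedler N (\<lambda>ps. \<psi> ((xs ! 0, xs ! 1) # lact_pairs A b ps)) us) u"
    by (rule sweedler_balanced[OF Suc.prems(1) t(2,3) refl assms(3)])
  also have "\<dots> = tensor_lift N (\<lambda>xs.
     sweedler N (\<lambda>ps. \<psi> ((xs ! 0, xs ! 1) # ract_pairs A ps b)) us) u"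
  proof (rule reg.tensor_lift_cong[OF N T_closed[OF t(2)]])
    fix xs assume xs: "xs \<in> words (regular A) 2"
    show "sweedler N (\<lambda>ps. \<psi> ((xs ! 0, xs ! 1) # lact_pairs A b ps)) us \<in> carrier N"
      by (rule sweedler_closed[OF t(3)])
        (use xs assms(3) in \<open>auto elim!: words_2E intro!: pair_balanced_closed[OF Suc.prems(1)]\<close>)
    show "sweedler N (\<lambda>ps. \<psi> ((xs ! 0, xs ! 1) # lact_pairs A b ps)) us
        = sweedler N (\<lambda>ps. \<psi> ((xs ! 0, xs ! 1) # ract_pairs A ps b)) us"
      by (rule Suc.IH[OF _ t(3)]) (use Suc.prems(1) xs in \<open>auto elim!: words_2E\<close>)
  qed
  also have "\<dots> = sweedler N (\<lambda>ps. \<psi> (ract_pairs A ps b)) ts"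
    unfolding t(1) sweedler.simps
  proof (rule reg.tensor_lift_cong[OF N T_closed[OF t(2)]])
    fix xs assume xs: "xs \<in> words (regular A) 2"
    have cl: "\<psi> ((xs ! 0, xs ! 1) # ract_pairs A ps b) \<in> carrier N" if "ps \<in> pair_words A (Suc n)" for ps
      using xs that assms(3) by (auto elim!: words_2E intro!: pair_balanced_closed[OF Suc.prems(1)])
    show "sweedler N (\<lambda>ps. \<psi> ((xs ! 0, xs ! 1) # ract_pairs A ps b)) us \<in> carrier N"
      by (rule sweedler_closed[OF t(3) cl])
    show "sweedler N (\<lambda>ps. \<psi> ((xs ! 0, xs ! 1) # ract_pairs A ps b)) us
        = sweedler N (\<lambda>ps. \<psi> (ract_pairs A ((xs ! 0, xs ! 1) # ps) b)) us"
      by (rule sweedler_cong[OF t(3) cl]) (auto simp: ract_pairs_def elim!: pair_words_SucE)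
  qed
  finally show ?case .
qed

section \<open>Contraction by the counit\<close>

lemma sweedler_counit_head:
  assumes \<psi>: "pair_balanced A B N (Suc n) \<psi>" and u: "u \<in> carrier T" and v: "v \<in> carrier T"
    and ws: "ws \<in> words T n"
  shows "sweedler N \<psi> ((u \<triangleleft>\<^bsub>AA\<^esub> counit A v) # ws) = sweedler N (\<lambda>ps. \<psi> (merge_pairs A 0 ps)) (u # v # ws)"
proof -
  have c: "counit A v \<in> carrier A"
    using counit_closed[OF v] by simp
  have "sweedler N \<psi> ((u \<triangleleft>\<^bsub>AA\<^esub> counit A v) # ws)
    = tensor_lift N (\<lambda>xs. sweedler N (\<lambda>ps. \<psi> ((xs ! 0, xs ! 1 \<otimes> counit A v) # ps)) ws) u"
    by (rule sweedler_ract_head[OF \<psi> u ws c])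
  also have "\<dots> = sweedler N (\<lambda>ps. \<psi> (merge_pairs A 0 ps)) (u # v # ws)"
    unfolding sweedler.simps
  proof (rule reg.tensor_lift_cong[OF N T_closed[OF u]])
    fix xs assume xs: "xs \<in> words (regular A) 2"
    then obtain x y where xy: "xs = [x, y]" "x \<in> carrier A" "y \<in> carrier A"
      by (auto elim: words_2E)
    show "sweedler N (\<lambda>ps. \<psi> ((xs ! 0, xs ! 1 \<otimes> counit A v) # ps)) ws \<in> carrier N"
      by (rule sweedler_closed[OF ws])
        (use xy c in \<open>auto intro!: pair_balanced_closed[OF \<psi>]\<close>)
    \<comment> \<open>The sum is additive in the factor \<open>c\<close> multiplied onto
      \<open>y\<close>. The sum over representatives of \<open>v\<close> can therefore be carried
      out inside this factor, where it forms the counit.\<close>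
    let ?f = "\<lambda>c. sweedler N (\<lambda>ps. \<psi> ((x, y \<otimes> c) # ps)) ws"
    have "?f \<in> hom (add_monoid A) (add_monoid N)"
    proof (rule add_homI)
      fix c d assume cd: "c \<in> carrier A" "d \<in> carrier A"
      show "?f (c \<oplus> d) = ?f c \<oplus>\<^bsub>N\<^esub> ?f d"
        using multiadditive_sweedler_head[OF \<psi> ws] xy cd
        by (auto simp: numeral_2_eq_2 multiadditive_Suc r_distr)
      show "?f c \<in> carrier N"
        by (rule sweedler_closed[OF ws]) (use xy cd in \<open>auto intro!: pair_balanced_closed[OF \<psi>]\<close>)
    qed
    then have "?f (counit A v) = tensor_lift N (\<lambda>zs. ?f (zs ! 0 \<otimes> zs ! 1)) v"
      unfolding counit_def
      by (intro reg.tensor_lift_hom[OF is_abelian_group N T_closed[OF v]]) (auto elim!: words_2E)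
    then show "sweedler N (\<lambda>ps. \<psi> ((xs ! 0, xs ! 1 \<otimes> counit A v) # ps)) ws
       = tensor_lift N (\<lambda>zs. sweedler N (\<lambda>ps. \<psi> (merge_pairs A 0 ((xs ! 0, xs ! 1) # (zs ! 0, zs ! 1) # ps))) ws) v"
      by (simp add: xy)
  qed
  finally show ?thesis .
qed

lemma sweedler_counit:
  assumes "pair_balanced A B N (length us + Suc (length ws)) \<psi>" "us @ u # v # ws \<in> words T n"
  shows "sweedler N \<psi> (us @ (u \<triangleleft>\<^bsub>AA\<^esub> counit A v) # ws)
    = sweedler N (\<lambda>ps. \<psi> (merge_pairs A (length us) ps)) (us @ u # v # ws)"
  using assms
proof (induction us arbitrary: \<psi> n)
  case Nil
  then show ?case
    using sweedler_counit_head[of "length ws" \<psi> u v ws] by (auto simp: words_def)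
next
  case (Cons t us)
  then have t: "t \<in> carrier T" and w: "us @ u # v # ws \<in> words T (Suc (Suc (length us + length ws)))"
    by (auto simp: words_def)
  have "u \<triangleleft>\<^bsub>AA\<^esub> counit A v \<in> carrier T"
    using w by (auto simp: words_def intro!: ract_T_closed counit_closed)
  with w have w': "us @ (u \<triangleleft>\<^bsub>AA\<^esub> counit A v) # ws \<in> words T (length us + Suc (length ws))"
    by (auto simp: words_def)
  have "tensor_lift N (\<lambda>xs. sweedler N (\<lambda>ps. \<psi> ((xs ! 0, xs ! 1) # ps)) (us @ (u \<triangleleft>\<^bsub>AA\<^esub> counit A v) # ws)) t
    = tensor_lift N (\<lambda>xs. sweedler N (\<lambda>ps. \<psi> ((xs ! 0, xs ! 1) # merge_pairs A (length us) ps)) (us @ u # v # ws)) t"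
  proof (rule reg.tensor_lift_cong[OF N T_closed[OF t]])
    fix xs assume xs: "xs \<in> words (regular A) 2"
    show "sweedler N (\<lambda>ps. \<psi> ((xs ! 0, xs ! 1) # ps)) (us @ (u \<triangleleft>\<^bsub>AA\<^esub> counit A v) # ws) \<in> carrier N"
      by (rule sweedler_closed[OF w'])
        (use xs in \<open>auto elim!: words_2E intro!: pair_balanced_closed[OF Cons.prems(1)]\<close>)
    show "sweedler N (\<lambda>ps. \<psi> ((xs ! 0, xs ! 1) # ps)) (us @ (u \<triangleleft>\<^bsub>AA\<^esub> counit A v) # ws)
        = sweedler N (\<lambda>ps. \<psi> ((xs ! 0, xs ! 1) # merge_pairs A (length us) ps)) (us @ u # v # ws)"
      by (rule Cons.IH[OF _ w]) (use Cons.prems(1) xs in \<open>auto elim!: words_2E\<close>)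
  qed
  then show ?case
    by simp
qed

end

end

section \<open>The argument of the homotopy\<close>

text \<open>The inner faces of the bar construction, in a recursive form that can be compared with
  \<open>merge_pairs\<close> by induction.\<close>

primrec merge_word :: "('k, 'a) module \<Rightarrow> nat \<Rightarrow> 'a list \<Rightarrow> 'a list" where
  "merge_word A 0 xs = (hd xs \<otimes>\<^bsub>A\<^esub> hd (tl xs)) # tl (tl xs)"
| "merge_word A (Suc j) xs = hd xs # merge_word A j (tl xs)"

lemma merge_word_eq:
  "Suc j < length xs \<Longrightarrow> take j xs @ [xs ! j \<otimes>\<^bsub>A\<^esub> xs ! Suc j] @ drop (Suc (Suc j)) xs = merge_word A j xs"
proof (induction j arbitrary: xs)
  case 0
  then obtain x y ys where "xs = x # y # ys"
    by (metis Suc_length_conv gr0_implies_Suc less_Suc_eq_0_disj list.exhaust list.size(3) not_less_zero)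
  then show ?case by simp
next
  case (Suc j)
  then show ?case by (cases xs) auto
qed

text \<open>The argument \<open>y\<close> is the second entry of the pair just passed, waiting for
  the first entry of the next pair.\<close>

primrec zip_tail :: "('k, 'a) module \<Rightarrow> 'a \<Rightarrow> ('a \<times> 'a) list \<Rightarrow> 'a list" where
  "zip_tail A y [] = [y]"
| "zip_tail A y (p # ps) = (y \<otimes>\<^bsub>A\<^esub> fst p) # zip_tail A (snd p) ps"

text \<open>\<open>[u\<^sub>1\<^sup>1, u\<^sub>1\<^sup>2u\<^sub>2\<^sup>1, \<dots>, u\<^bsub>n-1\<^esub>\<^sup>2u\<^sub>n\<^sup>1, u\<^sub>n\<^sup>2]\<close>\<close>

definition weave :: "('k, 'a) module \<Rightarrow> ('a \<times> 'a) list \<Rightarrow> 'a list" where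
  "weave A ps = fst (hd ps) # zip_tail A (snd (hd ps)) (tl ps)"

lemma weave_Cons [simp]: "weave A ((x, y) # ps) = x # zip_tail A y ps"
  by (simp add: weave_def)

lemma zip_tail_nonempty [simp]: "zip_tail A y ps \<noteq> []"
  by (cases ps) auto

lemma zip_tail_eq: "zip_tail A (snd p) ps = inner_products A (p # ps) @ [snd (last (p # ps))]"
  by (induction ps arbitrary: p) (auto simp: inner_products_def)

text \<open>The arguments of \<open>h\<close> in \<open>pi_left\<close> and \<open>pi_right\<close>
  are the woven word with its first or its last letter split off. The two parts of
  \<open>\<Phi>\<close> are thus the outer faces of the Hochschild differential at that
  word.\<close>

lemma weave_tl: "ps \<noteq> [] \<Longrightarrow> inner_products A ps @ [snd (last ps)] = tl (weave A ps)"
  and weave_butlast: "ps \<noteq> [] \<Longrightarrow> fst (hd ps) # inner_products A ps = butlast (weave A ps)"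
  and weave_last: "ps \<noteq> [] \<Longrightarrow> snd (last ps) = last (weave A ps)"
  by (cases ps; simp add: weave_def zip_tail_eq)+

text \<open>The second entry of the last pair occurs only as the last letter; \<open>y'\<close> is
  arbitrary because \<open>butlast\<close> discards it.\<close>

lemma zip_tail_snoc:
  "zip_tail A z (qs @ [(x, y)]) = butlast (zip_tail A z (qs @ [(x, y')])) @ [y]"
  by (induction qs arbitrary: z) auto

lemma last_zip_tail_snoc: "last (zip_tail A z (qs @ [(x, y)])) = y"
  by (induction qs arbitrary: z) auto

lemma weave_ract:
  "ps \<noteq> [] \<Longrightarrow> weave A (ract_pairs A ps a) = butlast (weave A ps) @ [last (weave A ps) \<otimes>\<^bsub>A\<^esub> a]"
proof (cases ps rule: rev_cases)
  case (snoc qs p)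
  obtain x y where p: "p = (x, y)"
    by (cases p)
  show ?thesis
  proof (cases qs)
    case Nil
    then show ?thesis
      by (simp add: snoc p ract_pairs_def)
  next
    case (Cons q qs')
    then show ?thesis
      using zip_tail_snoc[of A "snd q" qs' x "y \<otimes>\<^bsub>A\<^esub> a" y]
      by (simp add: snoc p ract_pairs_def weave_def last_zip_tail_snoc)
  qed
qed simp

lemma weave_lact: "ps \<noteq> [] \<Longrightarrow> weave A (lact_pairs A a ps) = (a \<otimes>\<^bsub>A\<^esub> hd (weave A ps)) # tl (weave A ps)"
  by (simp add: weave_def lact_pairs_def)

context irreducible_ring_extension
begin

section \<open>Faces of woven words\<close>

lemma zip_tail_closed [simp]:
  "y \<in> carrier A \<Longrightarrow> ps \<in> pair_words A n \<Longrightarrow> zip_tail A y ps \<in> words (regular A) (Suc n)"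
  by (induction n arbitrary: y ps) (auto elim!: pair_words_SucE)

lemma weave_closed: "ps \<in> pair_words A (Suc n) \<Longrightarrow> weave A ps \<in> words (regular A) (Suc (Suc n))"
  by (auto elim!: pair_words_SucE)

lemma zip_tail_lact:
  assumes "b \<in> carrier A" "y \<in> carrier A" "ps \<in> pair_words A n"
  shows "zip_tail A (b \<otimes> y) ps = (b \<otimes> hd (zip_tail A y ps)) # tl (zip_tail A y ps)"
  using assms by (cases n) (auto elim!: pair_words_SucE simp: m_assoc)

lemma zip_tail_merge_pairs:
  assumes "j \<le> n" "y \<in> carrier A" "ps \<in> pair_words A (Suc (Suc n))"
  shows "zip_tail A y (merge_pairs A j ps) = merge_word A (Suc j) (zip_tail A y ps)"
  using assms
proof (induction j arbitrary: n y ps)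
  case 0
  then obtain x1 y1 x2 y2 qs where "ps = (x1, y1) # (x2, y2) # qs" "x1 \<in> carrier A" "y1 \<in> carrier A"
    "x2 \<in> carrier A" "y2 \<in> carrier A" "qs \<in> pair_words A n"
    by (auto elim!: pair_words_SucE)
  with 0 show ?case
    using zip_tail_lact[of "y1 \<otimes> x2" y2 qs n] by (simp add: m_assoc)
next
  case (Suc j)
  then obtain m where "n = Suc m" "j \<le> m"
    by (cases n) auto
  with Suc show ?case
    by (auto elim!: pair_words_SucE[of ps])
qed

lemma weave_merge_pairs:
  assumes "j \<le> n" "ps \<in> pair_words A (Suc (Suc n))"
  shows "weave A (merge_pairs A j ps) = merge_word A (Suc j) (weave A ps)"
proof (cases j)
  case 0
  from assms(2) obtain x1 y1 x2 y2 qs where "ps = (x1, y1) # (x2, y2) # qs" "x1 \<in> carrier A"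
    "y1 \<in> carrier A" "x2 \<in> carrier A" "y2 \<in> carrier A" "qs \<in> pair_words A n"
    by (auto elim!: pair_words_SucE)
  then show ?thesis
    using 0 zip_tail_lact[of "y1 \<otimes> x2" y2 qs n] by (simp add: m_assoc)
next
  case (Suc i)
  then obtain m where "n = Suc m" "i \<le> m"
    using assms by (cases n) auto
  with assms Suc show ?thesis
    by (auto elim!: pair_words_SucE[of ps] simp: zip_tail_merge_pairs)
qed

lemma weave_merge_first:
  assumes "ps \<in> pair_words A (Suc (Suc n))"
  shows "weave A (lact_pairs A (fst (hd ps) \<otimes> snd (hd ps)) (tl ps)) = merge_word A 0 (weave A ps)"
  using assms by (auto elim!: pair_words_SucE simp: m_assoc)

lemma merge_word_closed:
  "j \<le> n \<Longrightarrow> ws \<in> words (regular A) (Suc (Suc n)) \<Longrightarrow> merge_word A j ws \<in> words (regular A) (Suc n)"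
proof (induction j arbitrary: n ws)
  case (Suc j)
  from Suc.prems obtain m where "n = Suc m" "j \<le> m"
    by (cases n) auto
  with Suc show ?case
    by (auto elim!: words_SucE[of ws])
qed (auto elim!: words_SucE)

lemma multiadditive_merge_word:
  assumes "multiadditive B (regular A) N (Suc n) \<phi>" "j \<le> n"
  shows "multiadditive B (regular A) N (Suc (Suc n)) (\<lambda>ws. \<phi> (merge_word A j ws))"
  using assms
proof (induction j arbitrary: n \<phi>)
  case 0
  show ?case
    unfolding multiadditive_Suc[of _ _ _ "Suc n"]
  proof (intro conjI ballI allI impI)
    fix x assume x: "x \<in> carrier (regular A)"
    then show "multiadditive B (regular A) N (Suc n) (\<lambda>ws. \<phi> (merge_word A 0 (x # ws)))"
      using 0(1) by (auto simp: multiadditive_Suc[of _ _ _ n] r_distr m_assoc[symmetric])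
  next
    fix x y ws
    assume "x \<in> carrier (regular A)" "y \<in> carrier (regular A)" "ws \<in> words (regular A) (Suc n)"
    then show "\<phi> (merge_word A 0 ((x \<oplus>\<^bsub>regular A\<^esub> y) # ws))
        = \<phi> (merge_word A 0 (x # ws)) \<oplus>\<^bsub>N\<^esub> \<phi> (merge_word A 0 (y # ws))"
      using 0(1) by (auto simp: multiadditive_Suc[of _ _ _ n] l_distr elim!: words_SucE)
  next
    fix x s y ws
    assume "x \<in> carrier (regular A)" "s \<in> B" "y # ws \<in> words (regular A) (Suc n)"
    then show "\<phi> (merge_word A 0 ((x \<triangleleft>\<^bsub>regular A\<^esub> s) # y # ws))
        = \<phi> (merge_word A 0 (x # (s \<triangleright>\<^bsub>regular A\<^esub> y) # ws))"
      by (simp add: m_assoc)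
  qed
next
  case (Suc j)
  then obtain m where n: "n = Suc m" "j \<le> m"
    by (cases n) auto
  show ?case
    unfolding multiadditive_Suc[of _ _ _ "Suc n"]
  proof (intro conjI ballI allI impI)
    fix x assume x: "x \<in> carrier (regular A)"
    then show "multiadditive B (regular A) N (Suc n) (\<lambda>ws. \<phi> (merge_word A (Suc j) (x # ws)))"
      using Suc.IH[of m "\<lambda>ws. \<phi> (x # ws)"] Suc.prems(1) n by (simp add: multiadditive_Suc[of _ _ _ "Suc m"])
  next
    fix x y ws
    assume "x \<in> carrier (regular A)" "y \<in> carrier (regular A)" "ws \<in> words (regular A) (Suc n)"
    then show "\<phi> (merge_word A (Suc j) ((x \<oplus>\<^bsub>regular A\<^esub> y) # ws))
        = \<phi> (merge_word A (Suc j) (x # ws)) \<oplus>\<^bsub>N\<^esub> \<phi> (merge_word A (Suc j) (y # ws))"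
      using Suc.prems(1) merge_word_closed[OF n(2), of ws] n by (simp add: multiadditive_Suc[of _ _ _ "Suc m"])
  next
    fix x s y ws
    assume h: "x \<in> carrier (regular A)" "s \<in> B" "y # ws \<in> words (regular A) (Suc n)"
    \<comment> \<open>The action of \<open>s\<close> stays on the first letter after merging; for
      \<open>j = 0\<close> that letter is itself a product, and associativity is needed.\<close>
    have "merge_word A j ((s \<otimes> y) # ws) = (s \<otimes> hd (merge_word A j (y # ws))) # tl (merge_word A j (y # ws))"
      using h n by (cases j) (auto simp: m_assoc elim!: words_SucE)
    moreover obtain z zs where z: "merge_word A j (y # ws) = z # zs"
      by (cases j) auto
    ultimately show "\<phi> (merge_word A (Suc j) ((x \<triangleleft>\<^bsub>regular A\<^esub> s) # y # ws))
        = \<phi> (merge_word A (Suc j) (x # (s \<triangleright>\<^bsub>regular A\<^esub> y) # ws))"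
      using Suc.prems(1) merge_word_closed[OF n(2), of "y # ws"] n h
      by (simp add: multiadditive_Suc[of _ _ _ "Suc m"])
  qed
qed

section \<open>Balancedness of woven formulas\<close>

text \<open>The two entries of a pair lie in neighbouring letters, so balancedness within a pair is
  that of \<open>\<phi>\<close>. Between adjacent pairs both sides give the same word, since
  \<open>(z b) x' = z (b x')\<close>.\<close>

lemma pair_balanced_zip_tail:
  "multiadditive B (regular A) N (Suc n) \<phi> \<Longrightarrow> y \<in> carrier A
    \<Longrightarrow> pair_balanced A B N n (\<lambda>ps. \<phi> (zip_tail A y ps))"
proof (induction n arbitrary: \<phi> y)
  case 0
  then show ?case
    by (auto intro: multiadditive_closed)
next
  case (Suc n)
  have \<phi>: "multiadditive B (regular A) N (Suc n) (\<lambda>ws. \<phi> (x # ws))" if "x \<in> carrier A" for x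
    using Suc.prems(1) that by (simp add: multiadditive_Suc[of _ _ _ "Suc n"])
  have head: "\<phi> ((x \<oplus> x') # ws) = \<phi> (x # ws) \<oplus>\<^bsub>N\<^esub> \<phi> (x' # ws)"
    "b \<in> B \<Longrightarrow> \<phi> ((x \<otimes> b) # ws) = \<phi> (x # (b \<otimes> hd ws) # tl ws)"
    if "x \<in> carrier A" "x' \<in> carrier A" "ws \<in> words (regular A) (Suc n)" for x x' ws b
    using Suc.prems(1) that by (auto simp: multiadditive_Suc[of _ _ _ "Suc n"] elim!: words_SucE)
  \<comment> \<open>The second entry of the head pair reappears in the first letter of the tail:
    alone if no pair follows, otherwise multiplied by the next first entry. Hence the case split on
    \<open>n\<close>.\<close>
  have add: "\<phi> (z # zip_tail A (x \<oplus> x') ps) = \<phi> (z # zip_tail A x ps) \<oplus>\<^bsub>N\<^esub> \<phi> (z # zip_tail A x' ps)"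
    if "z \<in> carrier A" "x \<in> carrier A" "x' \<in> carrier A" "ps \<in> pair_words A n" for z x x' ps
    using \<phi>[OF that(1)] that by (cases n) (auto simp: multiadditive_Suc l_distr elim!: pair_words_SucE)
  show ?case
    unfolding pair_balanced.simps
  proof (intro conjI ballI allI impI)
    fix x z assume "x \<in> carrier A" "z \<in> carrier A"
    then show "pair_balanced A B N n (\<lambda>ps. \<phi> (zip_tail A y ((x, z) # ps)))"
      using Suc.IH[OF \<phi>, of "y \<otimes> x" z] Suc.prems(2) by simp
  next
    fix x x' z ps
    assume "x \<in> carrier A" "x' \<in> carrier A" "z \<in> carrier A" "ps \<in> pair_words A n"
    then show "\<phi> (zip_tail A y ((x \<oplus> x', z) # ps))
        = \<phi> (zip_tail A y ((x, z) # ps)) \<oplus>\<^bsub>N\<^esub> \<phi> (zip_tail A y ((x', z) # ps))"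
      "\<phi> (zip_tail A y ((z, x \<oplus> x') # ps))
        = \<phi> (zip_tail A y ((z, x) # ps)) \<oplus>\<^bsub>N\<^esub> \<phi> (zip_tail A y ((z, x') # ps))"
      using Suc.prems(2) by (simp_all add: head add r_distr)
  next
    fix x b z ps
    assume "x \<in> carrier A" "b \<in> B" "z \<in> carrier A" "ps \<in> pair_words A n"
    then show "\<phi> (zip_tail A y ((x \<otimes> b, z) # ps)) = \<phi> (zip_tail A y ((x, b \<otimes> z) # ps))"
      using Suc.prems(2) head(2)[of "y \<otimes> x" "y \<otimes> x" "zip_tail A z ps" b]
      by (simp add: m_assoc zip_tail_lact)
  next
    fix x z b x' y' ps
    assume "x \<in> carrier A" "z \<in> carrier A" "b \<in> B" "(x', y') # ps \<in> pair_words A n"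
    then show "\<phi> (zip_tail A y ((x, z \<otimes> b) # (x', y') # ps))
        = \<phi> (zip_tail A y ((x, z) # (b \<otimes> x', y') # ps))"
      by (cases n) (auto simp: m_assoc)
  qed
qed

lemma pair_balanced_cong:
  "pair_balanced A B N n \<psi> \<Longrightarrow> (\<And>ps. ps \<in> pair_words A n \<Longrightarrow> \<psi> ps = \<psi>' ps) \<Longrightarrow> pair_balanced A B N n \<psi>'"
proof (induction n arbitrary: \<psi> \<psi>')
  case (Suc n)
  have eq: "\<psi>' ((x, y) # ps) = \<psi> ((x, y) # ps)"
    if "x \<in> carrier A" "y \<in> carrier A" "ps \<in> pair_words A n" for x y ps
    using Suc.prems(2)[of "(x, y) # ps"] that by simp
  have bal: "pair_balanced A B N n (\<lambda>ps. \<psi>' ((x, y) # ps))" if "x \<in> carrier A" "y \<in> carrier A" for x y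
    using Suc.IH[of "\<lambda>ps. \<psi> ((x, y) # ps)"] Suc.prems(1) that eq by simp
  have cl: "(b \<otimes> x, y) # ps \<in> pair_words A n" if "b \<in> B" "(x, y) # ps \<in> pair_words A n" for b x y ps
    using that by (cases n) auto
  show ?case
    using Suc.prems(1) by (simp add: eq bal cl)
qed simp

lemma pair_balanced_weave:
  assumes "multiadditive B (regular A) N (Suc (Suc n)) \<phi>"
  shows "pair_balanced A B N (Suc n) (\<lambda>ps. \<phi> (weave A ps))"
  \<comment> \<open>With the unit as the waiting entry, \<open>zip_tail\<close> produces exactly the
    woven word.\<close>
  using pair_balanced_zip_tail[OF assms one_closed]
  by (rule pair_balanced_cong) (auto elim!: pair_words_SucE)

end

section \<open>Cochains from Sweedler sums\<close>

lemma (in abelian_group) int_pow_add_hom: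
  "(\<lambda>x. [(k::int)] \<cdot> x) \<in> hom (add_monoid G) (add_monoid G)"
  by (rule add_homI) (simp_all add: add.int_pow_distrib)

text \<open>The two differentials run over the same faces \<open>c 1, ..., c (n + 2)\<close> with
  opposite signs; the coring differential merely lists the first and the last face
  separately.\<close>

lemma (in abelian_group) alternating_cancel:
  assumes "\<And>i. c i \<in> carrier G"
  shows "(c 1 \<oplus> (\<Oplus>i\<in>{2..n + 1}. [((-1) ^ (i + 1) :: int)] \<cdot> c i) \<oplus> [((-1) ^ (n + 3) :: int)] \<cdot> c (n + 2))
    \<oplus> (\<Oplus>i\<in>{1..n + 2}. [((-1) ^ i :: int)] \<cdot> c i) = \<zero>"
proof -
  have cl: "[k] \<cdot> c i \<in> carrier G" for i and k :: int
    using assms by simp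
  have set: "{1..n + 2} = insert 1 (insert (n + 2) {2..n + 1})"
    by auto
  have "(\<Oplus>i\<in>{1..n + 2}. [((-1) ^ (i + 1) :: int)] \<cdot> c i)
      = c 1 \<oplus> (\<Oplus>i\<in>{2..n + 1}. [((-1) ^ (i + 1) :: int)] \<cdot> c i) \<oplus> [((-1) ^ (n + 3) :: int)] \<cdot> c (n + 2)"
    unfolding set using assms by (simp add: finsum_closed a_ac eval_nat_numeral)
  moreover have "(\<Oplus>i\<in>{1..n + 2}. [((-1) ^ (i + 1) :: int)] \<cdot> c i) \<oplus> (\<Oplus>i\<in>{1..n + 2}. [((-1) ^ i :: int)] \<cdot> c i)
      = (\<Oplus>i\<in>{1..n + 2}. [((-1) ^ (i + 1) :: int)] \<cdot> c i \<oplus> [((-1) ^ i :: int)] \<cdot> c i)"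
    using cl by (simp add: finsum_addf)
  moreover have "[((-1) ^ (i + 1) :: int)] \<cdot> c i \<oplus> [((-1) ^ i :: int)] \<cdot> c i = \<zero>" for i
    using add.int_pow_mult[of "c i" "(- 1) ^ (i + 1)" "(- 1) ^ i"] assms
    by (simp add: add_pow_def[of _ 0])
  ultimately show ?thesis
    by (simp add: finsum_zero)
qed

locale irreducible_extension_bimodule = irreducible_ring_extension A B + P: bimodule A P
    for A :: "('k, 'a) module" (structure) and B :: "'a set" and P :: "('a, 'p) bimodule"
begin

lemma P_group: "abelian_group P"
  by (rule P.abelian_group_axioms)

lemma lact_hom: "a \<in> carrier A \<Longrightarrow> (\<lambda>x. a \<triangleright>\<^bsub>P\<^esub> x) \<in> hom (add_monoid P) (add_monoid P)"
  by (rule add_homI) (simp_all add: P.lact_closed P.lact_add_right)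

lemma ract_hom: "a \<in> carrier A \<Longrightarrow> (\<lambda>x. x \<triangleleft>\<^bsub>P\<^esub> a) \<in> hom (add_monoid P) (add_monoid P)"
  by (rule add_homI) (simp_all add: P.ract_closed P.ract_add_left)

lemma lact_left_hom: "x \<in> carrier P \<Longrightarrow> (\<lambda>a. a \<triangleright>\<^bsub>P\<^esub> x) \<in> hom (add_monoid A) (add_monoid P)"
  by (rule add_homI) (simp_all add: P.lact_closed P.lact_add_left)

section \<open>Equivariant formulas and the cochains they define\<close>

text \<open>Equivariance is demanded over \<open>B\<close> and used twice: for elements of
  \<open>R \<subseteq> B\<close> it makes the resulting cochain \<open>R\<close>-bilinear, and for
  all of \<open>B\<close> it forces the values into \<open>P\<^sup>B\<close>.\<close>

definition equivariant :: "nat \<Rightarrow> (('a \<times> 'a) list \<Rightarrow> 'p) \<Rightarrow> bool" where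
  "equivariant n \<psi> \<longleftrightarrow> pair_balanced A B P n \<psi> \<and>
     (\<forall>b\<in>B. \<forall>ps\<in>pair_words A n. \<psi> (lact_pairs A b ps) = b \<triangleright>\<^bsub>P\<^esub> \<psi> ps \<and> \<psi> (ract_pairs A ps b) = \<psi> ps \<triangleleft>\<^bsub>P\<^esub> b)"

definition sweedler_lift :: "(('a \<times> 'a) list \<Rightarrow> 'p) \<Rightarrow> 'a tensors tensors \<Rightarrow> 'p" where
  "sweedler_lift \<psi> = tensor_lift P (sweedler P \<psi>)"

lemma sweedler_lift_closed:
  assumes "X \<in> carrier (tensor_group R T n)" "\<And>ps. ps \<in> pair_words A n \<Longrightarrow> \<psi> ps \<in> carrier P"
  shows "sweedler_lift \<psi> X \<in> carrier P"
  unfolding sweedler_lift_def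
  by (rule T.tensor_lift_closed[OF P_group assms(1)]) (rule sweedler_closed[OF P_group _ assms(2)])

lemma sweedler_lift_cong:
  assumes X: "X \<in> carrier (tensor_group R T n)"
    and "\<And>ps. ps \<in> pair_words A n \<Longrightarrow> \<psi> ps \<in> carrier P"
    and "\<And>ps. ps \<in> pair_words A n \<Longrightarrow> \<psi> ps = \<psi>' ps"
  shows "sweedler_lift \<psi> X = sweedler_lift \<psi>' X"
  unfolding sweedler_lift_def
  by (rule T.tensor_lift_cong[OF P_group X])
    (auto intro: sweedler_closed[OF P_group] sweedler_cong[OF P_group] assms(2,3))

lemma sweedler_lift_add:
  assumes X: "X \<in> carrier (tensor_group R T n)"
    and cl: "\<And>ps. ps \<in> pair_words A n \<Longrightarrow> \<psi> ps \<in> carrier P"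
    "\<And>ps. ps \<in> pair_words A n \<Longrightarrow> \<psi>' ps \<in> carrier P"
  shows "sweedler_lift (\<lambda>ps. \<psi> ps \<oplus>\<^bsub>P\<^esub> \<psi>' ps) X = sweedler_lift \<psi> X \<oplus>\<^bsub>P\<^esub> sweedler_lift \<psi>' X"
proof -
  note sc = sweedler_closed[OF P_group]
  have "sweedler_lift (\<lambda>ps. \<psi> ps \<oplus>\<^bsub>P\<^esub> \<psi>' ps) X
      = tensor_lift P (\<lambda>ts. sweedler P \<psi> ts \<oplus>\<^bsub>P\<^esub> sweedler P \<psi>' ts) X"
    unfolding sweedler_lift_def
    by (rule T.tensor_lift_cong[OF P_group X])
      (auto intro!: sc sweedler_add[OF P_group] simp: cl)
  also have "\<dots> = sweedler_lift \<psi> X \<oplus>\<^bsub>P\<^esub> sweedler_lift \<psi>' X"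
    unfolding sweedler_lift_def
    by (rule T.tensor_lift_add[OF P_group X]) (auto intro!: sc simp: cl)
  finally show ?thesis .
qed

lemma sweedler_lift_hom:
  assumes X: "X \<in> carrier (tensor_group R T n)"
    and cl: "\<And>ps. ps \<in> pair_words A n \<Longrightarrow> \<psi> ps \<in> carrier P"
    and f: "f \<in> hom (add_monoid P) (add_monoid P)"
  shows "sweedler_lift (\<lambda>ps. f (\<psi> ps)) X = f (sweedler_lift \<psi> X)"
proof -
  note sc = sweedler_closed[OF P_group]
  have "f (sweedler_lift \<psi> X) = tensor_lift P (\<lambda>ts. f (sweedler P \<psi> ts)) X"
    unfolding sweedler_lift_def
    by (rule T.tensor_lift_hom[OF P_group P_group X _ f]) (auto intro!: sc simp: cl)
  also have "\<dots> = sweedler_lift (\<lambda>ps. f (\<psi> ps)) X"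
    unfolding sweedler_lift_def
    by (rule T.tensor_lift_cong[OF P_group X])
      (auto intro!: add_hom_closed[OF f] sc sweedler_hom[OF P_group P_group f] simp: cl)
  finally show ?thesis ..
qed

lemma sweedler_lift_pure:
  assumes "pair_balanced A B P n \<psi>" "ts \<in> words T n"
  shows "sweedler_lift \<psi> (dt_pure A B ts) = sweedler P \<psi> ts"
  unfolding sweedler_lift_def
  by (rule T.tensor_lift_pure[OF P_group multiadditive_sweedler[OF P_group assms(1)] assms(2)])

lemma sweedler_lift_additive:
  "pair_balanced A B P n \<psi> \<Longrightarrow> sweedler_lift \<psi> \<in> hom (add_monoid (tensor_group R T n)) (add_monoid P)"
  unfolding sweedler_lift_def
  by (rule T.tensor_lift_additive[OF P_group multiadditive_sweedler[OF P_group]])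

text \<open>On pure tensors \<open>b\<close> is absorbed into the first pair, carried through all
  tensors to the last pair by \<open>sweedler_ract_last\<close>, and released on the right.\<close>

lemma sweedler_lift_invariant:
  assumes \<psi>: "equivariant (Suc n) \<psi>" and X: "X \<in> carrier (tensor_group R T (Suc n))" and b: "b \<in> B"
  shows "b \<triangleright>\<^bsub>P\<^esub> sweedler_lift \<psi> X = sweedler_lift \<psi> X \<triangleleft>\<^bsub>P\<^esub> b"
proof (rule T.tensor_hom_eqI[OF P_group _ _ _ X])
  have bal: "pair_balanced A B P (Suc n) \<psi>"
    using \<psi> by (simp add: equivariant_def)
  note hom = sweedler_lift_additive[OF bal]
  show "(\<lambda>X. b \<triangleright>\<^bsub>P\<^esub> sweedler_lift \<psi> X) \<in> hom (add_monoid (tensor_group R T (Suc n))) (add_monoid P)"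
    using b by (intro add_hom_compose[OF hom] lact_hom) simp
  show "(\<lambda>X. sweedler_lift \<psi> X \<triangleleft>\<^bsub>P\<^esub> b) \<in> hom (add_monoid (tensor_group R T (Suc n))) (add_monoid P)"
    using b by (intro add_hom_compose[OF hom] ract_hom) simp
  fix ts assume ts: "ts \<in> words T (Suc n)"
  note cl = pair_balanced_closed[OF bal]
  have "b \<triangleright>\<^bsub>P\<^esub> sweedler P \<psi> ts = sweedler P (\<lambda>ps. b \<triangleright>\<^bsub>P\<^esub> \<psi> ps) ts"
    by (rule sweedler_hom[OF P_group P_group lact_hom ts cl]) (use b in simp_all)
  also have "\<dots> = sweedler P (\<lambda>ps. \<psi> (lact_pairs A b ps)) ts"
    by (rule sweedler_cong[OF P_group ts]) (use \<psi> b cl in \<open>auto simp: equivariant_def P.lact_closed\<close>)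
  also have "\<dots> = sweedler P (\<lambda>ps. \<psi> (ract_pairs A ps b)) ts"
    by (rule sweedler_ract_last[OF P_group bal ts b])
  also have "\<dots> = sweedler P (\<lambda>ps. \<psi> ps \<triangleleft>\<^bsub>P\<^esub> b) ts"
    by (rule sweedler_cong[OF P_group ts]) (use \<psi> b cl in \<open>auto simp: equivariant_def P.ract_closed\<close>)
  also have "\<dots> = sweedler P \<psi> ts \<triangleleft>\<^bsub>P\<^esub> b"
    by (rule sweedler_hom[OF P_group P_group ract_hom ts cl, symmetric]) (use b in simp_all)
  finally show "b \<triangleright>\<^bsub>P\<^esub> sweedler_lift \<psi> (dt_pure A B ts) = sweedler_lift \<psi> (dt_pure A B ts) \<triangleleft>\<^bsub>P\<^esub> b"
    by (simp add: sweedler_lift_pure[OF bal ts])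
qed

lemma sweedler_equivariant_ract:
  assumes \<psi>: "equivariant (Suc n) \<psi>" and ts: "ts \<in> words T (Suc n)" and r: "r \<in> R"
  shows "sweedler P \<psi> (butlast ts @ [last ts \<triangleleft>\<^bsub>AA\<^esub> r]) = sweedler P \<psi> ts \<triangleleft>\<^bsub>P\<^esub> r"
proof -
  have bal: "pair_balanced A B P (Suc n) \<psi>"
    using \<psi> by (simp add: equivariant_def)
  note cl = pair_balanced_closed[OF bal]
  have "sweedler P \<psi> (butlast ts @ [last ts \<triangleleft>\<^bsub>AA\<^esub> r]) = sweedler P (\<lambda>ps. \<psi> (ract_pairs A ps r)) ts"
    by (rule sweedler_ract[OF P_group bal ts r])
  also have "\<dots> = sweedler P (\<lambda>ps. \<psi> ps \<triangleleft>\<^bsub>P\<^esub> r) ts"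
    by (rule sweedler_cong[OF P_group ts]) (use \<psi> r cl in \<open>auto simp: equivariant_def P.ract_closed\<close>)
  also have "\<dots> = sweedler P \<psi> ts \<triangleleft>\<^bsub>P\<^esub> r"
    by (rule sweedler_hom[OF P_group P_group ract_hom ts cl, symmetric]) (use r in simp_all)
  finally show ?thesis .
qed

lemma sweedler_equivariant_lact:
  assumes \<psi>: "equivariant (Suc n) \<psi>" and ts: "ts \<in> words T (Suc n)" and r: "r \<in> R"
  shows "sweedler P \<psi> ((r \<triangleright>\<^bsub>AA\<^esub> hd ts) # tl ts) = r \<triangleright>\<^bsub>P\<^esub> sweedler P \<psi> ts"
proof -
  have bal: "pair_balanced A B P (Suc n) \<psi>"
    using \<psi> by (simp add: equivariant_def)
  note cl = pair_balanced_closed[OF bal]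
  have "sweedler P \<psi> ((r \<triangleright>\<^bsub>AA\<^esub> hd ts) # tl ts) = sweedler P (\<lambda>ps. \<psi> (lact_pairs A r ps)) ts"
    by (rule sweedler_lact[OF P_group bal ts]) (use r in simp)
  also have "\<dots> = sweedler P (\<lambda>ps. r \<triangleright>\<^bsub>P\<^esub> \<psi> ps) ts"
    by (rule sweedler_cong[OF P_group ts]) (use \<psi> r cl in \<open>auto simp: equivariant_def P.lact_closed\<close>)
  also have "\<dots> = r \<triangleright>\<^bsub>P\<^esub> sweedler P \<psi> ts"
    by (rule sweedler_hom[OF P_group P_group lact_hom ts cl, symmetric]) (use r in simp_all)
  finally show ?thesis .
qed

lemma sweedler_lift_cochain:
  assumes \<psi>: "equivariant (Suc n) \<psi>"
  shows "(\<lambda>X\<in>carrier (dt_power A B (n + 1)). sweedler_lift \<psi> X) \<in> carrier (coring_cochains A B P n)"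
proof -
  have bal: "pair_balanced A B P (Suc n) \<psi>"
    using \<psi> by (simp add: equivariant_def)
  note hom = sweedler_lift_additive[OF bal]
  note mult = multiadditive_sweedler[OF P_group bal]
  interpret tg: abelian_group "tensor_group R T (Suc n)"
    by (rule T.abelian_group_tensor_group)
  note sc = sweedler_closed[OF P_group _ pair_balanced_closed[OF bal]]
  have l: "sweedler_lift \<psi> (r \<triangleright>\<^bsub>dt_power A B (Suc n)\<^esub> X) = r \<triangleright>\<^bsub>P\<^esub> sweedler_lift \<psi> X"
    if r: "r \<in> R" and X: "X \<in> carrier (tensor_group R T (Suc n))" for r X
  proof -
    have "sweedler_lift \<psi> (r \<triangleright>\<^bsub>dt_power A B (Suc n)\<^esub> X)
        = tensor_lift P (\<lambda>ts. sweedler P \<psi> ((r \<triangleright>\<^bsub>AA\<^esub> hd ts) # tl ts)) X"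
      unfolding sweedler_lift_def using T.tensor_lift_lact[OF r _ P_group mult X] by simp
    also have "\<dots> = tensor_lift P (\<lambda>ts. r \<triangleright>\<^bsub>P\<^esub> sweedler P \<psi> ts) X"
      by (rule T.tensor_lift_cong[OF P_group X, symmetric])
        (use r in \<open>simp_all only: sweedler_equivariant_lact[OF \<psi>] P.lact_closed sc B_closed R_B\<close>)
    also have "\<dots> = r \<triangleright>\<^bsub>P\<^esub> sweedler_lift \<psi> X"
      unfolding sweedler_lift_def
      by (rule T.tensor_lift_hom[OF P_group P_group X sc lact_hom, symmetric]) (use r in auto)
    finally show ?thesis .
  qed
  have r: "sweedler_lift \<psi> (X \<triangleleft>\<^bsub>dt_power A B (Suc n)\<^esub> r) = sweedler_lift \<psi> X \<triangleleft>\<^bsub>P\<^esub> r"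
    if r: "r \<in> R" and X: "X \<in> carrier (tensor_group R T (Suc n))" for r X
  proof -
    have "sweedler_lift \<psi> (X \<triangleleft>\<^bsub>dt_power A B (Suc n)\<^esub> r)
        = tensor_lift P (\<lambda>ts. sweedler P \<psi> (butlast ts @ [last ts \<triangleleft>\<^bsub>AA\<^esub> r])) X"
      unfolding sweedler_lift_def using T.tensor_lift_ract[OF r _ P_group mult X] by simp
    also have "\<dots> = tensor_lift P (\<lambda>ts. sweedler P \<psi> ts \<triangleleft>\<^bsub>P\<^esub> r) X"
      by (rule T.tensor_lift_cong[OF P_group X, symmetric])
        (use r in \<open>simp_all only: sweedler_equivariant_ract[OF \<psi>] P.ract_closed sc B_closed R_B\<close>)
    also have "\<dots> = sweedler_lift \<psi> X \<triangleleft>\<^bsub>P\<^esub> r"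
      unfolding sweedler_lift_def
      by (rule T.tensor_lift_hom[OF P_group P_group X sc ract_hom, symmetric]) (use r in auto)
    finally show ?thesis .
  qed
  show ?thesis
    using sweedler_lift_invariant[OF \<psi>] add_hom_closed[OF hom] add_hom_add[OF hom] l r
      T.lact_tensor_closed[of _ "Suc n"] T.ract_tensor_closed[of _ "Suc n"]
    by (auto simp: coring_cochains_def hom_module_def bimodule_hom_def hom_def carrier_invariants)
qed

text \<open>The formula of \<open>coring_d\<close> before summation over representatives. Its last summand uses
  \<open>g(t\<^sub>1 \<otimes> \<cdots> \<otimes> t\<^bsub>n+1\<^esub>) \<epsilon>(t\<^bsub>n+2\<^esub>) = g(t\<^sub>1 \<otimes> \<cdots> \<otimes> t\<^bsub>n+1\<^esub> \<epsilon>(t\<^bsub>n+2\<^esub>))\<close>.\<close>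

definition coboundary :: "nat \<Rightarrow> (('a \<times> 'a) list \<Rightarrow> 'p) \<Rightarrow> ('a \<times> 'a) list \<Rightarrow> 'p" where
  "coboundary n \<psi> ps = \<psi> (lact_pairs A (fst (hd ps) \<otimes> snd (hd ps)) (tl ps))
     \<oplus>\<^bsub>P\<^esub> (\<Oplus>\<^bsub>P\<^esub>i\<in>{2..n + 1}. [((-1) ^ (i + 1) :: int)] \<cdot>\<^bsub>P\<^esub> \<psi> (merge_pairs A (i - 2) ps))
     \<oplus>\<^bsub>P\<^esub> [((-1) ^ (n + 3) :: int)] \<cdot>\<^bsub>P\<^esub> \<psi> (merge_pairs A n ps)"

section \<open>The coring differential of a Sweedler sum\<close>

text \<open>The formula is additive in the scalar acting on the remaining pairs, so summing over
  representatives of \<open>u\<close> turns this scalar into the counit. The counit lies in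
  \<open>B\<close>, and equivariance takes it out of \<open>\<psi>\<close>.\<close>

lemma sweedler_counit_first:
  assumes \<psi>: "equivariant (Suc n) \<psi>" and u: "u \<in> carrier T" and us: "us \<in> words T (Suc n)"
  shows "sweedler P (\<lambda>ps. \<psi> (lact_pairs A (fst (hd ps) \<otimes> snd (hd ps)) (tl ps))) (u # us)
    = counit A u \<triangleright>\<^bsub>P\<^esub> sweedler P \<psi> us"
proof -
  have bal: "pair_balanced A B P (Suc n) \<psi>"
    using \<psi> by (simp add: equivariant_def)
  note cl = pair_balanced_closed[OF bal]
  have c: "counit A u \<in> R"
    by (rule counit_closed[OF u])
  let ?f = "\<lambda>a. sweedler P (\<lambda>ps. \<psi> (lact_pairs A a ps)) us"
  have f: "?f \<in> hom (add_monoid A) (add_monoid P)"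
  proof (rule add_homI)
    fix a assume "a \<in> carrier A"
    then show "?f a \<in> carrier P"
      by (auto intro!: sweedler_closed[OF P_group us] cl)
  next
    fix a b assume ab: "a \<in> carrier A" "b \<in> carrier A"
    have "?f (a \<oplus> b) = sweedler P (\<lambda>ps. \<psi> (lact_pairs A a ps) \<oplus>\<^bsub>P\<^esub> \<psi> (lact_pairs A b ps)) us"
      by (rule sweedler_cong[OF P_group us])
        (use ab bal cl in \<open>auto elim!: pair_words_SucE simp: l_distr\<close>)
    also have "\<dots> = ?f a \<oplus>\<^bsub>P\<^esub> ?f b"
      by (rule sweedler_add[OF P_group us]) (use ab cl in auto)
    finally show "?f (a \<oplus> b) = ?f a \<oplus>\<^bsub>P\<^esub> ?f b" .
  qed
  have "sweedler P (\<lambda>ps. \<psi> (lact_pairs A (fst (hd ps) \<otimes> snd (hd ps)) (tl ps))) (u # us)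
      = tensor_lift P (\<lambda>xs. ?f (xs ! 0 \<otimes> xs ! 1)) u"
    by simp
  also have "\<dots> = ?f (counit A u)"
    unfolding counit_def
    by (rule reg.tensor_lift_hom[OF is_abelian_group P_group T_closed[OF u] _ f, symmetric])
      (auto elim!: words_2E)
  also have "\<dots> = sweedler P (\<lambda>ps. counit A u \<triangleright>\<^bsub>P\<^esub> \<psi> ps) us"
    by (rule sweedler_cong[OF P_group us]) (use \<psi> c cl in \<open>auto simp: equivariant_def P.lact_closed\<close>)
  also have "\<dots> = counit A u \<triangleright>\<^bsub>P\<^esub> sweedler P \<psi> us"
    by (rule sweedler_hom[OF P_group P_group lact_hom us cl, symmetric]) (use c in simp_all)
  finally show ?thesis .
qed

text \<open>The summands are matched on words over \<open>T\<close>: the first by pulling a counit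
  out of \<open>\<psi>\<close>, the inner ones by contraction, and the last by turning its right
  action into a contraction of the last two tensors.\<close>

lemma coring_d_sweedler_lift:
  assumes \<psi>: "equivariant (Suc n) \<psi>" and X: "X \<in> carrier (tensor_group R T (n + 2))"
    and g: "g = (\<lambda>X\<in>carrier (dt_power A B (n + 1)). sweedler_lift \<psi> X)"
  shows "coring_d A B P n g X = sweedler_lift (coboundary n \<psi>) X"
proof -
  have bal: "pair_balanced A B P (Suc n) \<psi>"
    using \<psi> by (simp add: equivariant_def)
  note cl = pair_balanced_closed[OF bal]
  note sc = sweedler_closed[OF P_group]
  have gp: "g (dt_pure A B ts) = sweedler P \<psi> ts" if "ts \<in> words T (Suc n)" for ts
    using that T.pure_tensor_closed[OF that] by (simp add: g sweedler_lift_pure[OF bal])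
  have first: "\<psi> (lact_pairs A (fst (hd ps) \<otimes> snd (hd ps)) (tl ps)) \<in> carrier P"
    if "ps \<in> pair_words A (Suc (Suc n))" for ps
    using that by (auto elim!: pair_words_SucE intro!: cl)
  have mid: "\<psi> (merge_pairs A j ps) \<in> carrier P" if "ps \<in> pair_words A (Suc (Suc n))" "j \<le> n" for ps j
    using that by (intro cl merge_pairs_closed)
  have mid': "(\<lambda>i. [((-1) ^ (i + 1) :: int)] \<cdot>\<^bsub>P\<^esub> \<psi> (merge_pairs A (i - 2) ps)) \<in> {2..n + 1} \<rightarrow> carrier P"
    if "ps \<in> pair_words A (Suc (Suc n))" for ps
    using mid[OF that] by auto
  \<comment> \<open>Stated for every \<open>j \<le> n\<close> and every coefficient, so that
    \<open>j = n\<close> also covers the last summand.\<close>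
  have mid_sw: "[(k::int)] \<cdot>\<^bsub>P\<^esub> sweedler P \<psi> (take j ts @ [ts ! j \<triangleleft>\<^bsub>AA\<^esub> counit A (ts ! Suc j)] @ drop (Suc (Suc j)) ts)
      = sweedler P (\<lambda>ps. [k] \<cdot>\<^bsub>P\<^esub> \<psi> (merge_pairs A j ps)) ts"
    and mid_cl: "take j ts @ [ts ! j \<triangleleft>\<^bsub>AA\<^esub> counit A (ts ! Suc j)] @ drop (Suc (Suc j)) ts \<in> words T (Suc n)"
    if ts: "ts \<in> words T (Suc (Suc n))" and j: "j \<le> n" for ts j k
  proof -
    define us u v ws where d: "us = take j ts" "u = ts ! j" "v = ts ! Suc j" "ws = drop (Suc (Suc j)) ts"
    have l: "length ts = Suc (Suc n)"
      using ts by (rule words_length)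
    have t: "ts = us @ u # v # ws"
      unfolding d using l j by (metis Cons_nth_drop_Suc id_take_nth_drop le_imp_less_Suc less_SucI Suc_less_eq)
    have lus: "length us = j" "length us + Suc (length ws) = Suc n"
      using l j by (simp_all add: d)
    have "u \<triangleleft>\<^bsub>AA\<^esub> counit A v \<in> carrier T"
      using ts t by (auto simp: words_def intro!: ract_T_closed counit_closed)
    then have "us @ (u \<triangleleft>\<^bsub>AA\<^esub> counit A v) # ws \<in> words T (Suc n)"
      using ts lus t by (auto simp: words_def)
    then show "take j ts @ [ts ! j \<triangleleft>\<^bsub>AA\<^esub> counit A (ts ! Suc j)] @ drop (Suc (Suc j)) ts \<in> words T (Suc n)"
      by (simp add: d)
    have "sweedler P \<psi> (us @ (u \<triangleleft>\<^bsub>AA\<^esub> counit A v) # ws) = sweedler P (\<lambda>ps. \<psi> (merge_pairs A (length us) ps)) ts"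
      using sweedler_counit[OF P_group, of us ws \<psi> u v "Suc (Suc n)"] bal ts lus t by simp
    moreover have "[k] \<cdot>\<^bsub>P\<^esub> sweedler P (\<lambda>ps. \<psi> (merge_pairs A j ps)) ts
        = sweedler P (\<lambda>ps. [k] \<cdot>\<^bsub>P\<^esub> \<psi> (merge_pairs A j ps)) ts"
      by (rule sweedler_hom[OF P_group P_group P.int_pow_add_hom ts mid[OF _ j]])
    ultimately show "[(k::int)] \<cdot>\<^bsub>P\<^esub> sweedler P \<psi> (take j ts @ [ts ! j \<triangleleft>\<^bsub>AA\<^esub> counit A (ts ! Suc j)] @ drop (Suc (Suc j)) ts)
      = sweedler P (\<lambda>ps. [k] \<cdot>\<^bsub>P\<^esub> \<psi> (merge_pairs A j ps)) ts"
      using lus by (simp add: d)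
  qed
  have "coring_d A B P n g X = tensor_lift P (\<lambda>ts.
          counit A (hd ts) \<triangleright>\<^bsub>P\<^esub> g (dt_pure A B (tl ts))
          \<oplus>\<^bsub>P\<^esub> (\<Oplus>\<^bsub>P\<^esub>i\<in>{2..n + 1}. [((-1) ^ (i + 1) :: int)] \<cdot>\<^bsub>P\<^esub>
                 g (dt_pure A B
                     (take (i - 2) ts
                       @ [ts ! (i - 2) \<triangleleft>\<^bsub>dt_bimodule A B\<^esub> counit A (ts ! (i - 1))]
                       @ drop i ts)))
          \<oplus>\<^bsub>P\<^esub> [((-1) ^ (n + 3) :: int)] \<cdot>\<^bsub>P\<^esub>
                 (g (dt_pure A B (butlast ts)) \<triangleleft>\<^bsub>P\<^esub> counit A (last ts))) X"
    using X by (simp add: coring_d_def)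
  also have "\<dots> = sweedler_lift (coboundary n \<psi>) X"
    unfolding sweedler_lift_def
  proof (rule T.tensor_lift_cong[OF P_group X, symmetric])
    fix ts assume "ts \<in> words T (n + 2)"
    then have ts: "ts \<in> words T (Suc (Suc n))"
      by simp
    show "sweedler P (coboundary n \<psi>) ts \<in> carrier P"
      unfolding coboundary_def
      by (rule sc[OF ts]) (intro P.a_closed P.finsum_closed mid' P.add.int_pow_closed mid first order.refl)
    obtain u us where t: "ts = u # us" "u \<in> carrier T" "us \<in> words T (Suc n)"
      using ts by (rule words_SucE)
    have "sweedler P (coboundary n \<psi>) ts
        = sweedler P (\<lambda>ps. \<psi> (lact_pairs A (fst (hd ps) \<otimes> snd (hd ps)) (tl ps))) ts
        \<oplus>\<^bsub>P\<^esub> (\<Oplus>\<^bsub>P\<^esub>i\<in>{2..n + 1}. sweedler P (\<lambda>ps. [((-1) ^ (i + 1) :: int)] \<cdot>\<^bsub>P\<^esub> \<psi> (merge_pairs A (i - 2) ps)) ts)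
        \<oplus>\<^bsub>P\<^esub> sweedler P (\<lambda>ps. [((-1) ^ (n + 3) :: int)] \<cdot>\<^bsub>P\<^esub> \<psi> (merge_pairs A n ps)) ts"
    proof -
      let ?f = "\<lambda>ps. \<psi> (lact_pairs A (fst (hd ps) \<otimes> snd (hd ps)) (tl ps))"
      let ?g = "\<lambda>i ps. [((-1) ^ (i + 1) :: int)] \<cdot>\<^bsub>P\<^esub> \<psi> (merge_pairs A (i - 2) ps)"
      let ?G = "\<lambda>ps. \<Oplus>\<^bsub>P\<^esub>i\<in>{2..n + 1}. ?g i ps"
      let ?h = "\<lambda>ps. [((-1) ^ (n + 3) :: int)] \<cdot>\<^bsub>P\<^esub> \<psi> (merge_pairs A n ps)"
      have G: "?G ps \<in> carrier P" if "ps \<in> pair_words A (Suc (Suc n))" for ps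
        by (rule P.finsum_closed[OF mid'[OF that]])
      have h: "?h ps \<in> carrier P" if "ps \<in> pair_words A (Suc (Suc n))" for ps
        using mid[OF that] by simp
      have "sweedler P (\<lambda>ps. ?f ps \<oplus>\<^bsub>P\<^esub> ?G ps \<oplus>\<^bsub>P\<^esub> ?h ps) ts
          = sweedler P (\<lambda>ps. ?f ps \<oplus>\<^bsub>P\<^esub> ?G ps) ts \<oplus>\<^bsub>P\<^esub> sweedler P ?h ts"
        by (rule sweedler_add[OF P_group ts]) (use G h first in blast)+
      moreover have "sweedler P (\<lambda>ps. ?f ps \<oplus>\<^bsub>P\<^esub> ?G ps) ts = sweedler P ?f ts \<oplus>\<^bsub>P\<^esub> sweedler P ?G ts"
        by (rule sweedler_add[OF P_group ts first G])
      moreover have "sweedler P ?G ts = (\<Oplus>\<^bsub>P\<^esub>i\<in>{2..n + 1}. sweedler P (?g i) ts)"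
        by (rule sweedler_finsum[OF P_group ts]) (use mid' in blast)+
      ultimately show ?thesis
        unfolding coboundary_def by (simp only:)
    qed
    also have "sweedler P (\<lambda>ps. \<psi> (lact_pairs A (fst (hd ps) \<otimes> snd (hd ps)) (tl ps))) ts
        = counit A (hd ts) \<triangleright>\<^bsub>P\<^esub> g (dt_pure A B (tl ts))"
      using sweedler_counit_first[OF \<psi> t(2,3)] by (simp add: t(1) gp[OF t(3)])
    also have "(\<Oplus>\<^bsub>P\<^esub>i\<in>{2..n + 1}. sweedler P (\<lambda>ps. [((-1) ^ (i + 1) :: int)] \<cdot>\<^bsub>P\<^esub> \<psi> (merge_pairs A (i - 2) ps)) ts)
        = (\<Oplus>\<^bsub>P\<^esub>i\<in>{2..n + 1}. [((-1) ^ (i + 1) :: int)] \<cdot>\<^bsub>P\<^esub>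
                 g (dt_pure A B
                     (take (i - 2) ts
                       @ [ts ! (i - 2) \<triangleleft>\<^bsub>dt_bimodule A B\<^esub> counit A (ts ! (i - 1))]
                       @ drop i ts)))"
    proof (rule P.finsum_cong')
      have "[(k::int)] \<cdot>\<^bsub>P\<^esub> g (dt_pure A B (take (i - 2) ts
              @ [ts ! (i - 2) \<triangleleft>\<^bsub>dt_bimodule A B\<^esub> counit A (ts ! (i - 1))] @ drop i ts))
          = sweedler P (\<lambda>ps. [k] \<cdot>\<^bsub>P\<^esub> \<psi> (merge_pairs A (i - 2) ps)) ts" if "i \<in> {2..n + 1}" for i k
      proof -
        define j where "j = i - 2"
        have j: "j \<le> n" "i = Suc (Suc j)"
          using that by (auto simp: j_def)
        show ?thesis
          using mid_sw[OF ts j(1), of k] gp[OF mid_cl[OF ts j(1)]] by (simp add: j(2))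
      qed
      then show "sweedler P (\<lambda>ps. [((-1) ^ (i + 1) :: int)] \<cdot>\<^bsub>P\<^esub> \<psi> (merge_pairs A (i - 2) ps)) ts
          = [((-1) ^ (i + 1) :: int)] \<cdot>\<^bsub>P\<^esub> g (dt_pure A B (take (i - 2) ts
              @ [ts ! (i - 2) \<triangleleft>\<^bsub>dt_bimodule A B\<^esub> counit A (ts ! (i - 1))] @ drop i ts))"
        if "i \<in> {2..n + 1}" for i
        using that by simp
      show "(\<lambda>i. [((-1) ^ (i + 1) :: int)] \<cdot>\<^bsub>P\<^esub> g (dt_pure A B (take (i - 2) ts
              @ [ts ! (i - 2) \<triangleleft>\<^bsub>dt_bimodule A B\<^esub> counit A (ts ! (i - 1))] @ drop i ts)))
          \<in> {2..n + 1} \<rightarrow> carrier P"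
      proof
        fix i assume i: "i \<in> {2..n + 1}"
        define j where "j = i - 2"
        have j: "j \<le> n" "i = Suc (Suc j)"
          using i by (auto simp: j_def)
        have "g (dt_pure A B (take (i - 2) ts
              @ [ts ! (i - 2) \<triangleleft>\<^bsub>dt_bimodule A B\<^esub> counit A (ts ! (i - 1))] @ drop i ts)) \<in> carrier P"
          using sc[OF mid_cl[OF ts j(1)] cl] gp[OF mid_cl[OF ts j(1)]] by (simp add: j(2))
        then show "[((-1) ^ (i + 1) :: int)] \<cdot>\<^bsub>P\<^esub> g (dt_pure A B (take (i - 2) ts
              @ [ts ! (i - 2) \<triangleleft>\<^bsub>dt_bimodule A B\<^esub> counit A (ts ! (i - 1))] @ drop i ts)) \<in> carrier P"
          by (rule P.add.int_pow_closed)
      qed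
    qed simp
    also have "sweedler P (\<lambda>ps. [((-1) ^ (n + 3) :: int)] \<cdot>\<^bsub>P\<^esub> \<psi> (merge_pairs A n ps)) ts
        = [((-1) ^ (n + 3) :: int)] \<cdot>\<^bsub>P\<^esub> (g (dt_pure A B (butlast ts)) \<triangleleft>\<^bsub>P\<^esub> counit A (last ts))"
    proof -
      have l: "length ts = Suc (Suc n)"
        using ts by (rule words_length)
      have bl: "butlast ts \<in> words T (Suc n)"
        using ts by (auto simp: words_def dest: in_set_butlastD)
      have "last ts \<in> carrier T"
        using ts by (cases ts rule: rev_cases) (auto simp: words_def)
      note c = counit_closed[OF this]
      \<comment> \<open>The right action of the last counit on the tensor before it is the
        contraction at position \<open>n\<close>.\<close>
      have e: "butlast (butlast ts) @ [last (butlast ts) \<triangleleft>\<^bsub>AA\<^esub> counit A (last ts)]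
        = take n ts @ [ts ! n \<triangleleft>\<^bsub>AA\<^esub> counit A (ts ! Suc n)] @ drop (Suc (Suc n)) ts"
      proof -
        have "butlast ts \<noteq> []" "ts \<noteq> []"
          using l by (auto simp flip: length_greater_0_conv)
        then show ?thesis
          using l by (simp add: last_conv_nth nth_butlast butlast_conv_take min_def)
      qed
      show ?thesis
        using mid_sw[OF ts order.refl, of "(-1) ^ (n + 3)"]
        unfolding e[symmetric] sweedler_equivariant_ract[OF \<psi> bl c] gp[OF bl] by (rule sym)
    qed
    finally show "sweedler P (coboundary n \<psi>) ts =
          counit A (hd ts) \<triangleright>\<^bsub>P\<^esub> g (dt_pure A B (tl ts))
          \<oplus>\<^bsub>P\<^esub> (\<Oplus>\<^bsub>P\<^esub>i\<in>{2..n + 1}. [((-1) ^ (i + 1) :: int)] \<cdot>\<^bsub>P\<^esub>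
                 g (dt_pure A B
                     (take (i - 2) ts
                       @ [ts ! (i - 2) \<triangleleft>\<^bsub>dt_bimodule A B\<^esub> counit A (ts ! (i - 1))]
                       @ drop i ts)))
          \<oplus>\<^bsub>P\<^esub> [((-1) ^ (n + 3) :: int)] \<cdot>\<^bsub>P\<^esub>
                 (g (dt_pure A B (butlast ts)) \<triangleleft>\<^bsub>P\<^esub> counit A (last ts))" .
  qed
  finally show ?thesis .
qed

end

section \<open>The homotopy\<close>

context irreducible_extension_bimodule
begin

lemma hochschild_hom:
  "h \<in> carrier (hochschild_cochains A B P n) \<Longrightarrow> h \<in> hom (add_monoid (tensor_group B (regular A) n)) (add_monoid P)"
  by (simp add: hochschild_cochains_def hom_module_def bimodule_hom_def hom_def)

lemma hochschild_multiadditive: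
  "h \<in> carrier (hochschild_cochains A B P n) \<Longrightarrow> multiadditive B (regular A) P n (\<lambda>ws. h (tens ws))"
  by (rule multiadditive_hom[OF reg.multiadditive_pure_tensor hochschild_hom])

lemma hochschild_lact:
  assumes "h \<in> carrier (hochschild_cochains A B P n)" "0 < n" "b \<in> B" "ws \<in> words (regular A) n"
  shows "h (tens ((b \<otimes> hd ws) # tl ws)) = b \<triangleright>\<^bsub>P\<^esub> h (tens ws)"
proof -
  have "h (b \<triangleright>\<^bsub>tensor_power B (regular A) n\<^esub> tens ws) = b \<triangleright>\<^bsub>P\<^esub> h (tens ws)"
    using assms reg.pure_tensor_closed[OF assms(4)]
    by (simp add: hochschild_cochains_def hom_module_def bimodule_hom_def)
  then show ?thesis
    using assms by (simp add: reg.lact_pure_tensor)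
qed

lemma hochschild_ract:
  assumes "h \<in> carrier (hochschild_cochains A B P n)" "0 < n" "b \<in> B" "ws \<in> words (regular A) n"
  shows "h (tens (butlast ws @ [last ws \<otimes> b])) = h (tens ws) \<triangleleft>\<^bsub>P\<^esub> b"
proof -
  have "h (tens ws \<triangleleft>\<^bsub>tensor_power B (regular A) n\<^esub> b) = h (tens ws) \<triangleleft>\<^bsub>P\<^esub> b"
    using assms reg.pure_tensor_closed[OF assms(4)]
    by (simp add: hochschild_cochains_def hom_module_def bimodule_hom_def)
  then show ?thesis
    using assms by (simp add: reg.ract_pure_tensor)
qed

section \<open>The Hochschild differential on words\<close>

text \<open>The formula inside \<open>hochschild_d\<close>, with the inner products written as
  recursive faces.\<close>

definition word_coboundary :: "nat \<Rightarrow> ('a list \<Rightarrow> 'p) \<Rightarrow> 'a list \<Rightarrow> 'p" where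
  "word_coboundary n \<phi> xs = hd xs \<triangleright>\<^bsub>P\<^esub> \<phi> (tl xs)
     \<oplus>\<^bsub>P\<^esub> (\<Oplus>\<^bsub>P\<^esub>i\<in>{1..n}. [((-1) ^ i :: int)] \<cdot>\<^bsub>P\<^esub> \<phi> (merge_word A (i - 1) xs))
     \<oplus>\<^bsub>P\<^esub> [((-1) ^ (n + 1) :: int)] \<cdot>\<^bsub>P\<^esub> (\<phi> (butlast xs) \<triangleleft>\<^bsub>P\<^esub> last xs)"

text \<open>Balancedness between the first two letters is left linearity of \<open>h\<close> over
  \<open>B\<close>: \<open>(x s) h(y ...) = x h(s y ...)\<close>.\<close>

lemma multiadditive_lact_tl:
  assumes h: "h \<in> carrier (hochschild_cochains A B P n)" and "0 < n"
  shows "multiadditive B (regular A) P (Suc n) (\<lambda>xs. hd xs \<triangleright>\<^bsub>P\<^esub> h (tens (tl xs)))"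
  unfolding multiadditive_Suc[of _ _ _ n]
proof (intro conjI ballI allI impI)
  note \<phi> = hochschild_multiadditive[OF h]
  note cl = multiadditive_closed[OF \<phi>]
  fix x assume "x \<in> carrier (regular A)"
  then show "multiadditive B (regular A) P n (\<lambda>ws. hd (x # ws) \<triangleright>\<^bsub>P\<^esub> h (tens (tl (x # ws))))"
    using multiadditive_hom[OF \<phi> lact_hom] by simp
  fix y ws assume "y \<in> carrier (regular A)" "ws \<in> words (regular A) n"
  with \<open>x \<in> _\<close> show "hd ((x \<oplus>\<^bsub>regular A\<^esub> y) # ws) \<triangleright>\<^bsub>P\<^esub> h (tens (tl ((x \<oplus>\<^bsub>regular A\<^esub> y) # ws))) =
      hd (x # ws) \<triangleright>\<^bsub>P\<^esub> h (tens (tl (x # ws))) \<oplus>\<^bsub>P\<^esub> hd (y # ws) \<triangleright>\<^bsub>P\<^esub> h (tens (tl (y # ws)))"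
    using cl by (simp add: P.lact_add_left)
next
  note cl = multiadditive_closed[OF hochschild_multiadditive[OF h]]
  fix x s y ws assume "x \<in> carrier (regular A)" "s \<in> B" "y # ws \<in> words (regular A) n"
  then show "hd ((x \<triangleleft>\<^bsub>regular A\<^esub> s) # y # ws) \<triangleright>\<^bsub>P\<^esub> h (tens (tl ((x \<triangleleft>\<^bsub>regular A\<^esub> s) # y # ws))) =
      hd (x # (s \<triangleright>\<^bsub>regular A\<^esub> y) # ws) \<triangleright>\<^bsub>P\<^esub> h (tens (tl (x # (s \<triangleright>\<^bsub>regular A\<^esub> y) # ws)))"
    using cl hochschild_lact[OF h assms(2), of s "y # ws"] by (simp add: P.lact_assoc)
qed

text \<open>The formula singles out the last letter, which peeling off first letters does not reach.
  Instead each relation is split according to whether it touches the last letter; if it does,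
  additivity comes from the right action on \<open>P\<close> and balancedness from right linearity
  of \<open>h\<close>.\<close>

lemma multiadditive_ract_butlast:
  assumes h: "h \<in> carrier (hochschild_cochains A B P n)" and "0 < n"
  shows "multiadditive B (regular A) P (Suc n) (\<lambda>xs. h (tens (butlast xs)) \<triangleleft>\<^bsub>P\<^esub> last xs)"
  unfolding multiadditive_def
proof (intro conjI allI impI)
  note \<phi> = hochschild_multiadditive[OF h]
  note cl = multiadditive_closed[OF \<phi>]
  show "(\<lambda>xs. h (tens (butlast xs)) \<triangleleft>\<^bsub>P\<^esub> last xs) \<in> words (regular A) (Suc n) \<rightarrow> carrier P"
  proof
    fix ws assume "ws \<in> words (regular A) (Suc n)"
    then show "h (tens (butlast ws)) \<triangleleft>\<^bsub>P\<^esub> last ws \<in> carrier P"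
      by (cases ws rule: rev_cases) (auto simp: words_def intro!: P.ract_closed cl)
  qed
next
  note \<phi> = hochschild_multiadditive[OF h]
  note cl = multiadditive_closed[OF \<phi>]
  fix us x y vs assume w: "us @ x # vs \<in> words (regular A) (Suc n)" "y \<in> carrier (regular A)"
  show "h (tens (butlast (us @ (x \<oplus>\<^bsub>regular A\<^esub> y) # vs))) \<triangleleft>\<^bsub>P\<^esub> last (us @ (x \<oplus>\<^bsub>regular A\<^esub> y) # vs) =
      h (tens (butlast (us @ x # vs))) \<triangleleft>\<^bsub>P\<^esub> last (us @ x # vs) \<oplus>\<^bsub>P\<^esub>
      h (tens (butlast (us @ y # vs))) \<triangleleft>\<^bsub>P\<^esub> last (us @ y # vs)"
  proof (cases vs rule: rev_cases)
    case Nil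
    then show ?thesis
      using w cl[of us] by (simp add: words_def butlast_append P.ract_add_right)
  next
    case (snoc vs' z)
    then have "us @ x # vs' \<in> words (regular A) n" "us @ y # vs' \<in> words (regular A) n" "z \<in> carrier A"
      using w by (auto simp: words_def)
    moreover from this have "h (tens (us @ (x \<oplus> y) # vs')) = h (tens (us @ x # vs')) \<oplus>\<^bsub>P\<^esub> h (tens (us @ y # vs'))"
      using \<phi> w(2) by (simp add: multiadditive_def)
    ultimately show ?thesis
      using cl by (simp add: snoc butlast_append P.ract_add_left)
  qed
next
  note \<phi> = hochschild_multiadditive[OF h]
  note cl = multiadditive_closed[OF \<phi>]
  fix us x s y vs assume w: "us @ x # y # vs \<in> words (regular A) (Suc n)" "s \<in> B"
  show "h (tens (butlast (us @ (x \<triangleleft>\<^bsub>regular A\<^esub> s) # y # vs))) \<triangleleft>\<^bsub>P\<^esub> last (us @ (x \<triangleleft>\<^bsub>regular A\<^esub> s) # y # vs) =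
      h (tens (butlast (us @ x # (s \<triangleright>\<^bsub>regular A\<^esub> y) # vs))) \<triangleleft>\<^bsub>P\<^esub> last (us @ x # (s \<triangleright>\<^bsub>regular A\<^esub> y) # vs)"
  proof (cases vs rule: rev_cases)
    case Nil
    then have "us @ [x] \<in> words (regular A) n" "y \<in> carrier A"
      using w by (auto simp: words_def)
    then show ?thesis
      using hochschild_ract[OF h assms(2) w(2), of "us @ [x]"] w(2) cl
      by (simp add: Nil butlast_append P.ract_assoc)
  next
    case (snoc vs' z)
    then have "us @ x # y # vs' \<in> words (regular A) n"
      using w by (auto simp: words_def)
    then have "h (tens (us @ (x \<otimes> s) # y # vs')) = h (tens (us @ x # (s \<otimes> y) # vs'))"
      using \<phi> w(2) by (simp add: multiadditive_def)
    then show ?thesis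
      by (simp add: snoc butlast_append)
  qed
qed

lemma multiadditive_word_coboundary:
  assumes h: "h \<in> carrier (hochschild_cochains A B P n)" and n: "0 < n"
  shows "multiadditive B (regular A) P (Suc n) (word_coboundary n (\<lambda>ws. h (tens ws)))"
proof -
  obtain m where m: "n = Suc m"
    using n by (cases n) auto
  have "multiadditive B (regular A) P (Suc n) (\<lambda>xs. h (tens (merge_word A (i - 1) xs)))" if "i \<in> {1..n}" for i
    using multiadditive_merge_word[of P m "\<lambda>ws. h (tens ws)" "i - 1"] hochschild_multiadditive[OF h] that
    by (auto simp: m)
  then show ?thesis
    unfolding word_coboundary_def
    by (intro multiadditive_add[OF P_group] reg.multiadditive_finsum[OF P_group]
        multiadditive_hom[OF _ P.int_pow_add_hom] multiadditive_lact_tl[OF h n]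
        multiadditive_ract_butlast[OF h n]) auto
qed

text \<open>The homotopy evaluates \<open>d h\<close> at a pure tensor, whose chosen representative
  is unknown; here balancedness of the formula is essential.\<close>

lemma hochschild_d_pure:
  assumes h: "h \<in> carrier (hochschild_cochains A B P n)" and n: "0 < n"
    and ws: "ws \<in> words (regular A) (n + 1)"
  shows "hochschild_d A B P n h (tens ws) = word_coboundary n (\<lambda>ws. h (tens ws)) ws"
proof -
  note m = multiadditive_word_coboundary[OF h n]
  note cl = multiadditive_closed[OF hochschild_multiadditive[OF h]]
  obtain m where nm: "n = Suc m"
    using n by (cases n) auto
  have X: "tens ws \<in> carrier (tensor_group B (regular A) (Suc n))"
    using reg.pure_tensor_closed[OF ws] by simp
  have "hochschild_d A B P n h (tens ws) = tensor_lift P (\<lambda>xs.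
          hd xs \<triangleright>\<^bsub>P\<^esub> h (pure_tensor B (regular A) (tl xs))
          \<oplus>\<^bsub>P\<^esub> (\<Oplus>\<^bsub>P\<^esub>i\<in>{1..n}. [((-1) ^ i :: int)] \<cdot>\<^bsub>P\<^esub>
                 h (pure_tensor B (regular A)
                     (take (i - 1) xs @ [xs ! (i - 1) \<otimes>\<^bsub>A\<^esub> xs ! i] @ drop (i + 1) xs)))
          \<oplus>\<^bsub>P\<^esub> [((-1) ^ (n + 1) :: int)] \<cdot>\<^bsub>P\<^esub>
                 (h (pure_tensor B (regular A) (butlast xs)) \<triangleleft>\<^bsub>P\<^esub> last xs)) (tens ws)"
    using X by (simp add: hochschild_d_def)
  also have "\<dots> = tensor_lift P (word_coboundary n (\<lambda>ws. h (tens ws))) (tens ws)"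
  proof (rule reg.tensor_lift_cong[OF P_group X, symmetric])
    fix xs assume xs: "xs \<in> words (regular A) (Suc n)"
    show "word_coboundary n (\<lambda>ws. h (tens ws)) xs \<in> carrier P"
      by (rule multiadditive_closed[OF m xs])
    have e: "take (i - 1) xs @ [xs ! (i - 1) \<otimes> xs ! i] @ drop (i + 1) xs = merge_word A (i - 1) xs"
      if "i \<in> {1..n}" for i
      using merge_word_eq[of "i - 1" xs A] that words_length[OF xs] by (cases i) auto
    have "(\<Oplus>\<^bsub>P\<^esub>i\<in>{1..n}. [((-1) ^ i :: int)] \<cdot>\<^bsub>P\<^esub> h (tens (merge_word A (i - 1) xs)))
      = (\<Oplus>\<^bsub>P\<^esub>i\<in>{1..n}. [((-1) ^ i :: int)] \<cdot>\<^bsub>P\<^esub>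
          h (tens (take (i - 1) xs @ [xs ! (i - 1) \<otimes>\<^bsub>A\<^esub> xs ! i] @ drop (i + 1) xs)))"
    proof (rule P.finsum_cong')
      have "h (tens (merge_word A (i - 1) xs)) \<in> carrier P" if "i \<in> {1..n}" for i
        using merge_word_closed[of "i - 1" m xs] xs that nm by (auto intro!: cl)
      then show "(\<lambda>i. [((-1) ^ i :: int)] \<cdot>\<^bsub>P\<^esub> h (tens (take (i - 1) xs @ [xs ! (i - 1) \<otimes>\<^bsub>A\<^esub> xs ! i] @ drop (i + 1) xs)))
          \<in> {1..n} \<rightarrow> carrier P"
        using e by auto
    qed (use e in auto)
    then show "word_coboundary n (\<lambda>ws. h (tens ws)) xs = hd xs \<triangleright>\<^bsub>P\<^esub> h (tens (tl xs))
          \<oplus>\<^bsub>P\<^esub> (\<Oplus>\<^bsub>P\<^esub>i\<in>{1..n}. [((-1) ^ i :: int)] \<cdot>\<^bsub>P\<^esub>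
                 h (tens (take (i - 1) xs @ [xs ! (i - 1) \<otimes>\<^bsub>A\<^esub> xs ! i] @ drop (i + 1) xs)))
          \<oplus>\<^bsub>P\<^esub> [((-1) ^ (n + 1) :: int)] \<cdot>\<^bsub>P\<^esub> (h (tens (butlast xs)) \<triangleleft>\<^bsub>P\<^esub> last xs)"
      by (simp only: word_coboundary_def)
  qed
  also have "\<dots> = word_coboundary n (\<lambda>ws. h (tens ws)) ws"
    using ws by (intro reg.tensor_lift_pure[OF P_group m]) simp
  finally show ?thesis .
qed

section \<open>The homotopy operator\<close>

text \<open>On a pair, the counit of the extra term is still the product of the two entries;
  summation over representatives makes it \<open>\<epsilon>(u)\<close>.\<close>

definition homotopy_kernel :: "nat \<Rightarrow> ('a tensors \<Rightarrow> 'p) \<Rightarrow> ('a \<times> 'a) list \<Rightarrow> 'p" where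
  "homotopy_kernel n h ps = h (tens (weave A ps)) \<oplus>\<^bsub>P\<^esub>
     (if n = 0 then (fst (hd ps) \<otimes> snd (hd ps)) \<triangleright>\<^bsub>P\<^esub> h (tens [\<one>, \<one>]) else \<zero>\<^bsub>P\<^esub>)"

definition homotopy :: "nat \<Rightarrow> ('a tensors \<Rightarrow> 'p) \<Rightarrow> 'a tensors tensors \<Rightarrow> 'p" where
  "homotopy n h = (\<lambda>X\<in>carrier (dt_power A B (n + 1)). sweedler_lift (homotopy_kernel n h) X)"

text \<open>Only the values of \<open>h\<close> on pure tensors are constrained, so that
  \<open>h\<close> can be a Hochschild coboundary without first being shown to be a cochain.\<close>

lemma homotopy_kernel_closed:
  assumes "\<And>ws. ws \<in> words (regular A) (n + 2) \<Longrightarrow> h (tens ws) \<in> carrier P"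
    and "ps \<in> pair_words A (Suc n)"
  shows "homotopy_kernel n h ps \<in> carrier P"
  using assms weave_closed[OF assms(2)]
  by (auto simp: homotopy_kernel_def elim!: pair_words_SucE intro!: P.lact_closed)

text \<open>The tensor of two units commutes with \<open>B\<close>: by balancedness \<open>b\<close>
  can be moved from the first factor to the second.\<close>

lemma unit_value_invariant:
  assumes h: "h \<in> carrier (hochschild_cochains A B P 2)" and b: "b \<in> B"
  shows "b \<triangleright>\<^bsub>P\<^esub> h (tens [\<one>, \<one>]) = h (tens [\<one>, \<one>]) \<triangleleft>\<^bsub>P\<^esub> b"
proof -
  have w: "[\<one>, \<one>] \<in> words (regular A) 2"
    by (simp add: numeral_2_eq_2)
  \<comment> \<open>The unit laws are held back in the simplification, as they would destroy the
    shape to which balancedness applies.\<close>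
  have "h (tens [\<one> \<otimes> b, \<one>]) = h (tens [\<one>, b \<otimes> \<one>])"
    using hochschild_multiadditive[OF h] b by (simp add: numeral_2_eq_2 multiadditive_Suc del: r_one l_one)
  then show ?thesis
    using hochschild_lact[OF h _ b w] hochschild_ract[OF h _ b w] b by simp
qed

lemma equivariant_homotopy_kernel:
  assumes h: "h \<in> carrier (hochschild_cochains A B P (n + 2))"
  shows "equivariant (Suc n) (homotopy_kernel n h)"
proof -
  have \<phi>: "multiadditive B (regular A) P (Suc (Suc n)) (\<lambda>ws. h (tens ws))"
    using hochschild_multiadditive[OF h] by simp
  note cl = multiadditive_closed[OF \<phi>]
  have w: "pair_balanced A B P (Suc n) (\<lambda>ps. h (tens (weave A ps)))"
    by (rule pair_balanced_weave[OF \<phi>])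
  have ne: "ps \<noteq> []" if "ps \<in> pair_words A (Suc n)" for ps
    using that by (auto simp: pair_words_def)
  have wl: "h (tens (weave A (lact_pairs A b ps))) = b \<triangleright>\<^bsub>P\<^esub> h (tens (weave A ps))"
    "h (tens (weave A (ract_pairs A ps b))) = h (tens (weave A ps)) \<triangleleft>\<^bsub>P\<^esub> b"
    if "b \<in> B" "ps \<in> pair_words A (Suc n)" for b ps
    using hochschild_lact[OF h _ that(1), of "weave A ps"] hochschild_ract[OF h _ that(1), of "weave A ps"]
      weave_closed[OF that(2)]
    by (simp_all add: weave_lact[OF ne[OF that(2)]] weave_ract[OF ne[OF that(2)]])
  note wcl = cl[OF weave_closed]
  show ?thesis
  proof (cases n)
    case (Suc m)
    have eq: "homotopy_kernel n h ps = h (tens (weave A ps))" if "ps \<in> pair_words A (Suc n)" for ps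
      using wcl[OF that] by (simp add: homotopy_kernel_def Suc)
    show ?thesis
      unfolding equivariant_def
    proof (intro conjI ballI)
      show "pair_balanced A B P (Suc n) (homotopy_kernel n h)"
        by (rule pair_balanced_cong[OF w eq[symmetric]])
    qed (simp_all add: eq wl)
  next
    case 0
    let ?p = "h (tens [\<one>, \<one>])"
    have p: "?p \<in> carrier P"
      using 0 by (intro cl) simp
    have inv: "b \<triangleright>\<^bsub>P\<^esub> ?p = ?p \<triangleleft>\<^bsub>P\<^esub> b" if "b \<in> B" for b
      using unit_value_invariant[of h b] h that 0 by (simp add: numeral_2_eq_2)
    have K: "homotopy_kernel n h [(x, y)] = h (tens [x, y]) \<oplus>\<^bsub>P\<^esub> (x \<otimes> y) \<triangleright>\<^bsub>P\<^esub> ?p" for x y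
      by (simp add: homotopy_kernel_def 0)
    have c: "h (tens [x, y]) \<in> carrier P" "(x \<otimes> y) \<triangleright>\<^bsub>P\<^esub> ?p \<in> carrier P"
      if "x \<in> carrier A" "y \<in> carrier A" for x y
      using that cl[of "[x, y]"] p 0 by (simp_all add: P.lact_closed)
    have bal: "pair_balanced A B P (Suc n) (homotopy_kernel n h)"
      using w p c unfolding 0 pair_balanced.simps
      by (auto simp: K[unfolded 0] l_distr r_distr P.lact_add_left m_assoc P.a_ac P.lact_closed)
    have "homotopy_kernel n h (lact_pairs A b [(x, y)]) = b \<triangleright>\<^bsub>P\<^esub> homotopy_kernel n h [(x, y)]"
      if "b \<in> B" "x \<in> carrier A" "y \<in> carrier A" for b x y
      using that wl(1)[of b "[(x, y)]"] c p
      by (simp add: 0 K[unfolded 0] P.lact_add_right m_assoc P.lact_assoc)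
    moreover have "homotopy_kernel n h (ract_pairs A [(x, y)] b) = homotopy_kernel n h [(x, y)] \<triangleleft>\<^bsub>P\<^esub> b"
      if "b \<in> B" "x \<in> carrier A" "y \<in> carrier A" for b x y
    proof -
      \<comment> \<open>This is where \<open>?p\<close> has to commute with \<open>b\<close>: the
        factor enters to the left of \<open>?p\<close> and must come out on the right.\<close>
      have "(x \<otimes> (y \<otimes> b)) \<triangleright>\<^bsub>P\<^esub> ?p = ((x \<otimes> y) \<triangleright>\<^bsub>P\<^esub> ?p) \<triangleleft>\<^bsub>P\<^esub> b"
        using that p by (simp add: m_assoc[symmetric] P.lact_assoc[of "x \<otimes> y" b] inv P.lact_ract)
      then show ?thesis
        using that wl(2)[of b "[(x, y)]"] c
        by (simp add: 0 K[unfolded 0] P.ract_add_left ract_pairs_def)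
    qed
    ultimately show ?thesis
      using bal by (auto simp: equivariant_def 0 elim!: pair_words_SucE)
  qed
qed

lemma homotopy_cochain:
  "h \<in> carrier (hochschild_cochains A B P (n + 2)) \<Longrightarrow> homotopy n h \<in> carrier (coring_cochains A B P n)"
  unfolding homotopy_def by (rule sweedler_lift_cochain[OF equivariant_homotopy_kernel])

lemma homotopy_kernel_cochain_closed:
  assumes "h \<in> carrier (hochschild_cochains A B P (n + 2))" "ps \<in> pair_words A (Suc n)"
  shows "homotopy_kernel n h ps \<in> carrier P"
  using pair_balanced_closed equivariant_homotopy_kernel[OF assms(1)] assms(2)
  unfolding equivariant_def by blast

lemma homotopy_additive:
  assumes f: "f \<in> carrier (hochschild_cochains A B P (n + 2))" and g: "g \<in> carrier (hochschild_cochains A B P (n + 2))"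
  shows "homotopy n (f \<oplus>\<^bsub>hochschild_cochains A B P (n + 2)\<^esub> g) = homotopy n f \<oplus>\<^bsub>coring_cochains A B P n\<^esub> homotopy n g"
proof
  fix X
  let ?h = "f \<oplus>\<^bsub>hochschild_cochains A B P (n + 2)\<^esub> g"
  note cl = multiadditive_closed[OF hochschild_multiadditive]
  have h: "?h (tens ws) = f (tens ws) \<oplus>\<^bsub>P\<^esub> g (tens ws)" if "ws \<in> words (regular A) (n + 2)" for ws
    using reg.pure_tensor_closed[OF that] by (simp add: hochschild_cochains_def hom_module_def)
  have k: "homotopy_kernel n ?h ps = homotopy_kernel n f ps \<oplus>\<^bsub>P\<^esub> homotopy_kernel n g ps"
    if "ps \<in> pair_words A (Suc n)" for ps
  proof -
    have "fst (hd ps) \<otimes> snd (hd ps) \<in> carrier A"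
      using that by (auto elim!: pair_words_SucE)
    then show ?thesis
      using weave_closed[OF that] cl[OF f] cl[OF g] h[of "weave A ps"] h[of "[\<one>, \<one>]"]
      by (cases "n = 0") (simp_all add: homotopy_kernel_def P.a_ac P.lact_add_right P.lact_closed)
  qed
  note kcl = homotopy_kernel_cochain_closed
  show "homotopy n ?h X = (homotopy n f \<oplus>\<^bsub>coring_cochains A B P n\<^esub> homotopy n g) X"
  proof (cases "X \<in> carrier (tensor_group R T (Suc n))")
    case True
    have "sweedler_lift (homotopy_kernel n ?h) X
        = sweedler_lift (\<lambda>ps. homotopy_kernel n f ps \<oplus>\<^bsub>P\<^esub> homotopy_kernel n g ps) X"
      by (rule sweedler_lift_cong[OF True, symmetric]) (use k kcl[OF f] kcl[OF g] in auto)
    also have "\<dots> = sweedler_lift (homotopy_kernel n f) X \<oplus>\<^bsub>P\<^esub> sweedler_lift (homotopy_kernel n g) X"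
      by (rule sweedler_lift_add[OF True kcl[OF f] kcl[OF g]])
    finally show ?thesis
      using True by (simp add: homotopy_def coring_cochains_def hom_module_def)
  qed (simp add: homotopy_def coring_cochains_def hom_module_def)
qed

lemma homotopy_smult:
  assumes f: "f \<in> carrier (hochschild_cochains A B P (n + 2))"
    and k: "k \<odot>\<^bsub>A\<^esub> \<one> \<in> carrier A"
    and central: "\<And>x. x \<in> carrier A \<Longrightarrow> (k \<odot>\<^bsub>A\<^esub> \<one>) \<otimes> x = x \<otimes> (k \<odot>\<^bsub>A\<^esub> \<one>)"
  shows "homotopy n (k \<odot>\<^bsub>hochschild_cochains A B P (n + 2)\<^esub> f) = k \<odot>\<^bsub>coring_cochains A B P n\<^esub> homotopy n f"
proof
  fix X
  let ?h = "k \<odot>\<^bsub>hochschild_cochains A B P (n + 2)\<^esub> f" and ?k = "k \<odot>\<^bsub>A\<^esub> \<one>"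
  note cl = multiadditive_closed[OF hochschild_multiadditive]
  have h: "?h (tens ws) = ?k \<triangleright>\<^bsub>P\<^esub> f (tens ws)" if "ws \<in> words (regular A) (n + 2)" for ws
    using reg.pure_tensor_closed[OF that] by (simp add: hochschild_cochains_def hom_module_def)
  have k': "homotopy_kernel n ?h ps = ?k \<triangleright>\<^bsub>P\<^esub> homotopy_kernel n f ps"
    if "ps \<in> pair_words A (Suc n)" for ps
  proof -
    have a: "fst (hd ps) \<otimes> snd (hd ps) \<in> carrier A"
      using that by (auto elim!: pair_words_SucE)
    \<comment> \<open>The extra term multiplies by an element of \<open>A\<close> to the left of the
      scalar, so centrality of \<open>k 1\<close> in \<open>A\<close> is needed to bring the scalar
      to the front.\<close>
    have "(fst (hd ps) \<otimes> snd (hd ps)) \<triangleright>\<^bsub>P\<^esub> (?k \<triangleright>\<^bsub>P\<^esub> f (tens [\<one>, \<one>]))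
        = ?k \<triangleright>\<^bsub>P\<^esub> ((fst (hd ps) \<otimes> snd (hd ps)) \<triangleright>\<^bsub>P\<^esub> f (tens [\<one>, \<one>]))" if "n = 0"
      using a k cl[OF f, of "[\<one>, \<one>]"] that central[OF a] by (simp flip: P.lact_assoc)
    then show ?thesis
      using weave_closed[OF that] cl[OF f] a k add_hom_zero[OF P_group P_group lact_hom[OF k]]
        h[of "weave A ps"] h[of "[\<one>, \<one>]"]
      by (cases "n = 0") (simp_all add: homotopy_kernel_def P.lact_add_right P.lact_closed)
  qed
  note kcl = homotopy_kernel_cochain_closed
  show "homotopy n ?h X = (k \<odot>\<^bsub>coring_cochains A B P n\<^esub> homotopy n f) X"
  proof (cases "X \<in> carrier (tensor_group R T (Suc n))")
    case True
    have "sweedler_lift (homotopy_kernel n ?h) X = sweedler_lift (\<lambda>ps. ?k \<triangleright>\<^bsub>P\<^esub> homotopy_kernel n f ps) X"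
      by (rule sweedler_lift_cong[OF True, symmetric]) (use k k' kcl[OF f] in \<open>auto intro!: P.lact_closed\<close>)
    also have "\<dots> = ?k \<triangleright>\<^bsub>P\<^esub> sweedler_lift (homotopy_kernel n f) X"
      by (rule sweedler_lift_hom[OF True kcl[OF f] lact_hom[OF k]])
    finally show ?thesis
      using True by (simp add: homotopy_def coring_cochains_def hom_module_def)
  qed (simp add: homotopy_def coring_cochains_def hom_module_def)
qed

section \<open>Cancellation of the inner faces\<close>

lemma coboundary_homotopy_kernel:
  assumes h: "h \<in> carrier (hochschild_cochains A B P (n + 2))" and ps: "ps \<in> pair_words A (Suc (Suc n))"
  shows "coboundary n (homotopy_kernel n h) ps = coboundary n (\<lambda>qs. h (tens (weave A qs))) ps"
proof -
  note cl = multiadditive_closed[OF hochschild_multiadditive[OF h]]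
  obtain x y x' y' qs where xy: "ps = (x, y) # (x', y') # qs" "x \<in> carrier A" "y \<in> carrier A"
    "x' \<in> carrier A" "y' \<in> carrier A" "qs \<in> pair_words A n"
    using ps by (auto elim!: pair_words_SucE)
  show ?thesis
  proof (cases n)
    case (Suc m)
    have eq: "homotopy_kernel n h qs = h (tens (weave A qs))" if "qs \<in> pair_words A (Suc n)" for qs
      using cl[of "weave A qs"] weave_closed[OF that] by (simp add: homotopy_kernel_def Suc)
    have c: "h (tens (weave A (merge_pairs A j ps))) \<in> carrier P" if "j \<le> n" for j
      using weave_closed[OF merge_pairs_closed[OF that ps]] cl by simp
    have "(\<Oplus>\<^bsub>P\<^esub>i\<in>{2..n + 1}. [((-1) ^ (i + 1) :: int)] \<cdot>\<^bsub>P\<^esub> homotopy_kernel n h (merge_pairs A (i - 2) ps))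
      = (\<Oplus>\<^bsub>P\<^esub>i\<in>{2..n + 1}. [((-1) ^ (i + 1) :: int)] \<cdot>\<^bsub>P\<^esub> h (tens (weave A (merge_pairs A (i - 2) ps))))"
      by (rule P.finsum_cong') (use c ps in \<open>auto simp: eq\<close>)
    then show ?thesis
      unfolding coboundary_def using eq[of "merge_pairs A n ps"] ps
        eq[of "lact_pairs A (fst (hd ps) \<otimes> snd (hd ps)) (tl ps)"] xy by simp
  next
    case 0
    \<comment> \<open>For \<open>n = 0\<close> only the first and the last face remain. In both the
      extra term multiplies out to \<open>?e\<close>, and the two carry opposite signs.\<close>
    let ?e = "(x \<otimes> y \<otimes> x' \<otimes> y') \<triangleright>\<^bsub>P\<^esub> h (tens [\<one>, \<one>])"
    have a: "h (tens [z, w]) \<in> carrier P" if "z \<in> carrier A" "w \<in> carrier A" for z w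
      using that 0 by (intro cl) simp
    have e: "?e \<in> carrier P"
      using xy a by (simp add: P.lact_closed)
    have i: "[(- 1 :: int)] \<cdot>\<^bsub>P\<^esub> z = \<ominus>\<^bsub>P\<^esub> z" if "z \<in> carrier P" for z
      using P.add.int_pow_neg[of z 1] that by simp
    have "u \<oplus>\<^bsub>P\<^esub> ?e \<oplus>\<^bsub>P\<^esub> \<ominus>\<^bsub>P\<^esub> (v \<oplus>\<^bsub>P\<^esub> ?e) = u \<oplus>\<^bsub>P\<^esub> \<ominus>\<^bsub>P\<^esub> v"
      if "u \<in> carrier P" "v \<in> carrier P" for u v
    proof -
      have "u \<oplus>\<^bsub>P\<^esub> ?e \<oplus>\<^bsub>P\<^esub> \<ominus>\<^bsub>P\<^esub> (v \<oplus>\<^bsub>P\<^esub> ?e) = u \<oplus>\<^bsub>P\<^esub> \<ominus>\<^bsub>P\<^esub> v \<oplus>\<^bsub>P\<^esub> (?e \<oplus>\<^bsub>P\<^esub> \<ominus>\<^bsub>P\<^esub> ?e)"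
        using that e by (simp add: P.minus_add P.a_ac del: P.r_neg)
      then show ?thesis
        using that e by (simp add: P.r_neg)
    qed
    then show ?thesis
      using 0 xy a e
      by (simp add: coboundary_def homotopy_kernel_def i m_assoc eval_nat_numeral)
  qed
qed

lemma coboundary_weave_cancel:
  assumes h: "h \<in> carrier (hochschild_cochains A B P (n + 2))" and ps: "ps \<in> pair_words A (Suc (Suc n))"
  shows "coboundary n (\<lambda>qs. h (tens (weave A qs))) ps \<oplus>\<^bsub>P\<^esub>
    (\<Oplus>\<^bsub>P\<^esub>i\<in>{1..n + 2}. [((-1) ^ i :: int)] \<cdot>\<^bsub>P\<^esub> h (tens (merge_word A (i - 1) (weave A ps)))) = \<zero>\<^bsub>P\<^esub>"
proof -
  note cl = multiadditive_closed[OF hochschild_multiadditive[OF h]]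
  \<comment> \<open>Outside the range of faces the value is zero, since
    \<open>alternating_cancel\<close> asks for a family that lies in the group at every
    index.\<close>
  define c where "c i = (if i \<in> {1..n + 2} then h (tens (merge_word A (i - 1) (weave A ps))) else \<zero>\<^bsub>P\<^esub>)" for i
  have ccl: "c i \<in> carrier P" for i
    using merge_word_closed[of "i - 1" "Suc n" "weave A ps"] weave_closed[OF ps] by (auto simp: c_def intro!: cl)
  have 1: "(\<Oplus>\<^bsub>P\<^esub>i\<in>{1..n + 2}. [((-1) ^ i :: int)] \<cdot>\<^bsub>P\<^esub> h (tens (merge_word A (i - 1) (weave A ps))))
      = (\<Oplus>\<^bsub>P\<^esub>i\<in>{1..n + 2}. [((-1) ^ i :: int)] \<cdot>\<^bsub>P\<^esub> c i)"
    by (rule P.finsum_cong') (use ccl in \<open>auto simp: c_def\<close>)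
  have 2: "(\<Oplus>\<^bsub>P\<^esub>i\<in>{2..n + 1}. [((-1) ^ (i + 1) :: int)] \<cdot>\<^bsub>P\<^esub> h (tens (weave A (merge_pairs A (i - 2) ps))))
      = (\<Oplus>\<^bsub>P\<^esub>i\<in>{2..n + 1}. [((-1) ^ (i + 1) :: int)] \<cdot>\<^bsub>P\<^esub> c i)"
  proof (rule P.finsum_cong')
    fix i assume i: "i \<in> {2..n + 1}"
    define j where "j = i - 2"
    have j: "j \<le> n" "i = Suc (Suc j)"
      using i by (auto simp: j_def)
    show "[((-1) ^ (i + 1) :: int)] \<cdot>\<^bsub>P\<^esub> h (tens (weave A (merge_pairs A (i - 2) ps)))
        = [((-1) ^ (i + 1) :: int)] \<cdot>\<^bsub>P\<^esub> c i"
      using weave_merge_pairs[OF j(1) ps] j by (simp add: c_def)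
  qed (use ccl in auto)
  have "coboundary n (\<lambda>qs. h (tens (weave A qs))) ps = c 1
      \<oplus>\<^bsub>P\<^esub> (\<Oplus>\<^bsub>P\<^esub>i\<in>{2..n + 1}. [((-1) ^ (i + 1) :: int)] \<cdot>\<^bsub>P\<^esub> c i)
      \<oplus>\<^bsub>P\<^esub> [((-1) ^ (n + 3) :: int)] \<cdot>\<^bsub>P\<^esub> c (n + 2)"
    unfolding coboundary_def 2 using weave_merge_first[OF ps] weave_merge_pairs[OF order.refl ps]
    by (simp add: c_def)
  then show ?thesis
    unfolding 1 using P.alternating_cancel[of c n, OF ccl] by simp
qed

section \<open>Phi as the sum of the outer faces\<close>

definition phi_kernel :: "nat \<Rightarrow> ('a tensors \<Rightarrow> 'p) \<Rightarrow> ('a \<times> 'a) list \<Rightarrow> 'p" where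
  "phi_kernel n h ps = hd (weave A ps) \<triangleright>\<^bsub>P\<^esub> h (tens (tl (weave A ps)))
     \<oplus>\<^bsub>P\<^esub> [((-1) ^ (n + 1) :: int)] \<cdot>\<^bsub>P\<^esub> (h (tens (butlast (weave A ps))) \<triangleleft>\<^bsub>P\<^esub> last (weave A ps))"

context
  fixes h n ps
  assumes h: "h \<in> carrier (hochschild_cochains A B P (Suc n))" and ps: "ps \<in> pair_words A (Suc n)"
begin

lemma phi_left_closed: "hd (weave A ps) \<triangleright>\<^bsub>P\<^esub> h (tens (tl (weave A ps))) \<in> carrier P"
  using weave_closed[OF ps] multiadditive_closed[OF hochschild_multiadditive[OF h]]
  by (auto elim!: words_SucE intro!: P.lact_closed)

lemma phi_right_closed: "h (tens (butlast (weave A ps))) \<triangleleft>\<^bsub>P\<^esub> last (weave A ps) \<in> carrier P"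
proof -
  obtain ws x where w: "weave A ps = ws @ [x]"
    by (cases "weave A ps" rule: rev_cases) (simp_all add: weave_def)
  show ?thesis
    using weave_closed[OF ps] multiadditive_closed[OF hochschild_multiadditive[OF h], of ws]
    by (auto simp: w words_def intro!: P.ract_closed)
qed

lemma phi_kernel_closed: "phi_kernel m h ps \<in> carrier P"
  using phi_left_closed phi_right_closed by (simp add: phi_kernel_def)

lemma word_coboundary_weave:
  "word_coboundary (Suc n) (\<lambda>ws. h (tens ws)) (weave A ps) = phi_kernel (Suc n) h ps \<oplus>\<^bsub>P\<^esub>
    (\<Oplus>\<^bsub>P\<^esub>i\<in>{1..Suc n}. [((-1) ^ i :: int)] \<cdot>\<^bsub>P\<^esub> h (tens (merge_word A (i - 1) (weave A ps))))"
proof -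
  have "(\<lambda>i. [((-1) ^ i :: int)] \<cdot>\<^bsub>P\<^esub> h (tens (merge_word A (i - 1) (weave A ps)))) \<in> {1..Suc n} \<rightarrow> carrier P"
    using merge_word_closed[of "_ - 1" n "weave A ps"] weave_closed[OF ps]
      multiadditive_closed[OF hochschild_multiadditive[OF h]] by auto
  note s = P.finsum_closed[OF this]
  show ?thesis
    unfolding word_coboundary_def phi_kernel_def
    using phi_left_closed phi_right_closed s by (simp only: P.a_ac P.add.int_pow_closed P.a_closed)
qed

end

lemma Phi_eq:
  assumes h: "h \<in> carrier (hochschild_cochains A B P (Suc n))" and X: "X \<in> carrier (tensor_group R T (Suc n))"
  shows "Phi A B P (Suc n) h X = sweedler_lift (phi_kernel (Suc n) h) X"
proof -
  let ?l = "\<lambda>ps. hd (weave A ps) \<triangleright>\<^bsub>P\<^esub> h (tens (tl (weave A ps)))"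
  let ?r = "\<lambda>ps. h (tens (butlast (weave A ps))) \<triangleleft>\<^bsub>P\<^esub> last (weave A ps)"
  have ne: "ps \<noteq> []" if "ps \<in> pair_words A (Suc n)" for ps
    using that by (auto simp: pair_words_def)
  note lc = phi_left_closed[OF h] and rc = phi_right_closed[OF h]
  have "pi_left A B P h X = sweedler_lift ?l X"
    unfolding pi_left_def sweedler_lift_def[symmetric]
    by (rule sweedler_lift_cong[OF X, symmetric])
      (use lc in \<open>simp_all add: weave_tl ne\<close>, simp add: weave_def)
  moreover have "pi_right A B P h X = sweedler_lift ?r X"
    unfolding pi_right_def sweedler_lift_def[symmetric]
    by (rule sweedler_lift_cong[OF X, symmetric])
      (use rc in \<open>simp_all add: weave_butlast weave_last[of _ A] ne\<close>)
  moreover have "sweedler_lift (phi_kernel (Suc n) h) X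
      = sweedler_lift ?l X \<oplus>\<^bsub>P\<^esub> [((-1) ^ (Suc n + 1) :: int)] \<cdot>\<^bsub>P\<^esub> sweedler_lift ?r X"
  proof -
    have "sweedler_lift (\<lambda>ps. [((-1) ^ (Suc n + 1) :: int)] \<cdot>\<^bsub>P\<^esub> ?r ps) X
        = [((-1) ^ (Suc n + 1) :: int)] \<cdot>\<^bsub>P\<^esub> sweedler_lift ?r X"
      by (rule sweedler_lift_hom[OF X rc P.int_pow_add_hom])
    moreover have "sweedler_lift (\<lambda>ps. ?l ps \<oplus>\<^bsub>P\<^esub> [((-1) ^ (Suc n + 1) :: int)] \<cdot>\<^bsub>P\<^esub> ?r ps) X
        = sweedler_lift ?l X \<oplus>\<^bsub>P\<^esub> sweedler_lift (\<lambda>ps. [((-1) ^ (Suc n + 1) :: int)] \<cdot>\<^bsub>P\<^esub> ?r ps) X"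
      by (rule sweedler_lift_add[OF X lc]) (use rc in simp_all)
    ultimately show ?thesis
      unfolding phi_kernel_def by (simp only:)
  qed
  ultimately show ?thesis
    using X by (simp add: Phi_def)
qed

section \<open>The homotopy identities\<close>

lemma Phi_homotopy:
  assumes h: "h \<in> carrier (hochschild_cochains A B P (n + 2))"
  shows "Phi A B P (n + 2) h = coring_d A B P n (homotopy n h)
    \<oplus>\<^bsub>coring_cochains A B P (n + 1)\<^esub> homotopy (n + 1) (hochschild_d A B P (n + 2) h)"
proof
  fix X
  let ?d = "hochschild_d A B P (n + 2) h"
  have h': "h \<in> carrier (hochschild_cochains A B P (Suc (Suc n)))"
    using h by simp
  note cl = multiadditive_closed[OF hochschild_multiadditive[OF h]]
  have dcl: "?d (tens ws) \<in> carrier P" if "ws \<in> words (regular A) (Suc n + 2)" for ws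
    using hochschild_d_pure[OF h, of ws] multiadditive_closed[OF multiadditive_word_coboundary[OF h]] that
    by simp
  show "Phi A B P (n + 2) h X = (coring_d A B P n (homotopy n h)
    \<oplus>\<^bsub>coring_cochains A B P (n + 1)\<^esub> homotopy (n + 1) ?d) X"
  proof (cases "X \<in> carrier (tensor_group R T (Suc (Suc n)))")
    case True
    have ccl: "coboundary n (homotopy_kernel n h) ps \<in> carrier P" if ps: "ps \<in> pair_words A (Suc (Suc n))" for ps
    proof -
      have "h (tens (weave A (merge_pairs A j ps))) \<in> carrier P" if "j \<le> n" for j
        using weave_closed[OF merge_pairs_closed[OF that ps]] cl by simp
      moreover have "h (tens (weave A (lact_pairs A (fst (hd ps) \<otimes> snd (hd ps)) (tl ps)))) \<in> carrier P"
        using weave_closed[of "lact_pairs A (fst (hd ps) \<otimes> snd (hd ps)) (tl ps)" n] ps cl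
        by (auto elim!: pair_words_SucE)
      ultimately show ?thesis
        unfolding coboundary_homotopy_kernel[OF h ps]
        unfolding coboundary_def
        by (intro P.a_closed P.finsum_closed P.add.int_pow_closed) auto
    qed
    \<comment> \<open>In positive degree the kernel has no extra term, so it is the value of
      \<open>d h\<close> at the woven word: the outer faces, which form \<open>\<Phi>\<close>, plus
      the inner ones.\<close>
    have dk: "homotopy_kernel (Suc n) ?d ps = phi_kernel (n + 2) h ps \<oplus>\<^bsub>P\<^esub>
      (\<Oplus>\<^bsub>P\<^esub>i\<in>{1..n + 2}. [((-1) ^ i :: int)] \<cdot>\<^bsub>P\<^esub> h (tens (merge_word A (i - 1) (weave A ps))))"
      if ps: "ps \<in> pair_words A (Suc (Suc n))" for ps
      using dcl[of "weave A ps"] hochschild_d_pure[OF h, of "weave A ps"] weave_closed[OF ps]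
        word_coboundary_weave[OF h' ps]
      by (simp add: homotopy_kernel_def)
    have eq: "phi_kernel (n + 2) h ps
        = coboundary n (homotopy_kernel n h) ps \<oplus>\<^bsub>P\<^esub> homotopy_kernel (Suc n) ?d ps"
      if ps: "ps \<in> pair_words A (Suc (Suc n))" for ps
    proof -
      let ?S = "\<Oplus>\<^bsub>P\<^esub>i\<in>{1..n + 2}. [((-1) ^ i :: int)] \<cdot>\<^bsub>P\<^esub> h (tens (merge_word A (i - 1) (weave A ps)))"
      have S: "?S \<in> carrier P"
        using merge_word_closed[of "_ - 1" "Suc n" "weave A ps"] weave_closed[OF ps] cl
        by (intro P.finsum_closed) auto
      have "phi_kernel (n + 2) h ps \<in> carrier P"
        by (rule phi_kernel_closed[OF h' ps])
      \<comment> \<open>The order of summation brings the coboundary next to the inner faces that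
        cancel it.\<close>
      then have "coboundary n (homotopy_kernel n h) ps \<oplus>\<^bsub>P\<^esub> (phi_kernel (n + 2) h ps \<oplus>\<^bsub>P\<^esub> ?S)
          = phi_kernel (n + 2) h ps \<oplus>\<^bsub>P\<^esub> (coboundary n (homotopy_kernel n h) ps \<oplus>\<^bsub>P\<^esub> ?S)"
        using ccl[OF ps] S by (simp only: P.a_ac P.a_closed)
      then show ?thesis
        unfolding dk[OF ps] coboundary_homotopy_kernel[OF h ps] coboundary_weave_cancel[OF h ps]
        using phi_kernel_closed[OF h' ps] by simp
    qed
    have "Phi A B P (n + 2) h X = sweedler_lift (phi_kernel (n + 2) h) X"
      using Phi_eq[OF h' True] by simp
    also have "\<dots> = sweedler_lift (\<lambda>ps. coboundary n (homotopy_kernel n h) ps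
        \<oplus>\<^bsub>P\<^esub> homotopy_kernel (Suc n) ?d ps) X"
      by (rule sweedler_lift_cong[OF True phi_kernel_closed[OF h'] eq])
    also have "\<dots> = sweedler_lift (coboundary n (homotopy_kernel n h)) X \<oplus>\<^bsub>P\<^esub> sweedler_lift (homotopy_kernel (Suc n) ?d) X"
      by (rule sweedler_lift_add[OF True ccl homotopy_kernel_closed[where h = ?d, OF dcl]])
    also have "sweedler_lift (coboundary n (homotopy_kernel n h)) X = coring_d A B P n (homotopy n h) X"
      by (rule coring_d_sweedler_lift[OF equivariant_homotopy_kernel[OF h] _ homotopy_def, symmetric])
        (use True in simp)
    finally show ?thesis
      using True by (simp add: homotopy_def[of "Suc n"] coring_cochains_def hom_module_def)
  qed (simp add: Phi_def coring_cochains_def hom_module_def)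
qed

text \<open>The formulas need not agree on a single pair, as \<open>h\<close> is not assumed linear
  over \<open>A\<close>. Once summed over representatives of \<open>u\<close>, the product becomes
  \<open>\<epsilon>(u)\<close>, which lies in \<open>B\<close>, and
  \<open>h(\<epsilon>(u)) = \<epsilon>(u) h(1)\<close>.\<close>

lemma sweedler_lift_unit:
  assumes h: "h \<in> carrier (hochschild_cochains A B P 1)" and X: "X \<in> carrier (tensor_group R T (Suc 0))"
  shows "sweedler_lift (\<lambda>ps. h (tens [fst (hd ps) \<otimes> snd (hd ps)])) X
    = sweedler_lift (\<lambda>ps. (fst (hd ps) \<otimes> snd (hd ps)) \<triangleright>\<^bsub>P\<^esub> h (tens [\<one>])) X"
  unfolding sweedler_lift_def
proof (rule T.tensor_lift_cong[OF P_group X])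
  have \<phi>: "multiadditive B (regular A) P (Suc 0) (\<lambda>ws. h (tens ws))"
    using hochschild_multiadditive[OF h] by simp
  have cl: "h (tens [a]) \<in> carrier P" if "a \<in> carrier A" for a
    using that by (intro multiadditive_closed[OF \<phi>]) simp
  have f: "(\<lambda>a. h (tens [a])) \<in> hom (add_monoid A) (add_monoid P)"
    using \<phi> by (intro add_homI cl) (auto simp: multiadditive_Suc)
  fix ts assume ts: "ts \<in> words T (Suc 0)"
  then obtain u where u: "ts = [u]" "u \<in> carrier T"
    by (auto elim!: words_SucE)
  show "sweedler P (\<lambda>ps. h (tens [fst (hd ps) \<otimes> snd (hd ps)])) ts \<in> carrier P"
    by (rule sweedler_closed[OF P_group ts]) (auto elim!: pair_words_SucE intro!: cl)
  have c: "counit A u \<in> B"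
    using counit_closed[OF u(2)] by simp
  have "sweedler P (\<lambda>ps. h (tens [fst (hd ps) \<otimes> snd (hd ps)])) ts
      = tensor_lift P (\<lambda>xs. h (tens [xs ! 0 \<otimes> xs ! 1])) u"
    by (simp add: u)
  also have "\<dots> = h (tens [counit A u])"
    unfolding counit_def
    by (rule reg.tensor_lift_hom[OF is_abelian_group P_group T_closed[OF u(2)] _ f, symmetric])
      (auto elim!: words_2E)
  also have "\<dots> = counit A u \<triangleright>\<^bsub>P\<^esub> h (tens [\<one>])"
    using hochschild_lact[OF h _ c, of "[\<one>]"] c by simp
  also have "\<dots> = tensor_lift P (\<lambda>xs. (xs ! 0 \<otimes> xs ! 1) \<triangleright>\<^bsub>P\<^esub> h (tens [\<one>])) u"
    unfolding counit_def
    by (rule reg.tensor_lift_hom[OF is_abelian_group P_group T_closed[OF u(2)] _ lact_left_hom])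
      (auto elim!: words_2E intro!: cl)
  finally show "sweedler P (\<lambda>ps. h (tens [fst (hd ps) \<otimes> snd (hd ps)])) ts
      = sweedler P (\<lambda>ps. (fst (hd ps) \<otimes> snd (hd ps)) \<triangleright>\<^bsub>P\<^esub> h (tens [\<one>])) ts"
    by (simp add: u)
qed

lemma Phi_homotopy_1:
  assumes h: "h \<in> carrier (hochschild_cochains A B P 1)"
  shows "Phi A B P 1 h = homotopy 0 (hochschild_d A B P 1 h)"
proof
  fix X
  let ?d = "hochschild_d A B P (Suc 0) h"
  have h': "h \<in> carrier (hochschild_cochains A B P (Suc 0))"
    using h by simp
  have cl: "h (tens [a]) \<in> carrier P" if "a \<in> carrier A" for a
    using that multiadditive_closed[OF hochschild_multiadditive[OF h], of "[a]"] by simp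
  have i: "[(- 1 :: int)] \<cdot>\<^bsub>P\<^esub> z = \<ominus>\<^bsub>P\<^esub> z" if "z \<in> carrier P" for z
    using P.add.int_pow_neg[of z 1] that by simp
  have d: "?d (tens [x, y]) = x \<triangleright>\<^bsub>P\<^esub> h (tens [y]) \<oplus>\<^bsub>P\<^esub> (\<ominus>\<^bsub>P\<^esub> h (tens [x \<otimes> y])) \<oplus>\<^bsub>P\<^esub> h (tens [x]) \<triangleleft>\<^bsub>P\<^esub> y"
    if "x \<in> carrier A" "y \<in> carrier A" for x y
    using hochschild_d_pure[OF h', of "[x, y]"] that cl
    by (simp add: word_coboundary_def i P.lact_closed P.ract_closed)
  have d1: "?d (tens [\<one>, \<one>]) = h (tens [\<one>])"
    using d[of \<one> \<one>] cl[of \<one>] by (simp add: P.lact_one P.ract_one P.r_neg)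
  show "Phi A B P 1 h X = homotopy 0 (hochschild_d A B P 1 h) X"
  proof (cases "X \<in> carrier (tensor_group R T (Suc 0))")
    case True
    \<comment> \<open>The extra term \<open>?e\<close> and the inner face \<open>?c\<close> are
      equated only after summation. The identity on pairs therefore keeps one on each side, and they
      are cancelled as Sweedler sums at the end.\<close>
    let ?e = "\<lambda>ps. (fst (hd ps) \<otimes> snd (hd ps)) \<triangleright>\<^bsub>P\<^esub> h (tens [\<one>])"
    let ?c = "\<lambda>ps. h (tens [fst (hd ps) \<otimes> snd (hd ps)])"
    have c: "?e ps \<in> carrier P" "?c ps \<in> carrier P" if "ps \<in> pair_words A (Suc 0)" for ps
      using that cl by (auto elim!: pair_words_SucE intro!: P.lact_closed)
    have k: "homotopy_kernel 0 ?d ps \<in> carrier P" "phi_kernel (Suc 0) h ps \<in> carrier P"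
      "homotopy_kernel 0 ?d ps \<oplus>\<^bsub>P\<^esub> ?c ps = phi_kernel (Suc 0) h ps \<oplus>\<^bsub>P\<^esub> ?e ps"
      if ps: "ps \<in> pair_words A (Suc 0)" for ps
    proof -
      obtain x y where xy: "ps = [(x, y)]" "x \<in> carrier A" "y \<in> carrier A"
        using ps by (auto elim!: pair_words_SucE)
      have t: "x \<triangleright>\<^bsub>P\<^esub> h (tens [y]) \<in> carrier P" "h (tens [x]) \<triangleleft>\<^bsub>P\<^esub> y \<in> carrier P"
        "h (tens [x \<otimes> y]) \<in> carrier P" "(x \<otimes> y) \<triangleright>\<^bsub>P\<^esub> h (tens [\<one>]) \<in> carrier P"
        using xy cl by (simp_all add: P.lact_closed P.ract_closed)
      show "homotopy_kernel 0 ?d ps \<in> carrier P" "phi_kernel (Suc 0) h ps \<in> carrier P"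
        using xy t by (simp_all add: homotopy_kernel_def phi_kernel_def d d1)
      have "l \<oplus>\<^bsub>P\<^esub> \<ominus>\<^bsub>P\<^esub> m \<oplus>\<^bsub>P\<^esub> r \<oplus>\<^bsub>P\<^esub> e \<oplus>\<^bsub>P\<^esub> m = l \<oplus>\<^bsub>P\<^esub> r \<oplus>\<^bsub>P\<^esub> e"
        if "l \<in> carrier P" "m \<in> carrier P" "r \<in> carrier P" "e \<in> carrier P" for l m r e
      proof -
        have "l \<oplus>\<^bsub>P\<^esub> \<ominus>\<^bsub>P\<^esub> m \<oplus>\<^bsub>P\<^esub> r \<oplus>\<^bsub>P\<^esub> e \<oplus>\<^bsub>P\<^esub> m = l \<oplus>\<^bsub>P\<^esub> r \<oplus>\<^bsub>P\<^esub> e \<oplus>\<^bsub>P\<^esub> (m \<oplus>\<^bsub>P\<^esub> \<ominus>\<^bsub>P\<^esub> m)"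
          using that by (simp add: P.a_ac del: P.r_neg)
        then show ?thesis
          using that by (simp add: P.r_neg)
      qed
      then show "homotopy_kernel 0 ?d ps \<oplus>\<^bsub>P\<^esub> ?c ps = phi_kernel (Suc 0) h ps \<oplus>\<^bsub>P\<^esub> ?e ps"
        using xy t by (simp add: homotopy_kernel_def phi_kernel_def d d1)
    qed
    have "sweedler_lift (homotopy_kernel 0 ?d) X \<oplus>\<^bsub>P\<^esub> sweedler_lift ?c X
        = sweedler_lift (\<lambda>ps. homotopy_kernel 0 ?d ps \<oplus>\<^bsub>P\<^esub> ?c ps) X"
      by (rule sweedler_lift_add[OF True k(1) c(2), symmetric])
    also have "\<dots> = sweedler_lift (\<lambda>ps. phi_kernel (Suc 0) h ps \<oplus>\<^bsub>P\<^esub> ?e ps) X"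
      by (rule sweedler_lift_cong[OF True]) (use k c in auto)
    also have "\<dots> = sweedler_lift (phi_kernel (Suc 0) h) X \<oplus>\<^bsub>P\<^esub> sweedler_lift ?e X"
      by (rule sweedler_lift_add[OF True k(2) c(1)])
    also have "sweedler_lift ?e X = sweedler_lift ?c X"
      by (rule sweedler_lift_unit[OF h True, symmetric])
    finally have "sweedler_lift (homotopy_kernel 0 ?d) X = sweedler_lift (phi_kernel (Suc 0) h) X"
      using sweedler_lift_closed[OF True k(1)] sweedler_lift_closed[OF True k(2)]
        sweedler_lift_closed[OF True c(2)] by (simp add: P.add.right_cancel)
    then show ?thesis
      using Phi_eq[OF h' True] True by (simp add: homotopy_def)
  qed (simp add: Phi_def homotopy_def)
qed

end

theorem proposition5p3:
  fixes K :: "'k ring" and A :: "('k, 'a) module" and B :: "'a set"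
    and P :: "('a, 'p) bimodule"
  assumes "assoc_algebra K A"
    and "unital_subalgebra K A B"
    and "irreducible_extension A B"
    and "bimodule_over K A P"
  shows "nullhomotopic K
           (hochschild_cochains A B P) (hochschild_d A B P)
           (coring_cochains A B P) (coring_d A B P)
           (Phi A B P)"
proof -
  interpret alg: assoc_algebra K A
    by fact
  interpret irreducible_extension_bimodule A B P
  proof (intro irreducible_extension_bimodule.intro irreducible_ring_extension.intro
      irreducible_ring_extension_axioms.intro)
    show "ring A"
      by (rule alg.ring_axioms)
    show "subring B A"
      using assms(2) by (simp add: unital_subalgebra_def)
    show "centralizer A B \<subseteq> B"
      using assms(3) by (simp add: irreducible_extension_def)
    show "bimodule A P"
      using assms(4) by (simp add: bimodule_over_def)
  qed
  \<comment> \<open>The locale of the homotopy does not mention \<open>K\<close>. These are the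
    facts on scalars that \<open>homotopy_smult\<close> takes as assumptions; centrality of
    \<open>k 1\<close> follows from the two algebra axioms.\<close>
  have scalar: "k \<odot>\<^bsub>A\<^esub> \<one>\<^bsub>A\<^esub> \<in> carrier A"
    "x \<in> carrier A \<Longrightarrow> (k \<odot>\<^bsub>A\<^esub> \<one>\<^bsub>A\<^esub>) \<otimes>\<^bsub>A\<^esub> x = x \<otimes>\<^bsub>A\<^esub> (k \<odot>\<^bsub>A\<^esub> \<one>\<^bsub>A\<^esub>)" if "k \<in> carrier K" for k x
    using that by (simp_all add: alg.smult_mult_left alg.smult_mult_right)
  show ?thesis
    unfolding nullhomotopic_def
  proof (intro exI[of _ homotopy] conjI allI ballI)
    fix n
    show "homotopy n \<in> linear_maps K (hochschild_cochains A B P (n + 2)) (coring_cochains A B P n)"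
      \<comment> \<open>The index is kept as \<open>n + 2\<close>, the form in which the facts on
        the homotopy are stated.\<close>
      unfolding linear_maps_def
      by (auto intro!: add_homI homotopy_cochain homotopy_additive homotopy_smult scalar simp del: add_2_eq_Suc')
  next
    fix n h assume "h \<in> carrier (hochschild_cochains A B P (n + 2))"
    then show "Phi A B P (n + 2) h = coring_d A B P n (homotopy n h)
        \<oplus>\<^bsub>coring_cochains A B P (n + 1)\<^esub> homotopy (n + 1) (hochschild_d A B P (n + 2) h)"
      by (rule Phi_homotopy)
  next
    fix h assume "h \<in> carrier (hochschild_cochains A B P 1)"
    then show "Phi A B P 1 h = homotopy 0 (hochschild_d A B P 1 h)"
      by (rule Phi_homotopy_1)
  qed
qed

end
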